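(* Let $\widehat{\boldsymbol u}_D^h\in V^h$ with $\mathrm{div}_h\widehat{\boldsymbol u}_D^h=0$ a.e. in $\Omega$, let $\boldsymbol f_h\in(\mathbb P^0(\mathcal T_h))^d$ and $\boldsymbol F_h\in(\mathbb P^0(\mathcal T_h))^{d\times d}$, and let $\nu>0$. Then the following statements apply. (i) Given the discrete primal solution $\boldsymbol u_h\in K^h_{\boldsymbol u}$ and a discrete Lagrange multiplier $p_h\in\mathbb P^0(\mathcal T_h)$ such that for every $\boldsymbol v_h\in V^h_D$ $$(\nu\nabla_h(\boldsymbol u_h+\widehat{\boldsymbol u}^h_D)-p_h\boldsymbol I,\nabla_h\boldsymbol v_h)_\Omega=(\boldsymbol f_h,\boldsymbol v_h)_\Omega+(\boldsymbol F_h,\nabla_h\boldsymbol v_h)_\Omega ,$$ the discrete dual solution $\boldsymbol T_h\in K^h_{\boldsymbol T}$ is given by $$\boldsymbol T_h=\nu\nabla_h(\boldsymbol u_h+\widehat{\boldsymbol u}_D^h)-p_h\boldsymbol I-\tfrac1d\,\boldsymbol f_h\otimes(\mathrm{id}_{\mathbb R^d}-\Pi_h\mathrm{id}_{\mathbb R^d})\quad\text{a.e. in }\Omega .$$ (ii) Given the discrete dual solution $\boldsymbol T_h\in K^h_{\boldsymbol T}$ and a discrete Lagrange multiplier $\overline{\boldsymbol u}_h\in(\mathbb P^0(\mathcal T_h))^d$ such that for every $\boldsymbol\tau_h\in\Sigma^h_N$ $$-\tfrac1\nu(\mathrm{dev}\,\Pi_h\boldsymbol T_h,\mathrm{dev}\,\Pi_h\boldsymbol\tau_h)_\Omega-(\overline{\boldsymbol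 u}_h,\mathrm{div}\,\boldsymbol\tau_h)_\Omega=-(\nabla_h\widehat{\boldsymbol u}^h_D,\mathrm{dev}\,\Pi_h\boldsymbol\tau_h)_\Omega ,$$ the discrete primal solution $\boldsymbol u_h\in K^h_{\boldsymbol u}$ is given by $$\boldsymbol u_h=\overline{\boldsymbol u}_h+\tfrac1\nu\,\mathrm{dev}\,\Pi_h\boldsymbol T_h\,(\mathrm{id}_{\mathbb R^d}-\Pi_h\mathrm{id}_{\mathbb R^d})\quad\text{a.e. in }\Omega .$$
   Context: Domain. $d\ge 2$; $\Omega\subset\mathbb R^d$ is a bounded polyhedral Lipschitz domain whose boundary is divided into disjoint relatively open parts $\Gamma_D\neq\emptyset$ and $\Gamma_N$ with $\overline\Gamma_D\cup\overline\Gamma_N=\partial\Omega$. $(\cdot,\cdot)_\Omega$, $\|\cdot\|_\Omega$ denote the $L^2(\Omega)$ inner product and norm (scalar, vector or matrix valued). For matrices, $\mathrm{dev}\,\boldsymbol A=\boldsymbol A-\frac1d\mathrm{tr}(\boldsymbol A)\boldsymbol I$ with $\boldsymbol I$ the identity matrix; $(\nabla\boldsymbol v)_{ij}=\partial_j v_i$; the divergence of a matrix field is taken row-wise; $(\boldsymbol a\otimes\boldsymbol b)_{ij}=a_ib_j$. Mesh and spaces. $\mathcal T_h$ is a triangulation of $\Omega$ into closed simplices (from a shape-regular family), with each boundary side (codimension-one face) lying in $\overline\Gamma_D$ or in $\overline\Gamma_N$. $\mathbb P^k(\mathcal T_h)$: functions that are polynomials of degree at most $k$ on each $T\in\mathcal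 T_h$. $\Pi_h$: element-wise mean (the $L^2$-projection onto element-wise constants, applied componentwise). $\mathrm{id}_{\mathbb R^d}$ is the identity map $x\mapsto x$, so $(\mathrm{id}_{\mathbb R^d}-\Pi_h\mathrm{id}_{\mathbb R^d})|_T(x)=x-x_T$ with $x_T$ the barycentre of $T$. $\nabla_h$, $\mathrm{div}_h$: element-wise gradient and divergence. Crouzeix–Raviart space: $V^h$ is the set of $\boldsymbol v_h\in(\mathbb P^1(\mathcal T_h))^d$ whose jump has zero mean over every interior side; $V^h_D$ is the set of $\boldsymbol v_h\in V^h$ having zero mean over every side in $\overline\Gamma_D$. Raviart–Thomas space: $\Sigma^h$ is the set of $\boldsymbol\tau_h\in(\mathbb P^1(\mathcal T_h))^{d\times d}$ such that, for each $T$, $\boldsymbol\tau_h|_T\boldsymbol n_T$ is constant on each side of $T$, and the normal component $\boldsymbol\tau_h\boldsymbol n$ is continuous across interior sides; $\Sigma^h_N=\{\boldsymbol\tau_h\in\Sigma^h:\boldsymbol\tau_h\boldsymbol n=\boldsymbol 0\text{ on }\Gamma_N\}$. Discrete incompressible Stokes problem. Put $K^h_{\boldsymbol u}=\{\boldsymbol v_h\in V_D^h:\mathrm{div}_h\boldsymbol v_h=0\text{ a.e. in }\Omega\}$ and, for $\boldsymbol v_h\in K^h_{\boldsymbol u}$, $$I_h(\boldsymbol v_h)=\tfrac\nu2\|\nabla_h(\boldsymbol v_h+\widehat{\boldsymbol u}_D^h)\|_\Omega^2-(\boldsymbol f_h,\Pi_h\boldsymbol v_h)_\Omega-(\boldsymbol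 F_h,\nabla_h\boldsymbol v_h)_\Omega$$ ($I_h=+\infty$ on $V_D^h\setminus K^h_{\boldsymbol u}$). The discrete primal solution $\boldsymbol u_h\in K^h_{\boldsymbol u}$ (discrete velocity) is the unique minimiser of $I_h$; $p_h$ is the discrete pressure. Put $K^h_{\boldsymbol T}=\{\boldsymbol\tau_h\in\boldsymbol F_h+\Sigma^h_N:\mathrm{div}(\boldsymbol\tau_h-\boldsymbol F_h)=-\boldsymbol f_h\text{ a.e. in }\Omega\}$ and, for $\boldsymbol\tau_h\in K^h_{\boldsymbol T}$, $$D_h(\boldsymbol\tau_h)=-\tfrac1{2\nu}\|\mathrm{dev}\,\Pi_h\boldsymbol\tau_h\|_\Omega^2+(\mathrm{dev}\,\Pi_h\boldsymbol\tau_h,\nabla_h\widehat{\boldsymbol u}_D^h)_\Omega$$ ($D_h=-\infty$ on $(\boldsymbol F_h+\Sigma_N^h)\setminus K^h_{\boldsymbol T}$). The discrete dual solution $\boldsymbol T_h\in K_{\boldsymbol T}^h$ (discrete stress) is the maximiser of $D_h$; if $\Gamma_D=\partial\Omega$, uniqueness of its trace part is understood via the usual zero-mean normalisation $\int_\Omega\mathrm{tr}(\boldsymbol T_h)\,\mathrm dx=0$ (with $p_h$ correspondingly of zero mean).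
   Formalization: In (ii) the printed recovery formula is false unless ∇_h û_D^h = 0; the formal statement proves the corrected formula u_h = ū_h + ((1/ν) dev Π_h T_h − ∇_h û_D^h)(id − Π_h id), which agrees with the printed one when ∇_h û_D^h = 0. *)

theory Defs
  imports "HOL-Analysis.Analysis"
begin

section \<open>Matrix algebra\<close>

definition dev :: "real^'n^'n \<Rightarrow> real^'n^'n" where
  "dev A = A - (trace A / real CARD('n)) *\<^sub>R mat 1"

definition outer :: "real^'n \<Rightarrow> real^'n \<Rightarrow> real^'n^'n"  (infixl \<open>\<otimes>\<^sub>v\<close> 75) where
  "a \<otimes>\<^sub>v b = (\<chi> i j. a $ i * b $ j)"


section \<open>The domain, its boundary parts and the triangulation\<close>

text \<open>Near each boundary point, \<open>\<Omega>\<close> is the strict epigraph, in some direction \<open>e\<close>, of a Lipschitz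
  function defined on the hyperplane orthogonal to \<open>e\<close>.\<close>

definition polyhedral_lipschitz_domain :: "(real^'n) set \<Rightarrow> bool" where
  "polyhedral_lipschitz_domain \<Omega> \<longleftrightarrow>
     open \<Omega> \<and> connected \<Omega> \<and> bounded \<Omega> \<and> \<Omega> \<noteq> {} \<and>
     (\<exists>\<P>. finite \<P> \<and> (\<forall>P\<in>\<P>. polytope P) \<and> closure \<Omega> = \<Union>\<P>) \<and>
     (\<forall>z\<in>frontier \<Omega>. \<exists>e r L \<phi>. norm e = 1 \<and> 0 < r \<and> L-lipschitz_on {y. e \<bullet> y = 0} \<phi> \<and>
        (\<forall>x\<in>ball z r. x \<in> \<Omega> \<longleftrightarrow> \<phi> (x - (e \<bullet> x) *\<^sub>R e) < e \<bullet> x))"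

definition boundary_parts :: "(real^'n) set \<Rightarrow> (real^'n) set \<Rightarrow> (real^'n) set \<Rightarrow> bool" where
  "boundary_parts \<Omega> \<Gamma>D \<Gamma>N \<longleftrightarrow>
     openin (top_of_set (frontier \<Omega>)) \<Gamma>D \<and> openin (top_of_set (frontier \<Omega>)) \<Gamma>N \<and>
     \<Gamma>D \<inter> \<Gamma>N = {} \<and> \<Gamma>D \<noteq> {} \<and> closure \<Gamma>D \<union> closure \<Gamma>N = frontier \<Omega>"

definition mesh_of ::
    "(real^'n) set \<Rightarrow> (real^'n) set \<Rightarrow> (real^'n) set \<Rightarrow> (real^'n) set set \<Rightarrow> bool" where
  "mesh_of \<Omega> \<Gamma>D \<Gamma>N \<T> \<longleftrightarrow>
     triangulation \<T> \<and> (\<forall>T\<in>\<T>. int CARD('n) simplex T) \<and> \<Union>\<T> = closure \<Omega> \<and>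
     (\<forall>T\<in>\<T>. \<forall>S. S facet_of T \<and> S \<subseteq> frontier \<Omega> \<longrightarrow> S \<subseteq> closure \<Gamma>D \<or> S \<subseteq> closure \<Gamma>N)"

definition outer_normal :: "(real^'n) set \<Rightarrow> (real^'n) set \<Rightarrow> real^'n" where
  "outer_normal T S = (THE n. norm n = 1 \<and>
     (\<exists>b. T \<subseteq> {x. n \<bullet> x \<le> b} \<and> S = T \<inter> {x. n \<bullet> x = b}))"


section \<open>Means\<close>

definition mean :: "(real^'n) set \<Rightarrow> (real^'n \<Rightarrow> 'b::euclidean_space) \<Rightarrow> 'b" where
  "mean A w = integral A w /\<^sub>R measure lebesgue A"

text \<open>The mean over a flat side \<open>S\<close> is taken with respect to the \<open>(d-1)\<close>-dimensional measure. By
  Fubini, the mean over \<open>S\<close> equals the Lebesgue mean, over the straight cylinder with mid-section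
  \<open>S\<close>, of the function extended constantly in the normal direction; here \<open>closest_point\<close> is the
  orthogonal projection onto the hyperplane of \<open>S\<close>, and the height of the cylinder cancels.\<close>

definition side_cylinder :: "(real^'n) set \<Rightarrow> (real^'n) set" where
  "side_cylinder S = {x. closest_point (affine hull S) x \<in> S \<and>
                         dist x (closest_point (affine hull S) x) \<le> 1}"

definition side_mean :: "(real^'n) set \<Rightarrow> (real^'n \<Rightarrow> 'b::euclidean_space) \<Rightarrow> 'b" where
  "side_mean S w = mean (side_cylinder S) (\<lambda>x. w (closest_point (affine hull S) x))"


section \<open>Element-wise polynomials and operators\<close>

text \<open>Piecewise functions are total functions that are prescribed on the interiors of the elements
  only; their values on the (null) mesh skeleton are irrelevant. On the sides of \<open>T\<close>, the
  restriction to \<open>T\<close> is the limit from the interior of \<open>T\<close>.\<close>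

definition Pk :: "nat \<Rightarrow> (real^'n) set set \<Rightarrow> (real^'n \<Rightarrow> 'b::euclidean_space) set" where
  "Pk k \<T> = {v. \<forall>T\<in>\<T>. \<exists>c. \<forall>x\<in>interior T.
     v x = (\<Sum>\<alpha> | (\<Sum>i\<in>UNIV. \<alpha> i) \<le> k. (\<Prod>i\<in>UNIV. (x $ i) ^ \<alpha> i) *\<^sub>R c \<alpha>)}"

definition restr :: "(real^'n) set \<Rightarrow> (real^'n \<Rightarrow> 'b::euclidean_space) \<Rightarrow> real^'n \<Rightarrow> 'b" where
  "restr T v x = Lim (at x within interior T) v"

definition \<Pi>h :: "(real^'n) set set \<Rightarrow> (real^'n \<Rightarrow> 'b::euclidean_space) \<Rightarrow> real^'n \<Rightarrow> 'b" where
  "\<Pi>h \<T> w x = (\<Sum>T\<in>\<T>. indicator (interior T) x *\<^sub>R mean T w)"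

definition gradh :: "(real^'n \<Rightarrow> real^'n) \<Rightarrow> real^'n \<Rightarrow> real^'n^'n" where
  "gradh v x = jacobian v (at x)"

definition divh :: "(real^'n \<Rightarrow> real^'n) \<Rightarrow> real^'n \<Rightarrow> real" where
  "divh v x = trace (jacobian v (at x))"

text \<open>For fields whose normal component is continuous across interior sides, the element-wise
  divergence is the weak one.\<close>

definition Divh :: "(real^'n \<Rightarrow> real^'n^'n) \<Rightarrow> real^'n \<Rightarrow> real^'n" where
  "Divh \<tau> x = (\<chi> i. divh (\<lambda>y. \<tau> y $ i) x)"

text \<open>On matrix fields the inner product of \<^typ>\<open>real^'n^'n\<close> is the Frobenius product.\<close>

definition l2_inner ::
    "(real^'n) set \<Rightarrow> (real^'n \<Rightarrow> 'b::euclidean_space) \<Rightarrow> (real^'n \<Rightarrow> 'b) \<Rightarrow> real" where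
  "l2_inner \<Omega> v w = integral \<Omega> (\<lambda>x. v x \<bullet> w x)"

definition l2_norm :: "(real^'n) set \<Rightarrow> (real^'n \<Rightarrow> 'b::euclidean_space) \<Rightarrow> real" where
  "l2_norm \<Omega> v = sqrt (l2_inner \<Omega> v v)"


section \<open>Crouzeix--Raviart and Raviart--Thomas spaces\<close>

definition CR :: "(real^'n) set set \<Rightarrow> (real^'n \<Rightarrow> real^'n) set" where
  "CR \<T> = {v \<in> Pk 1 \<T>. \<forall>T\<in>\<T>. \<forall>T'\<in>\<T>. \<forall>S. T \<noteq> T' \<and> S facet_of T \<and> S facet_of T' \<longrightarrow>
     side_mean S (\<lambda>x. restr T v x - restr T' v x) = 0}"

definition CR_D :: "(real^'n) set set \<Rightarrow> (real^'n) set \<Rightarrow> (real^'n \<Rightarrow> real^'n) set" where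
  "CR_D \<T> \<Gamma>D = {v \<in> CR \<T>. \<forall>T\<in>\<T>. \<forall>S. S facet_of T \<and> S \<subseteq> closure \<Gamma>D \<longrightarrow>
     side_mean S (restr T v) = 0}"

definition RT :: "(real^'n) set set \<Rightarrow> (real^'n \<Rightarrow> real^'n^'n) set" where
  "RT \<T> = {\<tau> \<in> Pk 1 \<T>.
     (\<forall>T\<in>\<T>. \<forall>S. S facet_of T \<longrightarrow> (\<exists>c. \<forall>x\<in>S. restr T \<tau> x *v outer_normal T S = c)) \<and>
     (\<forall>T\<in>\<T>. \<forall>T'\<in>\<T>. \<forall>S. T \<noteq> T' \<and> S facet_of T \<and> S facet_of T' \<longrightarrow>
        (\<forall>x\<in>S. restr T \<tau> x *v outer_normal T S = restr T' \<tau> x *v outer_normal T S))}"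

definition RT_N ::
    "(real^'n) set \<Rightarrow> (real^'n) set set \<Rightarrow> (real^'n) set \<Rightarrow> (real^'n \<Rightarrow> real^'n^'n) set" where
  "RT_N \<Omega> \<T> \<Gamma>N = {\<tau> \<in> RT \<T>. \<forall>T\<in>\<T>. \<forall>S. S facet_of T \<and> S \<subseteq> frontier \<Omega> \<longrightarrow>
     (\<forall>x\<in>S \<inter> \<Gamma>N. restr T \<tau> x *v outer_normal T S = 0)}"


section \<open>The discrete primal problem\<close>

definition K_u ::
    "(real^'n) set \<Rightarrow> (real^'n) set set \<Rightarrow> (real^'n) set \<Rightarrow> (real^'n \<Rightarrow> real^'n) set" where
  "K_u \<Omega> \<T> \<Gamma>D = {v \<in> CR_D \<T> \<Gamma>D. AE x in lebesgue_on \<Omega>. divh v x = 0}"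

definition I_h ::
    "(real^'n) set \<Rightarrow> (real^'n) set set \<Rightarrow> (real^'n) set \<Rightarrow> real \<Rightarrow>
     (real^'n \<Rightarrow> real^'n) \<Rightarrow> (real^'n \<Rightarrow> real^'n^'n) \<Rightarrow> (real^'n \<Rightarrow> real^'n) \<Rightarrow>
     (real^'n \<Rightarrow> real^'n) \<Rightarrow> ereal" where
  "I_h \<Omega> \<T> \<Gamma>D \<nu> f F uD v =
     (if v \<in> K_u \<Omega> \<T> \<Gamma>D
      then ereal (\<nu> / 2 * (l2_norm \<Omega> (gradh (\<lambda>x. v x + uD x)))\<^sup>2
                  - l2_inner \<Omega> f (\<Pi>h \<T> v) - l2_inner \<Omega> F (gradh v))
      else \<infinity>)"

definition primal_solution ::
    "(real^'n) set \<Rightarrow> (real^'n) set set \<Rightarrow> (real^'n) set \<Rightarrow> real \<Rightarrow>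
     (real^'n \<Rightarrow> real^'n) \<Rightarrow> (real^'n \<Rightarrow> real^'n^'n) \<Rightarrow> (real^'n \<Rightarrow> real^'n) \<Rightarrow>
     (real^'n \<Rightarrow> real^'n) \<Rightarrow> bool" where
  "primal_solution \<Omega> \<T> \<Gamma>D \<nu> f F uD u \<longleftrightarrow>
     u \<in> K_u \<Omega> \<T> \<Gamma>D \<and>
     (\<forall>v\<in>CR_D \<T> \<Gamma>D. I_h \<Omega> \<T> \<Gamma>D \<nu> f F uD u \<le> I_h \<Omega> \<T> \<Gamma>D \<nu> f F uD v)"


section \<open>The discrete dual problem\<close>

definition shifted_RT_N ::
    "(real^'n) set \<Rightarrow> (real^'n) set set \<Rightarrow> (real^'n) set \<Rightarrow> (real^'n \<Rightarrow> real^'n^'n) \<Rightarrow>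
     (real^'n \<Rightarrow> real^'n^'n) set" where
  "shifted_RT_N \<Omega> \<T> \<Gamma>N F = {\<lambda>x. F x + \<sigma> x | \<sigma>. \<sigma> \<in> RT_N \<Omega> \<T> \<Gamma>N}"

definition K_T ::
    "(real^'n) set \<Rightarrow> (real^'n) set set \<Rightarrow> (real^'n) set \<Rightarrow>
     (real^'n \<Rightarrow> real^'n) \<Rightarrow> (real^'n \<Rightarrow> real^'n^'n) \<Rightarrow> (real^'n \<Rightarrow> real^'n^'n) set" where
  "K_T \<Omega> \<T> \<Gamma>N f F = {\<tau> \<in> shifted_RT_N \<Omega> \<T> \<Gamma>N F.
     AE x in lebesgue_on \<Omega>. Divh (\<lambda>y. \<tau> y - F y) x = - f x}"

definition D_h ::
    "(real^'n) set \<Rightarrow> (real^'n) set set \<Rightarrow> (real^'n) set \<Rightarrow> real \<Rightarrow>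
     (real^'n \<Rightarrow> real^'n) \<Rightarrow> (real^'n \<Rightarrow> real^'n^'n) \<Rightarrow> (real^'n \<Rightarrow> real^'n) \<Rightarrow>
     (real^'n \<Rightarrow> real^'n^'n) \<Rightarrow> ereal" where
  "D_h \<Omega> \<T> \<Gamma>N \<nu> f F uD \<tau> =
     (if \<tau> \<in> K_T \<Omega> \<T> \<Gamma>N f F
      then ereal (- (1 / (2 * \<nu>)) * (l2_norm \<Omega> (\<lambda>x. dev (\<Pi>h \<T> \<tau> x)))\<^sup>2
                  + l2_inner \<Omega> (\<lambda>x. dev (\<Pi>h \<T> \<tau> x)) (gradh uD))
      else - \<infinity>)"

text \<open>In the pure Dirichlet case, maximisers are unique only up to a constant multiple of the
  identity, which the normalisation fixes. This case is expressed as \<open>\<Gamma>N = {}\<close>, equivalently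
  \<open>closure \<Gamma>D = frontier \<Omega>\<close>; testing \<open>\<Gamma>D = frontier \<Omega>\<close> would miss a \<open>\<Gamma>D\<close> from which a nonempty
  nowhere dense subset of the boundary has been removed.\<close>

definition dual_solution ::
    "(real^'n) set \<Rightarrow> (real^'n) set set \<Rightarrow> (real^'n) set \<Rightarrow> real \<Rightarrow>
     (real^'n \<Rightarrow> real^'n) \<Rightarrow> (real^'n \<Rightarrow> real^'n^'n) \<Rightarrow> (real^'n \<Rightarrow> real^'n) \<Rightarrow>
     (real^'n \<Rightarrow> real^'n^'n) \<Rightarrow> bool" where
  "dual_solution \<Omega> \<T> \<Gamma>N \<nu> f F uD T \<longleftrightarrow>
     T \<in> K_T \<Omega> \<T> \<Gamma>N f F \<and>
     (\<forall>\<tau>\<in>shifted_RT_N \<Omega> \<T> \<Gamma>N F. D_h \<Omega> \<T> \<Gamma>N \<nu> f F uD \<tau> \<le> D_h \<Omega> \<T> \<Gamma>N \<nu> f F uD T) \<and>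
     (\<Gamma>N = {} \<longrightarrow> integral \<Omega> (\<lambda>x. trace (T x)) = 0)"


section \<open>Lagrange multipliers\<close>

definition primal_multiplier ::
    "(real^'n) set \<Rightarrow> (real^'n) set set \<Rightarrow> (real^'n) set \<Rightarrow> (real^'n) set \<Rightarrow> real \<Rightarrow>
     (real^'n \<Rightarrow> real^'n) \<Rightarrow> (real^'n \<Rightarrow> real^'n^'n) \<Rightarrow> (real^'n \<Rightarrow> real^'n) \<Rightarrow>
     (real^'n \<Rightarrow> real^'n) \<Rightarrow> (real^'n \<Rightarrow> real) \<Rightarrow> bool" where
  "primal_multiplier \<Omega> \<T> \<Gamma>D \<Gamma>N \<nu> f F uD u p \<longleftrightarrow>
     p \<in> Pk 0 \<T> \<and> (\<Gamma>N = {} \<longrightarrow> integral \<Omega> p = 0) \<and>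
     (\<forall>v\<in>CR_D \<T> \<Gamma>D.
        l2_inner \<Omega> (\<lambda>x. \<nu> *\<^sub>R gradh (\<lambda>y. u y + uD y) x - p x *\<^sub>R mat 1) (gradh v)
        = l2_inner \<Omega> f v + l2_inner \<Omega> F (gradh v))"

text \<open>The equation below, with \<open>tr (gradh uD) = 0\<close>, says that \<open>ubar\<close> is the element-wise mean of a
  Crouzeix--Raviart function whose gradient is \<open>dev (\<Pi>h T) / \<nu> - gradh uD\<close>, not
  \<open>dev (\<Pi>h T) / \<nu>\<close>: the latter is the gradient of the primal solution shifted by \<open>uD\<close>. Hence the
  recovery formula for the unshifted primal solution needs the term \<open>- gradh uD\<close>. It is missing in
  the source formula, which is correct only if \<open>gradh uD\<close> vanishes.\<close>

definition dual_multiplier ::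
    "(real^'n) set \<Rightarrow> (real^'n) set set \<Rightarrow> (real^'n) set \<Rightarrow> real \<Rightarrow>
     (real^'n \<Rightarrow> real^'n) \<Rightarrow> (real^'n \<Rightarrow> real^'n^'n) \<Rightarrow> (real^'n \<Rightarrow> real^'n) \<Rightarrow> bool" where
  "dual_multiplier \<Omega> \<T> \<Gamma>N \<nu> uD T ubar \<longleftrightarrow>
     ubar \<in> Pk 0 \<T> \<and>
     (\<forall>\<tau>\<in>RT_N \<Omega> \<T> \<Gamma>N.
        - (1 / \<nu>) * l2_inner \<Omega> (\<lambda>x. dev (\<Pi>h \<T> T x)) (\<lambda>x. dev (\<Pi>h \<T> \<tau> x))
          - l2_inner \<Omega> ubar (Divh \<tau>)
        = - l2_inner \<Omega> (gradh uD) (\<lambda>x. dev (\<Pi>h \<T> \<tau> x)))"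

end

theory Submission
  imports Defs
begin

text \<open>On each element, a Crouzeix--Raviart function \<open>v\<close> is \<open>b + A (x - x\<^sub>T)\<close> and a Raviart--Thomas field \<open>\<tau>\<close> is
  \<open>C + a \<otimes> (x - x\<^sub>T)\<close>. The discrete integration by parts turns \<open>(\<nabla>v, \<tau>) + (v, div \<tau>)\<close> into the sum, over all
  elements and their sides, of the value of \<open>v\<close> at the barycentre of the side times the flux of \<open>\<tau>\<close>
  through it. The sum vanishes if \<open>v\<close> and \<open>\<tau>\<close> lie in the two discrete spaces and, conversely, testing
  with basis functions shows that a piecewise field orthogonal in this sense to one space lies in the
  other. Each multiplier equation states such an orthogonality for the reconstructed field, which is
  therefore admissible. Its optimality is a quadratic expansion whose linear term vanishes by the same
  formula. For uniqueness, the difference of two solutions is piecewise constant, and the mesh is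
  connected through its sides, because removing sets of codimension two does not disconnect \<open>\<Omega>\<close>.\<close>

text \<open>The notions are analytic (side means over cylinders, limits at sides, identities almost
  everywhere), but the argument is finite linear algebra in the coefficients \<open>b\<close>,
  \<open>A\<close> and \<open>C\<close>, \<open>a\<close> on the elements. No surface measure is
  computed: from volume = height * area / d, the area-weighted outer normal of a side is
  \<open>- d vol bgrad\<close>. The two facts that need a change of variables, equal integrals of
  the barycentric coordinates and the volume ratio of two neighbours, both come from maps of the
  form x + (g . x + beta) w. The factor 1/d of the stress formula inverts div (a (x) (x - c)) = d a.
  The mesh is only given as face-to-face; that two elements at a side lie on opposite sides of it,
  that no third one meets it, that unshared sides lie on the boundary and that such sides cover the
  boundary all have to be derived. The last fact supplies the Dirichlet side from which uniqueness
  of the velocity starts.\<close>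

section \<open>Rank-one affine maps and the Lebesgue integral\<close>

text \<open>The matrix differs from the identity only in column \<open>k\<close>, which is
  \<open>axis k 1 + c w\<close>; Cramer's rule for the identity reads the determinant off as the
  \<open>k\<close>-th entry of that column.\<close>

lemma det_mat_plus_outer_axis:
  fixes w :: "real^'n"
  shows "det (mat 1 + w \<otimes>\<^sub>v (c *\<^sub>R axis k 1)) = 1 + c * w $ k"
proof -
  have "(mat 1 + w \<otimes>\<^sub>v (c *\<^sub>R axis k 1) :: real^'n^'n)
      = (\<chi> i j. if j = k then (mat 1 *v (axis k 1 + c *\<^sub>R w)) $ i else mat 1 $ i $ j)"
    by (simp add: vec_eq_iff outer_def) (simp add: axis_def mat_def)
  also have "det \<dots> = 1 + c * w $ k"
    by (subst cramer_lemma) (simp add: axis_def)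
  finally show ?thesis .
qed

lemma matrix_mul_outer: "U ** (w \<otimes>\<^sub>v g) = (U *v w) \<otimes>\<^sub>v g"
  by (simp add: vec_eq_iff outer_def matrix_matrix_mult_def matrix_vector_mult_def sum_distrib_right
      mult.assoc)

lemma outer_mul_transpose: "(w \<otimes>\<^sub>v g) ** transpose U = w \<otimes>\<^sub>v (U *v g)"
  by (simp add: vec_eq_iff outer_def matrix_matrix_mult_def matrix_vector_mult_def sum_distrib_left
      transpose_def ac_simps)

lemma outer_mul_vec: "(w \<otimes>\<^sub>v g) *v x = (g \<bullet> x) *\<^sub>R w"
  by (simp add: vec_eq_iff outer_def matrix_vector_mult_def inner_vec_def sum_distrib_left
      sum_distrib_right ac_simps)

lemma matrix_add_mul_right: "(B + C) ** A = B ** A + C ** (A :: real^'n^'m)"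
  by (simp add: vec_eq_iff matrix_matrix_mult_def distrib_right sum.distrib)

text \<open>An orthogonal map that turns \<open>g\<close> onto a coordinate axis changes neither the
  determinant nor \<open>g \<bullet> w\<close>, which reduces the claim to the axis case.\<close>

lemma det_mat_plus_outer:
  fixes w g :: "real^'n"
  shows "det (mat 1 + w \<otimes>\<^sub>v g) = 1 + g \<bullet> w"
proof -
  fix k :: 'n
  have "norm g = norm (norm g *\<^sub>R axis k 1 :: real^'n)" by simp
  then obtain Q where Q: "orthogonal_transformation Q" "Q g = (norm g *\<^sub>R axis k 1 :: real^'n)"
    using orthogonal_transformation_exists by blast
  define U where "U = matrix Q"
  have lin: "linear Q" using Q orthogonal_transformation_linear by blast
  have U: "U *v x = Q x" for x
    unfolding U_def using lin by simp
  have orth: "U ** transpose U = mat 1"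
    using Q(1) orthogonal_transformation_matrix[of Q] unfolding U_def orthogonal_matrix_def by blast
  have "det U * det U = 1"
    using arg_cong[OF orth, of det] by (simp add: det_mul)
  then have "det (mat 1 + w \<otimes>\<^sub>v g) = det (U ** (mat 1 + w \<otimes>\<^sub>v g) ** transpose U)"
    by (simp add: det_mul)
  also have "U ** (mat 1 + w \<otimes>\<^sub>v g) ** transpose U = mat 1 + (U *v w) \<otimes>\<^sub>v (U *v g)"
    unfolding matrix_add_ldistrib matrix_add_mul_right matrix_mul_outer outer_mul_transpose by (simp add: orth)
  also have "det \<dots> = 1 + norm g * Q w $ k"
    unfolding U Q by (rule det_mat_plus_outer_axis)
  also have "norm g * Q w $ k = Q g \<bullet> Q w"
    unfolding Q by (simp add: inner_axis')
  also have "\<dots> = g \<bullet> w"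
    using Q(1) unfolding orthogonal_transformation_def by blast
  finally show ?thesis .
qed

text \<open>The library's change of variables requires a well-ordered index type, so an arbitrary finite index
  type is replaced by a well-ordered copy.\<close>

typedef 'a wo = "UNIV :: 'a set" by simp

instance wo :: (finite) finite
proof
  show "finite (UNIV :: 'a wo set)"
    by (simp add: type_definition.univ[OF type_definition_wo])
qed

instantiation wo :: (finite) wellorder
begin

definition "x \<le> y \<longleftrightarrow> to_nat (Rep_wo x) \<le> to_nat (Rep_wo y)"
definition "x < y \<longleftrightarrow> to_nat (Rep_wo x) < to_nat (Rep_wo y)"

instance
proof
  fix P :: "'a wo \<Rightarrow> bool" and a :: "'a wo"
  assume step: "\<And>x. (\<And>y. y < x \<Longrightarrow> P y) \<Longrightarrow> P x"
  show "P a"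
  proof (induction "to_nat (Rep_wo a)" arbitrary: a rule: less_induct)
    case less
    show ?case by (rule step) (rule less, simp add: less_wo_def)
  qed
qed (auto simp: less_eq_wo_def less_wo_def Rep_wo_inject)

end

lemma bij_Rep_wo: "bij Rep_wo"
  by (rule bijI') (auto simp: Rep_wo_inject intro: Abs_wo_inverse[symmetric])

definition to_wo :: "real^'n \<Rightarrow> real^('n wo)" where
  "to_wo x = (\<chi> i. x $ Rep_wo i)"

definition of_wo :: "real^('n wo) \<Rightarrow> real^'n" where
  "of_wo x = (\<chi> i. x $ Abs_wo i)"

lemma of_to_wo [simp]: "of_wo (to_wo x) = x" "to_wo (of_wo y) = y"
  by (simp_all add: to_wo_def of_wo_def Abs_wo_inverse Rep_wo_inverse)

lemma linear_to_wo: "linear to_wo" and linear_of_wo: "linear of_wo"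
  by (auto intro!: linearI simp: to_wo_def of_wo_def vec_eq_iff)

lemma inner_to_wo: "to_wo x \<bullet> to_wo y = x \<bullet> y"
  unfolding inner_vec_def to_wo_def
  using sum.reindex_bij_betw[OF bij_Rep_wo, of "\<lambda>i. x $ i \<bullet> y $ i"] by simp

lemma to_wo_cbox: "to_wo ` cbox a b = cbox (to_wo a) (to_wo b)"
proof -
  have *: "to_wo x \<in> cbox (to_wo a) (to_wo b) \<longleftrightarrow> x \<in> cbox a b" for x a b
    unfolding mem_box_cart to_wo_def vec_lambda_beta by (metis Abs_wo_inverse[OF UNIV_I])
  show ?thesis
  proof
    show "cbox (to_wo a) (to_wo b) \<subseteq> to_wo ` cbox a b"
      using * of_to_wo(2) by (metis image_eqI subsetI)
  qed (auto simp: *)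
qed

lemma content_to_wo: "measure lborel (cbox (to_wo a) (to_wo b)) = measure lborel (cbox a b)"
proof (cases "cbox a b = {}")
  case True
  then show ?thesis using to_wo_cbox[of a b] by (simp)
next
  case False
  then have "cbox (to_wo a) (to_wo b) \<noteq> {}" using to_wo_cbox[of a b] by auto
  with False show ?thesis
    using prod.reindex_bij_betw[OF bij_Rep_wo, of "\<lambda>i. b $ i - a $ i"]
    by (simp add: content_cbox_if_cart to_wo_def)
qed

lemma of_wo_cbox: "of_wo ` cbox a b = cbox (of_wo a) (of_wo b)"
proof -
  have "of_wo ` cbox a b = of_wo ` to_wo ` cbox (of_wo a) (of_wo b)"
    by (simp add: to_wo_cbox)
  then show ?thesis by (simp add: image_image)
qed

text \<open>\<open>has_integral_twiddle\<close> moves integrals over boxes, so the integrand is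
  first extended by zero from \<open>K\<close> to a box. Both the change of index type and
  translations map boxes to boxes of equal volume.\<close>

lemma has_integral_bounded_bij:
  fixes f :: "'a::euclidean_space \<Rightarrow> 'b::banach" and h :: "'a \<Rightarrow> 'c::euclidean_space"
  assumes "bounded K" "(f has_integral i) K"
    and hk: "\<And>x. k (h x) = x" "\<And>y. h (k y) = y" and cont: "\<And>y. continuous (at y) k"
    and k: "\<And>u v. \<exists>w z. k ` cbox u v = cbox w z" and h: "\<And>u v. \<exists>w z. h ` cbox u v = cbox w z"
    and r: "\<And>u v. measure lborel (k ` cbox u v) = measure lborel (cbox u v)"
  shows "((\<lambda>y. f (k y)) has_integral i) (h ` K)"
proof -
  obtain a where a: "K \<subseteq> cbox (-a) a"
    using bounded_subset_cbox_symmetric[OF assms(1)] by blast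
  have "((\<lambda>x. if x \<in> K then f x else 0) has_integral i) (cbox (-a) a)"
    using a assms(2) by simp
  then have "((\<lambda>y. if k y \<in> K then f (k y) else 0) has_integral (1 / 1) *\<^sub>R i) (h ` cbox (-a) a)"
    by (intro has_integral_twiddle[where g = k and h = h and r = 1]) (use assms in auto)
  moreover have "k y \<in> K \<longleftrightarrow> y \<in> h ` K" for y
    using hk by (metis image_iff)
  moreover have "h ` K \<subseteq> h ` cbox (-a) a" using a by blast
  ultimately show ?thesis by simp
qed

lemma continuous_of_wo: "continuous (at x within S) of_wo"
  using linear_of_wo linear_continuous_within linear_conv_bounded_linear by blast

lemma has_integral_to_wo:
  fixes f :: "real^'n \<Rightarrow> 'b::banach"
  assumes "bounded K" "(f has_integral i) K"
  shows "((\<lambda>x. f (of_wo x)) has_integral i) (to_wo ` K)"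
proof (rule has_integral_bounded_bij[OF assms])
  show "\<exists>w z. of_wo ` cbox u v = cbox w z" for u v :: "real^('n wo)"
    using of_wo_cbox by blast
  show "\<exists>w z. to_wo ` cbox u v = cbox w z" for u v :: "real^'n"
    using to_wo_cbox by blast
  show "measure lborel (of_wo ` cbox u v) = measure lborel (cbox u v)" for u v :: "real^('n wo)"
    using content_to_wo[of "of_wo u" "of_wo v"] by (simp add: of_wo_cbox)
qed (simp_all add: continuous_of_wo)

lemma has_integral_translation:
  fixes f :: "'a::euclidean_space \<Rightarrow> 'b::banach"
  assumes "bounded K" "(f has_integral i) K"
  shows "((\<lambda>y. f (y - c)) has_integral i) ((\<lambda>x. x + c) ` K)"
proof (rule has_integral_bounded_bij[OF assms])
  have *: "(\<lambda>x. x + d) ` cbox u v = cbox (u + d) (v + d)" for d u v :: 'a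
    using cbox_translation[of d u v] by (simp add: add.commute image_def)
  have **: "(\<lambda>x. x - c) ` cbox u v = cbox (u - c) (v - c)" for u v
    using *[of "-c"] by simp
  show "\<exists>w z. (\<lambda>x. x - c) ` cbox u v = cbox w z" "\<exists>w z. (\<lambda>x. x + c) ` cbox u v = cbox w z" for u v
    using * ** by blast+
  show "measure lborel ((\<lambda>x. x - c) ` cbox u v) = measure lborel (cbox u v)" for u v
    unfolding ** by (simp add: content_cbox_if box_ne_empty inner_diff_left box_eq_empty)
qed (auto intro: continuous_intros)

lemma absolutely_integrable_continuous_compact:
  fixes f :: "'a::euclidean_space \<Rightarrow> 'b::euclidean_space"
  assumes "compact K" "continuous_on UNIV f"
  shows "f absolutely_integrable_on K"
proof -
  obtain a where "K \<subseteq> cbox (-a) a"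
    using bounded_subset_cbox_symmetric[OF compact_imp_bounded[OF assms(1)]] by blast
  moreover have "f absolutely_integrable_on cbox (-a) a"
    using assms(2) continuous_on_subset by (intro absolutely_integrable_continuous) blast
  ultimately show ?thesis
    using assms(1) by (meson set_integrable_subset lmeasurable_compact fmeasurableD)
qed

lemma integrable_continuous_compact:
  fixes f :: "'a::euclidean_space \<Rightarrow> 'b::euclidean_space"
  assumes "compact K" "continuous_on UNIV f"
  shows "f integrable_on K"
  using absolutely_integrable_continuous_compact[OF assms] set_lebesgue_integral_eq_integral(1) by blast

text \<open>The translation by \<open>\<beta> w\<close> is removed first, by shifting the integrand;
  the linear part is then moved to the well-ordered index type, where its determinant is
  \<open>1 + g \<bullet> w\<close>.\<close>

lemma integral_rank_one_image:
  fixes f :: "real^'n \<Rightarrow> real^'n"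
  assumes "compact K" "continuous_on UNIV f" and L: "L = (\<lambda>x. x + (g \<bullet> x + \<beta>) *\<^sub>R w)"
  shows "integral (L ` K) f = \<bar>1 + g \<bullet> w\<bar> *\<^sub>R integral K (\<lambda>x. f (L x))"
proof -
  define M where "M = (\<lambda>x. x + (g \<bullet> x) *\<^sub>R w)"
  define c where "c = \<beta> *\<^sub>R w"
  have LM: "L x = M x + c" for x by (simp add: L M_def c_def algebra_simps)
  define f' where "f' = (\<lambda>x. f (x + c))"
  have cf': "continuous_on UNIV f'"
    unfolding f'_def by (intro continuous_on_compose2[OF assms(2)] continuous_intros) auto
  let ?M = "\<lambda>x. to_wo (M (of_wo x))"
  let ?f = "\<lambda>x. f' (of_wo x)"
  have M: "?M x = (mat 1 + to_wo w \<otimes>\<^sub>v to_wo g) *v x" for x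
  proof -
    have "g \<bullet> of_wo x = to_wo g \<bullet> x" using inner_to_wo[of g "of_wo x"] by simp
    moreover have "?M x = x + (g \<bullet> of_wo x) *\<^sub>R to_wo w"
      by (simp add: M_def linear_add[OF linear_to_wo] linear_cmul[OF linear_to_wo])
    ultimately show ?thesis
      by (simp add: matrix_vector_mult_add_rdistrib outer_mul_vec)
  qed
  have linM: "linear ?M"
    unfolding M by (rule matrix_vector_mul_linear)
  have matM: "matrix ?M = mat 1 + to_wo w \<otimes>\<^sub>v to_wo g"
    unfolding M by simp
  have contM: "continuous_on S M" for S
    unfolding M_def by (intro continuous_intros)
  have cmp: "compact (M ` K)"
    using assms(1) contM compact_continuous_image by blast
  have cmp': "compact (to_wo ` K)"
    using assms(1) linear_to_wo linear_continuous_on linear_conv_bounded_linear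
    by (blast intro: compact_continuous_image)
  have contF: "continuous_on UNIV ?f"
    by (intro continuous_on_compose2[OF cf'] continuous_at_imp_continuous_on ballI continuous_of_wo) auto
  have contMw: "continuous_on S ?M" for S
    using linM linear_continuous_on linear_conv_bounded_linear by blast
  have img: "?M ` (to_wo ` K) = to_wo ` M ` K"
    by (simp add: image_image)
  have imgL: "L ` K = (\<lambda>x. x + c) ` M ` K"
    by (simp add: image_image LM)
  have "integral (L ` K) (\<lambda>x. f' (x - c)) = integral (M ` K) f'"
    unfolding imgL
    by (intro integral_unique has_integral_translation integrable_integral compact_imp_bounded cmp
        integrable_continuous_compact cf')
  then have "integral (L ` K) f = integral (M ` K) f'"
    by (simp add: f'_def)
  also have "\<dots> = integral (to_wo ` M ` K) ?f"
    by (intro integral_unique[symmetric] has_integral_to_wo integrable_integral compact_imp_bounded cmp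
        integrable_continuous_compact cf')
  also have "\<dots> = integral (?M ` (to_wo ` K)) ?f"
    by (simp add: img)
  also have "\<dots> = \<bar>det (matrix ?M)\<bar> *\<^sub>R integral (to_wo ` K) (?f \<circ> ?M)"
    using cmp' by (intro integral_change_of_variables_linear linM disjI1
        absolutely_integrable_continuous_compact contF) (auto intro!: compact_continuous_image contMw)
  also have "integral (to_wo ` K) (?f \<circ> ?M) = integral (to_wo ` K) (\<lambda>x. f' (M (of_wo x)))"
    by (simp add: o_def)
  also have "\<dots> = integral K (\<lambda>x. f' (M x))"
    by (intro integral_unique has_integral_to_wo[where f="\<lambda>x. f' (M x)"] integrable_integral
        compact_imp_bounded assms integrable_continuous_compact continuous_on_compose2[OF cf' contM]) auto
  finally show ?thesis
    by (simp add: matM det_mat_plus_outer inner_to_wo f'_def LM)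
qed

text \<open>A volume is read off from the vector-valued formula by integrating a constant unit
  vector and taking its component.\<close>

lemma measure_rank_one_image:
  fixes g :: "real^'n"
  assumes "compact K"
  shows "measure lebesgue ((\<lambda>x. x + (g \<bullet> x + \<beta>) *\<^sub>R w) ` K) = \<bar>1 + g \<bullet> w\<bar> * measure lebesgue K"
proof -
  let ?L = "\<lambda>x. x + (g \<bullet> x + \<beta>) *\<^sub>R w"
  fix k :: 'n
  have int: "integral A (\<lambda>_. axis k 1 :: real^'n) $ k = measure lebesgue A" if "compact A" for A :: "(real^'n) set"
    using that integrable_continuous_compact[of A "\<lambda>_. axis k 1 :: real^'n"]
    by (simp add: integral_component_eq_cart[symmetric] lmeasure_integral lmeasurable_compact)
  have "compact (?L ` K)"
    using assms by (intro compact_continuous_image continuous_intros)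
  then show ?thesis
    using arg_cong[OF integral_rank_one_image[OF assms, of "\<lambda>_. axis k 1" ?L g \<beta> w], of "\<lambda>x. x $ k"] assms
    by (simp add: int)
qed

section \<open>Barycentric coordinates\<close>

definition cen :: "(real^'n) set \<Rightarrow> real^'n" where
  "cen W = \<Sum>W /\<^sub>R real (card W)"

text \<open>The gradient of the barycentric coordinate of \<open>z\<close>, which falls from 1 at
  \<open>z\<close> to 0 at every other vertex. For the vertices of a full simplex the differences
  \<open>y - z\<close> form a basis, so that the choice is determined.\<close>

definition bgrad :: "(real^'n) set \<Rightarrow> real^'n \<Rightarrow> real^'n" where
  "bgrad V z = (SOME g. \<forall>y\<in>V - {z}. g \<bullet> (y - z) = -1)"

definition bary :: "(real^'n) set \<Rightarrow> real^'n \<Rightarrow> real^'n \<Rightarrow> real" where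
  "bary V z x = bgrad V z \<bullet> (x - z) + 1"

lemma bary_diff: "bary V z x - bary V z y = bgrad V z \<bullet> (x - y)"
  by (simp add: bary_def inner_diff_right)

lemma bary_add: "bary V z (x + y) = bary V z x + bgrad V z \<bullet> y"
  by (simp add: bary_def inner_diff_right inner_add_right)

lemma continuous_bary [continuous_intros]:
  "continuous_on S f \<Longrightarrow> continuous_on S (\<lambda>x. bary V z (f x))"
  unfolding bary_def by (intro continuous_intros)

lemma bary_sum:
  assumes "finite W" "sum u W = 1"
  shows "bary V z (\<Sum>y\<in>W. u y *\<^sub>R y) = (\<Sum>y\<in>W. u y * bary V z y)"
proof -
  have "(\<Sum>y\<in>W. u y * bary V z y) = (\<Sum>y\<in>W. u y * (bgrad V z \<bullet> y)) + (\<Sum>y\<in>W. u y) * (1 - bgrad V z \<bullet> z)"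
    by (simp add: bary_def inner_diff_right algebra_simps sum.distrib sum_subtractf sum_distrib_right)
  then show ?thesis
    by (simp add: assms bary_def inner_sum_right inner_diff_right)
qed

locale full_simplex =
  fixes V :: "(real^'n) set"
  assumes indep: "\<not> affine_dependent V" and card_V: "card V = CARD('n) + 1"
begin

lemma finite_V: "finite V"
  using card_V card_ge_0_finite by force

lemma affine_hull_V: "affine hull V = UNIV"
  using aff_dim_affine_independent[OF indep] card_V by (simp add: aff_dim_eq_full[symmetric])

lemma notin_affine_hull: "z \<in> V \<Longrightarrow> z \<notin> affine hull (V - {z})"
  using indep by (auto simp: affine_dependent_def)

text \<open>Makes the choice in \<open>bgrad\<close> legitimate: the other vertices span a
  hyperplane \<open>a \<bullet> x = b\<close> that misses \<open>z\<close>, and \<open>a\<close>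
  divided by \<open>a \<bullet> z - b\<close> is a witness.\<close>

lemma bgrad_inner:
  assumes "z \<in> V" "y \<in> V" "y \<noteq> z"
  shows "bgrad V z \<bullet> (y - z) = -1"
proof -
  have "\<not> affine_dependent (V - {z})"
    using affine_independent_subset[OF indep] by blast
  then have "aff_dim (V - {z}) = int (card (V - {z})) - 1"
    using aff_dim_affine_independent[of "V - {z}"] by linarith
  also have "card (V - {z}) = CARD('n)"
    using assms(1) card_V finite_V by simp
  finally have "aff_dim (V - {z}) = DIM(real^'n) - 1"
    by simp
  then obtain a b where ab: "affine hull (V - {z}) = {x. a \<bullet> x = b}"
    unfolding aff_dim_eq_hyperplane by (elim exE conjE) (rule that)
  have nz: "a \<bullet> z - b \<noteq> 0"
  proof
    assume "a \<bullet> z - b = 0"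
    then have "z \<in> affine hull (V - {z})" unfolding ab by simp
    then show False using notin_affine_hull[OF assms(1)] by blast
  qed
  have "\<forall>y\<in>V - {z}. (a /\<^sub>R (a \<bullet> z - b)) \<bullet> (y - z) = -1"
  proof
    fix y assume "y \<in> V - {z}"
    then have "y \<in> affine hull (V - {z})" by (rule hull_inc)
    then have "a \<bullet> y = b" unfolding ab by simp
    then have "a \<bullet> (y - z) = - (a \<bullet> z - b)" by (simp add: inner_diff_right)
    then show "(a /\<^sub>R (a \<bullet> z - b)) \<bullet> (y - z) = -1"
      unfolding inner_scaleR_left using nz by (metis left_inverse mult_minus_right)
  qed
  then have "\<forall>y\<in>V - {z}. bgrad V z \<bullet> (y - z) = -1"
    unfolding bgrad_def by (rule someI[of "\<lambda>g. \<forall>y\<in>V - {z}. g \<bullet> (y - z) = -1"])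
  with assms show ?thesis by blast
qed

lemma bary_vertex:
  assumes "z \<in> V" "y \<in> V"
  shows "bary V z y = (if y = z then 1 else 0)"
  using bgrad_inner[OF assms] by (simp add: bary_def)

lemma bary_unique:
  assumes "sum u V = 1" "x = (\<Sum>y\<in>V. u y *\<^sub>R y)" "z \<in> V"
  shows "bary V z x = u z"
proof -
  have "bary V z x = (\<Sum>y\<in>V. u y * (if y = z then 1 else 0))"
    unfolding assms(2) bary_sum[OF finite_V assms(1)]
    by (intro sum.cong refl) (simp add: bary_vertex assms(3))
  then show ?thesis
    using assms(3) finite_V by (simp add: if_distrib cong: if_cong)
qed

lemma sum_bary: "(\<Sum>z\<in>V. bary V z x) = 1"
  and sum_bary_scale: "(\<Sum>z\<in>V. bary V z x *\<^sub>R z) = x"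
proof -
  have "x \<in> affine hull V" by (simp add: affine_hull_V)
  then obtain u where u: "sum u V = 1" "x = (\<Sum>y\<in>V. u y *\<^sub>R y)"
    unfolding affine_hull_finite[OF finite_V] by auto
  then show "(\<Sum>z\<in>V. bary V z x) = 1" "(\<Sum>z\<in>V. bary V z x *\<^sub>R z) = x"
    using bary_unique[OF u] by simp_all
qed

text \<open>The coordinates sum to the constant 1, so their gradients cancel.\<close>

lemma sum_bgrad: "(\<Sum>z\<in>V. bgrad V z) = 0"
proof -
  have "(\<Sum>z\<in>V. bgrad V z) \<bullet> x = (\<Sum>z\<in>V. bary V z x) - (\<Sum>z\<in>V. bary V z 0)" for x
    by (simp add: inner_sum_left sum_subtractf[symmetric] bary_diff)
  from this[of "\<Sum>z\<in>V. bgrad V z"] show ?thesis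
    by (simp add: sum_bary)
qed

text \<open>The linear part of \<open>sum_bary_scale\<close>. In matrix form, vertices times
  transposed gradients sum to the identity.\<close>

lemma sum_bgrad_inner: "(\<Sum>z\<in>V. (bgrad V z \<bullet> x) *\<^sub>R z) = x"
proof -
  have "(\<Sum>z\<in>V. (bgrad V z \<bullet> x) *\<^sub>R z) = (\<Sum>z\<in>V. bary V z x *\<^sub>R z) - (\<Sum>z\<in>V. bary V z 0 *\<^sub>R z)"
    by (simp add: sum_subtractf[symmetric] scaleR_diff_left[symmetric] bary_diff)
  then show ?thesis
    by (simp add: sum_bary_scale)
qed

text \<open>An affine function is determined by its values at the vertices, here \<open>c\<close> at
  \<open>z\<close> and 0 elsewhere. This identifies the outer normal of a side and the coordinates
  of a neighbouring simplex.\<close>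

lemma bgrad_eqI:
  assumes "z \<in> V" "k \<bullet> z + b = c" "\<And>y. y \<in> V - {z} \<Longrightarrow> k \<bullet> y + b = 0"
  shows "k = c *\<^sub>R bgrad V z" and "k \<bullet> x + b = c * bary V z x"
proof -
  have *: "k \<bullet> x + b = c * bary V z x" for x
  proof -
    have "k \<bullet> x + b = (\<Sum>y\<in>V. bary V y x * (k \<bullet> y)) + (\<Sum>y\<in>V. bary V y x) * b"
      by (subst sum_bary_scale[symmetric, of x]) (simp add: inner_sum_right sum_bary)
    also have "\<dots> = (\<Sum>y\<in>V. bary V y x * (k \<bullet> y + b))"
      by (simp add: algebra_simps sum.distrib sum_distrib_left)
    also have "\<dots> = (\<Sum>y\<in>V. bary V y x * (if y = z then c else 0))"
      using assms by (intro sum.cong) auto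
    also have "\<dots> = c * bary V z x"
      using assms(1) finite_V by (simp add: if_distrib cong: if_cong)
    finally show ?thesis .
  qed
  then show "k \<bullet> x + b = c * bary V z x" .
  have "k \<bullet> x = c * (bgrad V z \<bullet> x)" for x
    using *[of x] *[of 0] bary_diff[of V z x 0] by (simp add: algebra_simps)
  from this[of "k - c *\<^sub>R bgrad V z"] have "(k - c *\<^sub>R bgrad V z) \<bullet> (k - c *\<^sub>R bgrad V z) = 0"
    by (simp add: inner_diff_left)
  then show "k = c *\<^sub>R bgrad V z" by simp
qed

lemma exists_other_vertex: obtains y where "y \<in> V" "y \<noteq> z"
proof -
  have "\<not> V \<subseteq> {z}"
    using card_V card_mono[of "{z}" V] zero_less_card_finite[where 'a = 'n] by auto
  then show thesis using that by blast
qed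

lemma bgrad_nonzero: assumes "z \<in> V" shows "bgrad V z \<noteq> 0"
proof -
  obtain y where "y \<in> V" "y \<noteq> z" by (rule exists_other_vertex)
  with bgrad_inner[OF assms this] show ?thesis by auto
qed

lemma convex_hull_V: "convex hull V = {x. \<forall>z\<in>V. 0 \<le> bary V z x}"
proof
  show "convex hull V \<subseteq> {x. \<forall>z\<in>V. 0 \<le> bary V z x}"
    unfolding convex_hull_finite[OF finite_V] using bary_unique by auto
  show "{x. \<forall>z\<in>V. 0 \<le> bary V z x} \<subseteq> convex hull V"
    unfolding convex_hull_finite[OF finite_V] using sum_bary sum_bary_scale by fastforce
qed

lemma convex_hull_side:
  assumes "z \<in> V"
  shows "convex hull (V - {z}) = {x. bary V z x = 0 \<and> (\<forall>y\<in>V - {z}. 0 \<le> bary V y x)}"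
proof -
  have fin: "finite (V - {z})" using finite_V by blast
  show ?thesis
  proof (intro equalityI subsetI)
    fix x assume "x \<in> convex hull (V - {z})"
    then obtain u where u: "\<forall>y\<in>V - {z}. 0 \<le> u y" "sum u (V - {z}) = 1" "(\<Sum>y\<in>V - {z}. u y *\<^sub>R y) = x"
      unfolding convex_hull_finite[OF fin] by auto
    define u' where "u' = (\<lambda>y. if y = z then 0 else u y)"
    have "sum u' V = 1" "x = (\<Sum>y\<in>V. u' y *\<^sub>R y)"
      using u(2,3) by (simp_all add: sum.remove[OF finite_V assms] u'_def)
    from bary_unique[OF this] show "x \<in> {x. bary V z x = 0 \<and> (\<forall>y\<in>V - {z}. 0 \<le> bary V y x)}"
      using u(1) assms by (auto simp: u'_def)
  next
    fix x assume x: "x \<in> {x. bary V z x = 0 \<and> (\<forall>y\<in>V - {z}. 0 \<le> bary V y x)}"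
    then have "(\<Sum>y\<in>V - {z}. bary V y x) = 1" "(\<Sum>y\<in>V - {z}. bary V y x *\<^sub>R y) = x"
      using sum_bary[of x] sum_bary_scale[of x] by (simp_all add: sum.remove[OF finite_V assms])
    with x show "x \<in> convex hull (V - {z})"
      unfolding convex_hull_finite[OF fin] by auto
  qed
qed

lemma affine_hull_side:
  assumes "z \<in> V"
  shows "affine hull (V - {z}) = {x. bary V z x = 0}"
proof -
  have fin: "finite (V - {z})" using finite_V by blast
  show ?thesis
  proof (intro equalityI subsetI)
    fix x assume "x \<in> affine hull (V - {z})"
    then obtain u where u: "sum u (V - {z}) = 1" "(\<Sum>y\<in>V - {z}. u y *\<^sub>R y) = x"
      unfolding affine_hull_finite[OF fin] by auto
    have "bary V z x = 0"
      unfolding u(2)[symmetric] bary_sum[OF fin u(1)]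
      by (intro sum.neutral) (simp add: bary_vertex assms)
    then show "x \<in> {x. bary V z x = 0}" by simp
  next
    fix x assume x: "x \<in> {x. bary V z x = 0}"
    then have "(\<Sum>y\<in>V - {z}. bary V y x) = 1" "(\<Sum>y\<in>V - {z}. bary V y x *\<^sub>R y) = x"
      using sum_bary[of x] sum_bary_scale[of x] by (simp_all add: sum.remove[OF finite_V assms])
    then show "x \<in> affine hull (V - {z})"
      unfolding affine_hull_finite[OF fin] by auto
  qed
qed

lemma interior_V: "interior (convex hull V) = {x. \<forall>z\<in>V. 0 < bary V z x}"
proof (rule interior_unique)
  show "{x. \<forall>z\<in>V. 0 < bary V z x} \<subseteq> convex hull V"
    by (auto simp: convex_hull_V less_imp_le)
  have "{x. \<forall>z\<in>V. 0 < bary V z x} = (\<Inter>z\<in>V. {x. 0 < bary V z x})" by auto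
  also have "open \<dots>"
    using finite_V by (intro open_INT ballI open_Collect_less continuous_intros) auto
  finally show "open {x. \<forall>z\<in>V. 0 < bary V z x}" .
  fix U assume U: "U \<subseteq> convex hull V" "open U"
  show "U \<subseteq> {x. \<forall>z\<in>V. 0 < bary V z x}"
  proof (intro subsetI CollectI ballI)
    fix x z assume x: "x \<in> U" and z: "z \<in> V"
    let ?g = "bgrad V z"
    obtain e where e: "e > 0" "ball x e \<subseteq> U"
      using U(2) x open_contains_ball by blast
    \<comment> \<open>A step of length \<open>e / 2\<close> against the gradient stays in the ball
      and lowers the coordinate strictly; since it is still nonnegative there, it is positive at
      \<open>x\<close>.\<close>
    define t where "t = e / (2 * norm ?g)"
    have t: "t > 0" using e bgrad_nonzero[OF z] by (simp add: t_def)
    have "x - t *\<^sub>R ?g \<in> ball x e"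
      using e bgrad_nonzero[OF z] by (simp add: dist_norm t_def)
    then have "x - t *\<^sub>R ?g \<in> convex hull V" using e U by blast
    then have "0 \<le> bary V z (x - t *\<^sub>R ?g)"
      using z by (simp add: convex_hull_V)
    also have "\<dots> = bary V z x - t * (?g \<bullet> ?g)"
      by (simp add: bary_def inner_diff_right)
    also have "\<dots> < bary V z x"
      using t bgrad_nonzero[OF z] by simp
    finally show "0 < bary V z x" .
  qed
qed

lemma bary_cen:
  assumes "W \<subseteq> V" "W \<noteq> {}" "z \<in> V"
  shows "bary V z (cen W) = (if z \<in> W then 1 / card W else 0)"
proof -
  have fin: "finite W" using assms finite_V finite_subset by blast
  have "cen W = (\<Sum>y\<in>W. (1 / card W) *\<^sub>R y)"
    by (simp add: cen_def scaleR_sum_right divide_inverse)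
  moreover have "(\<Sum>y\<in>W. 1 / real (card W)) = 1"
    using assms fin by simp
  ultimately have "bary V z (cen W) = (\<Sum>y\<in>W. 1 / card W * bary V z y)"
    using bary_sum[OF fin, of "\<lambda>_. 1 / card W" V z] by simp
  also have "\<dots> = (\<Sum>y\<in>W. if y = z then 1 / card W else 0)"
    using assms by (intro sum.cong refl) (auto simp: bary_vertex)
  finally show ?thesis using fin by simp
qed

lemma cen_interior: "cen V \<in> interior (convex hull V)"
proof -
  have "V \<noteq> {}" using card_V by auto
  then show ?thesis by (simp add: interior_V bary_cen card_V)
qed

lemma card_side: "z \<in> V \<Longrightarrow> card (V - {z}) = CARD('n)"
  using card_V finite_V by simp

lemma side_nonempty: "z \<in> V \<Longrightarrow> V - {z} \<noteq> {}"
  using exists_other_vertex[of z] by blast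

text \<open>For uniqueness: \<open>b - n \<bullet> x\<close> is affine, vanishes on the side and is
  positive at \<open>z\<close>, hence is a positive multiple of the barycentric coordinate; the unit
  length of \<open>n\<close> fixes the factor.\<close>

lemma outer_normal_side:
  assumes z: "z \<in> V"
  shows "outer_normal (convex hull V) (convex hull (V - {z})) = - (bgrad V z /\<^sub>R norm (bgrad V z))"
  unfolding outer_normal_def
proof (rule the_equality)
  let ?g = "bgrad V z" and ?T = "convex hull V" and ?S = "convex hull (V - {z})"
  have ng: "norm ?g > 0" using bgrad_nonzero[OF z] by simp
  let ?n = "- (?g /\<^sub>R norm ?g)" and ?b = "(1 - ?g \<bullet> z) / norm ?g"
  have n: "?n \<bullet> x = ?b - bary V z x / norm ?g" for x
    by (simp add: bary_def inner_diff_right divide_inverse algebra_simps)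
  have le: "?n \<bullet> x \<le> ?b \<longleftrightarrow> 0 \<le> bary V z x" and eq: "?n \<bullet> x = ?b \<longleftrightarrow> bary V z x = 0" for x
    unfolding n using ng by (auto simp: divide_le_0_iff zero_le_divide_iff)
  show "norm ?n = 1 \<and> (\<exists>b. ?T \<subseteq> {x. ?n \<bullet> x \<le> b} \<and> ?S = ?T \<inter> {x. ?n \<bullet> x = b})"
  proof (intro conjI exI[of _ ?b])
    show "norm ?n = 1" using ng by simp
    show "?T \<subseteq> {x. ?n \<bullet> x \<le> ?b}"
      using z by (simp only: le convex_hull_V) blast
    show "?S = ?T \<inter> {x. ?n \<bullet> x = ?b}"
      using z by (simp only: eq convex_hull_V convex_hull_side[OF z]) auto
  qed
  fix n assume "norm n = 1 \<and> (\<exists>b. ?T \<subseteq> {x. n \<bullet> x \<le> b} \<and> ?S = ?T \<inter> {x. n \<bullet> x = b})"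
  then obtain b where nb: "norm n = 1" "?T \<subseteq> {x. n \<bullet> x \<le> b}" "?S = ?T \<inter> {x. n \<bullet> x = b}" by blast
  have zT: "z \<in> ?T" using z by (rule hull_inc)
  have "z \<notin> ?S" using notin_affine_hull[OF z] convex_hull_subset_affine_hull by blast
  with zT nb have "n \<bullet> z < b" by force
  define c where "c = b - n \<bullet> z"
  have c: "c > 0" using \<open>n \<bullet> z < b\<close> by (simp add: c_def)
  have "- n = c *\<^sub>R ?g"
  proof (rule bgrad_eqI[OF z, of _ b])
    show "- n \<bullet> z + b = c" by (simp add: c_def)
    fix y assume "y \<in> V - {z}"
    then have "y \<in> ?S" by (rule hull_inc)
    then show "- n \<bullet> y + b = 0" using nb(3) by auto
  qed
  then have n: "n = - (c *\<^sub>R ?g)" by (metis minus_minus)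
  then have "1 = c * norm ?g" using nb(1) c by simp
  then have "c = inverse (norm ?g)" using ng by (simp add: field_simps)
  then show "n = ?n" using n by simp
qed

end

section \<open>Means over simplices and over their sides\<close>

lemma integral_scaleR_const:
  fixes h :: "'a::euclidean_space \<Rightarrow> real" and v :: "'b::euclidean_space"
  assumes "h integrable_on K"
  shows "integral K (\<lambda>x. h x *\<^sub>R v) = integral K h *\<^sub>R v"
  using integral_linear[OF assms bounded_linear_scaleR_left] by (simp add: o_def)

text \<open>The cylinder over a simplex of any dimension is invariant under the affine involution that swaps two
  vertices and is a rank-one perturbation of the identity; so all barycentric coordinates have
  the same integral.\<close>

lemma mean_barycentric:
  fixes W :: "(real^'n) set" and \<mu> :: "real^'n \<Rightarrow> real^'n \<Rightarrow> real"
  assumes fin: "finite W" and ne: "W \<noteq> {}"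
    and aff: "\<And>y x. y \<in> W \<Longrightarrow> \<mu> y x = c y \<bullet> x + \<beta> y"
    and one: "\<And>x. (\<Sum>y\<in>W. \<mu> y x) = 1"
    and delta: "\<And>y y'. y \<in> W \<Longrightarrow> y' \<in> W \<Longrightarrow> \<mu> y y' = (if y' = y then 1 else 0)"
    and P: "P = (\<lambda>x. \<Sum>y\<in>W. \<mu> y x *\<^sub>R y)"
    and K: "K = {x. (\<forall>y\<in>W. 0 \<le> \<mu> y x) \<and> norm (x - P x) \<le> 1}"
  shows "compact K" and "0 < measure lebesgue K" and "mean K P = cen W" and "continuous_on UNIV P"
proof -
  have c\<mu>: "continuous_on S (\<mu> y)" if "y \<in> W" for y S
    using aff[OF that] by (simp add: continuous_on_cong[OF refl, of S "\<mu> y"] continuous_intros)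
  have cP: "continuous_on S P" for S
    unfolding P by (intro continuous_intros c\<mu>)
  show "continuous_on UNIV P" by (rule cP)
  have \<mu>add: "\<mu> y (x + t *\<^sub>R (z - w)) = \<mu> y x + t * ((if z = y then 1 else 0) - (if w = y then 1 else 0))"
    if "y \<in> W" "z \<in> W" "w \<in> W" for y z w x t
  proof -
    have "c y \<bullet> (z - w) = \<mu> y z - \<mu> y w"
      using that by (simp add: aff inner_diff_right)
    then show ?thesis
      using that by (simp add: aff[of y x] aff[of y "x + t *\<^sub>R (z - w)"] inner_add_right delta)
  qed
  have Padd: "P (x + t *\<^sub>R (z - w)) = P x + t *\<^sub>R (z - w)" if "z \<in> W" "w \<in> W" for z w x t
  proof -
    have "P (x + t *\<^sub>R (z - w))
        = (\<Sum>y\<in>W. \<mu> y x *\<^sub>R y + (if z = y then t *\<^sub>R y else 0) - (if w = y then t *\<^sub>R y else 0))"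
      unfolding P using that by (intro sum.cong refl) (auto simp: \<mu>add scaleR_add_left scaleR_diff_left)
    also have "\<dots> = P x + t *\<^sub>R z - t *\<^sub>R w"
      unfolding P using that fin by (simp add: sum.distrib sum_subtractf)
    finally show ?thesis by (simp add: scaleR_diff_right)
  qed
  have clK: "closed K"
  proof -
    have "K = (\<Inter>y\<in>W. {x. 0 \<le> \<mu> y x}) \<inter> {x. norm (x - P x) \<le> 1}"
      unfolding K by auto
    also have "closed \<dots>"
      by (intro closed_Int closed_INT ballI closed_Collect_le continuous_intros c\<mu> cP)
    finally show ?thesis .
  qed
  have PW: "P x \<in> convex hull W" if "x \<in> K" for x
    unfolding convex_hull_finite[OF fin] P using that one unfolding K by auto
  have "bounded (convex hull W)"
    using fin by (simp add: bounded_convex_hull finite_imp_bounded)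
  then obtain B where B: "norm y \<le> B" if "y \<in> convex hull W" for y
    unfolding bounded_iff by blast
  have "norm x \<le> B + 1" if "x \<in> K" for x
  proof -
    have "norm x \<le> norm (x - P x) + norm (P x)"
      using norm_triangle_ineq[of "x - P x" "P x"] by simp
    also have "\<dots> \<le> B + 1"
      using B[OF PW[OF that]] that unfolding K by auto
    finally show ?thesis .
  qed
  then have "bounded K" unfolding bounded_iff by blast
  with clK show cmp: "compact K" by (simp add: compact_eq_bounded_closed)
  have int: "f integrable_on K" if "continuous_on UNIV f" for f :: "real^'n \<Rightarrow> 'z::euclidean_space"
    using integrable_continuous_compact[OF cmp that] .
  define m where "m = cen W"
  have cW: "real (card W) > 0" using fin ne by (simp add: card_gt_0_iff)
  have \<mu>m: "\<mu> z m = 1 / card W" if "z \<in> W" for z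
  proof -
    have "(\<Sum>y\<in>W. \<mu> z y) = c z \<bullet> \<Sum>W + card W * \<beta> z"
      using that by (simp add: aff inner_sum_right sum.distrib)
    moreover have "(\<Sum>y\<in>W. \<mu> z y) = (\<Sum>y\<in>W. if y = z then 1 else 0)"
      using that by (intro sum.cong refl) (simp add: delta)
    ultimately have "c z \<bullet> \<Sum>W + card W * \<beta> z = 1" using that fin by simp
    then show ?thesis
      using cW that by (simp add: aff m_def cen_def field_simps)
  qed
  have Pm: "P m = m"
    unfolding P m_def cen_def scaleR_sum_right
    by (intro sum.cong refl) (simp add: \<mu>m[unfolded m_def cen_def scaleR_sum_right] divide_inverse)
  \<comment> \<open>A nonempty open subset of \<open>K\<close> around the barycentre, which makes
    the measure of \<open>K\<close> positive.\<close>
  define U where "U = (\<Inter>y\<in>W. {x. 0 < \<mu> y x}) \<inter> {x. norm (x - P x) < 1}"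
  have "open U"
    unfolding U_def using fin by (intro open_Int open_INT ballI open_Collect_less continuous_intros c\<mu> cP)
  moreover have "m \<in> U" using cW by (simp add: U_def \<mu>m Pm)
  moreover have "U \<subseteq> K" unfolding U_def K by force
  ultimately have "\<not> negligible K"
    using open_not_negligible negligible_subset by blast
  then show pos: "0 < measure lebesgue K"
    using cmp by (simp add: negligible_iff_measure lmeasurable_compact zero_less_measure_iff)
  have eq: "integral K (\<mu> y) = integral K (\<mu> z)" if "y \<in> W" "z \<in> W" for y z
  proof (cases "y = z")
    case False
    \<comment> \<open>Swaps the coordinates of \<open>y\<close> and \<open>z\<close> and fixes the
      others. The displacement of \<open>P x\<close> equals that of \<open>x\<close>, so
      \<open>x - P x\<close> does not change and \<open>K\<close> is preserved.\<close>
    define L where "L = (\<lambda>x. x + ((c z - c y) \<bullet> x + (\<beta> z - \<beta> y)) *\<^sub>R (y - z))"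
    have L: "L x = x + (\<mu> z x - \<mu> y x) *\<^sub>R (y - z)" for x
      using that by (simp add: L_def aff inner_diff_left algebra_simps)
    have \<mu>L: "\<mu> w (L x) = (if w = y then \<mu> z x else if w = z then \<mu> y x else \<mu> w x)" if "w \<in> W" for w x
      unfolding L using that \<open>y \<in> W\<close> \<open>z \<in> W\<close> False by (simp add: \<mu>add)
    have PL: "P (L x) = P x + (\<mu> z x - \<mu> y x) *\<^sub>R (y - z)" for x
      unfolding L using that by (rule Padd)
    have LK: "L x \<in> K" if "x \<in> K" for x
    proof -
      have "L x - P (L x) = x - P x" by (simp add: PL) (simp add: L)
      with that show ?thesis
        using \<open>y \<in> W\<close> \<open>z \<in> W\<close> unfolding K by (simp add: \<mu>L)
    qed
    have LL: "L (L x) = x" for x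
      using that False by (subst L) (simp add: \<mu>L, simp add: L algebra_simps)
    have "L ` K = K"
      using LK LL by (auto simp: image_iff) metis
    \<comment> \<open>The determinant of \<open>L\<close> is \<open>1 - 2 = -1\<close>, so the
      change of variables has factor 1.\<close>
    moreover have "(c z - c y) \<bullet> (y - z) = -2"
    proof -
      have "c z \<bullet> (y - z) = \<mu> z y - \<mu> z z" "c y \<bullet> (y - z) = \<mu> y y - \<mu> y z"
        using that by (simp_all add: aff inner_diff_right)
      then show ?thesis using that False by (simp add: inner_diff_left delta)
    qed
    \<comment> \<open>Comparing the integrals of \<open>P\<close> and \<open>P \<circ> L\<close>
      leaves the difference of the two coordinate integrals times \<open>y - z\<close>, which
      therefore vanishes.\<close>
    ultimately have "integral K P = integral K (\<lambda>x. P (L x))"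
      using integral_rank_one_image[OF cmp cP L_def] by simp
    also have "\<dots> = integral K P + integral K (\<lambda>x. (\<mu> z x - \<mu> y x) *\<^sub>R (y - z))"
      unfolding PL using that by (intro integral_add int continuous_intros cP c\<mu>)
    also have "integral K (\<lambda>x. (\<mu> z x - \<mu> y x) *\<^sub>R (y - z)) = integral K (\<lambda>x. \<mu> z x - \<mu> y x) *\<^sub>R (y - z)"
      using that by (intro integral_scaleR_const int continuous_intros c\<mu>)
    also have "integral K (\<lambda>x. \<mu> z x - \<mu> y x) = integral K (\<mu> z) - integral K (\<mu> y)"
      using that by (intro integral_diff int c\<mu>)
    finally show ?thesis using False by simp
  qed simp
  obtain z where z: "z \<in> W" using ne by blast
  have "integral K (\<lambda>x. 1 :: real) = integral K (\<lambda>x. \<Sum>y\<in>W. \<mu> y x)"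
    by (simp add: one)
  also have "\<dots> = (\<Sum>y\<in>W. integral K (\<mu> y))"
    using fin by (intro integral_sum int c\<mu>)
  also have "\<dots> = card W * integral K (\<mu> z)"
    using eq[OF _ z] by simp
  finally have I: "measure lebesgue K = card W * integral K (\<mu> z)"
    using cmp by (simp add: lmeasure_integral lmeasurable_compact)
  have "integral K P = (\<Sum>y\<in>W. integral K (\<lambda>x. \<mu> y x *\<^sub>R y))"
    unfolding P using fin by (intro integral_sum int continuous_intros c\<mu>)
  also have "\<dots> = (\<Sum>y\<in>W. integral K (\<mu> z) *\<^sub>R y)"
    using eq[OF _ z] by (intro sum.cong refl) (simp add: integral_scaleR_const int c\<mu>)
  also have "\<dots> = integral K (\<mu> z) *\<^sub>R \<Sum>W"
    by (simp add: scaleR_sum_right)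
  finally show "mean K P = cen W"
    using I pos cW by (auto simp: mean_def cen_def zero_less_mult_iff)
qed

text \<open>Integration commutes with linear maps. \<open>P\<close> is the identity for elements and
  the projection onto the hyperplane for sides; the null set \<open>N\<close> allows
  \<open>w\<close> to be prescribed on the interior only.\<close>

lemma mean_linear_compose:
  fixes L :: "'a::euclidean_space \<Rightarrow> 'b::euclidean_space" and P :: "real^'n \<Rightarrow> 'a"
  assumes K: "compact K" "0 < measure lebesgue K" and P: "continuous_on UNIV P" and L: "linear L"
    and N: "negligible N" and w: "\<And>x. x \<in> K - N \<Longrightarrow> w x = L (P x) + b"
  shows "mean K w = L (mean K P) + b"
proof -
  have bl: "bounded_linear L" using L linear_conv_bounded_linear by blast
  have "integral K w = integral K (\<lambda>x. L (P x) + b)"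
    by (rule integral_spike[OF N]) (simp add: w)
  also have "\<dots> = integral K (\<lambda>x. L (P x)) + integral K (\<lambda>x. b)"
    using K P by (intro integral_add integrable_continuous_compact continuous_intros
        bounded_linear.continuous_on[OF bl])
  also have "integral K (\<lambda>x. L (P x)) = L (integral K P)"
    using integral_linear[OF integrable_continuous_compact[OF K(1) P] bl] by (simp add: o_def)
  also have "integral K (\<lambda>x. b) = measure lebesgue K *\<^sub>R b"
    using integral_scaleR_const[of "\<lambda>_. 1 :: real" K b] K
    by (simp add: lmeasure_integral lmeasurable_compact integrable_continuous_compact)
  finally show ?thesis
    using K by (simp add: mean_def scaleR_add_right linear_cmul[OF L])
qed

section \<open>Means over a full simplex and over its sides\<close>

context full_simplex
begin

lemma compact_V: "compact (convex hull V)"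
  using finite_V by (simp add: finite_imp_compact_convex_hull)

lemma measure_pos: "0 < measure lebesgue (convex hull V)"
  and mean_id: "mean (convex hull V) (\<lambda>x. x) = cen V"
proof -
  have ne: "V \<noteq> {}" using exists_other_vertex by blast
  \<comment> \<open>For a full simplex \<open>P\<close> is the identity, so the bound on
    \<open>norm (x - P x)\<close> is void and \<open>K\<close> is the simplex itself.\<close>
  have P: "(\<lambda>x. x) = (\<lambda>x. \<Sum>z\<in>V. bary V z x *\<^sub>R z)" by (simp add: sum_bary_scale)
  have K: "convex hull V = {x. (\<forall>z\<in>V. 0 \<le> bary V z x) \<and> norm (x - x) \<le> 1}"
    by (simp add: convex_hull_V)
  have a: "bary V z x = bgrad V z \<bullet> x + (1 - bgrad V z \<bullet> z)" for z x
    by (simp add: bary_def inner_diff_right)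
  note * = mean_barycentric[where \<mu> = "bary V", OF finite_V ne a sum_bary bary_vertex P K]
  show "0 < measure lebesgue (convex hull V)" by (rule *(2))
  show "mean (convex hull V) (\<lambda>x. x) = cen V" by (rule *(3))
qed

lemma mean_affine:
  fixes L :: "real^'n \<Rightarrow> 'b::euclidean_space"
  assumes "linear L" "\<And>x. x \<in> interior (convex hull V) \<Longrightarrow> w x = L x + b"
  shows "mean (convex hull V) w = L (cen V) + b"
proof -
  have "mean (convex hull V) w = L (mean (convex hull V) (\<lambda>x. x)) + b"
  proof (rule mean_linear_compose[OF compact_V measure_pos _ assms(1)])
    show "negligible (frontier (convex hull V))"
      by (rule negligible_convex_frontier) simp
    show "w x = L x + b" if "x \<in> convex hull V - frontier (convex hull V)" for x
      using that compact_V by (intro assms(2)) (auto simp: frontier_def compact_imp_closed)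
  qed (intro continuous_intros)
  then show ?thesis by (simp add: mean_id)
qed

text \<open>The candidate removes just the multiple of the gradient that makes the coordinate of
  \<open>z\<close> nonzero. It is nearest by Pythagoras, since the gradient is orthogonal to the
  hyperplane.\<close>

lemma closest_point_side:
  assumes z: "z \<in> V"
  shows "closest_point (affine hull (V - {z})) x
    = x - (bary V z x / (bgrad V z \<bullet> bgrad V z)) *\<^sub>R bgrad V z" (is "_ = ?P")
proof (rule closest_point_unique[symmetric])
  let ?g = "bgrad V z" and ?H = "affine hull (V - {z})"
  have gg: "?g \<bullet> ?g > 0" using bgrad_nonzero[OF z] by simp
  show "convex ?H" by (simp add: affine_imp_convex)
  show "closed ?H" by simp
  show PH: "?P \<in> ?H"
    using gg unfolding affine_hull_side[OF z] by (simp add: bary_def inner_diff_right)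
  show "\<forall>y\<in>?H. dist x ?P \<le> dist x y"
  proof
    fix y assume "y \<in> ?H"
    then have "?g \<bullet> (?P - y) = 0"
      using PH unfolding affine_hull_side[OF z] by (simp add: bary_diff[symmetric])
    then have "orthogonal (x - ?P) (?P - y)" by (simp add: orthogonal_def)
    from norm_add_Pythagorean[OF this] have "(norm (x - y))\<^sup>2 = (norm (x - ?P))\<^sup>2 + (norm (?P - y))\<^sup>2"
      by (simp del: diff_diff_eq2)
    then have "(norm (x - ?P))\<^sup>2 \<le> (norm (x - y))\<^sup>2" by simp
    then show "dist x ?P \<le> dist x y" by (simp add: dist_norm)
  qed
qed

text \<open>The coordinates of the side, composed with the projection onto its hyperplane, are
  affine on the whole space and describe the cylinder in the form that
  \<open>mean_barycentric\<close> expects.\<close>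

lemma side_mean_affine:
  fixes L :: "real^'n \<Rightarrow> 'b::euclidean_space"
  assumes z: "z \<in> V" and L: "linear L"
    and w: "\<And>x. x \<in> convex hull (V - {z}) \<Longrightarrow> w x = L x + b"
  shows "side_mean (convex hull (V - {z})) w = L (cen (V - {z})) + b"
proof -
  let ?S = "convex hull (V - {z})" and ?W = "V - {z}" and ?g = "bgrad V z"
  have gg: "?g \<bullet> ?g > 0" using bgrad_nonzero[OF z] by simp
  define P where "P = closest_point (affine hull ?W)"
  have P: "P x = x - (bary V z x / (?g \<bullet> ?g)) *\<^sub>R ?g" for x
    unfolding P_def using closest_point_side[OF z] .
  have Pz: "bary V z (P x) = 0" for x
    unfolding P using gg by (simp add: bary_def inner_diff_right)
  define \<mu> where "\<mu> y x = bary V y (P x)" for y x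
  \<comment> \<open>Composition with the projection strips \<open>bgrad V y\<close> of its component
    normal to the side.\<close>
  have aff: "\<mu> y x = (bgrad V y - ((bgrad V y \<bullet> ?g) / (?g \<bullet> ?g)) *\<^sub>R ?g) \<bullet> x + \<mu> y 0" for y x
    unfolding \<mu>_def P by (simp add: bary_def inner_diff_right inner_diff_left algebra_simps add_divide_distrib diff_divide_distrib)
  have ahV: "affine hull ?S = affine hull ?W" by simp
  have inS: "x \<in> ?S \<longleftrightarrow> bary V z x = 0 \<and> (\<forall>y\<in>?W. 0 \<le> bary V y x)" for x
    by (simp add: convex_hull_side[OF z])
  have K: "side_cylinder ?S = {x. (\<forall>y\<in>?W. 0 \<le> \<mu> y x) \<and> norm (x - P x) \<le> 1}"
    unfolding side_cylinder_def ahV P_def[symmetric] inS \<mu>_def by (simp add: Pz dist_norm)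
  have Psum: "P = (\<lambda>x. \<Sum>y\<in>?W. \<mu> y x *\<^sub>R y)"
    using sum_bary_scale[of "P _"] Pz by (simp add: sum.remove[OF finite_V z] \<mu>_def)
  have one: "(\<Sum>y\<in>?W. \<mu> y x) = 1" for x
    using sum_bary[of "P x"] Pz by (simp add: sum.remove[OF finite_V z] \<mu>_def)
  have delta: "\<mu> y y' = (if y' = y then 1 else 0)" if "y \<in> ?W" "y' \<in> ?W" for y y'
    using that z by (simp add: \<mu>_def P bary_vertex)
  have fin: "finite ?W" using finite_V by simp
  note * = mean_barycentric[where \<mu> = \<mu>, OF fin side_nonempty[OF z] aff one delta Psum K]
  have "side_mean ?S w = mean (side_cylinder ?S) (\<lambda>x. w (P x))"
    unfolding side_mean_def ahV P_def ..
  also have "\<dots> = L (mean (side_cylinder ?S) P) + b"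
  proof (rule mean_linear_compose[OF *(1) *(2) *(4) L negligible_empty])
    fix x assume "x \<in> side_cylinder ?S - {}"
    then have "P x \<in> ?S" unfolding side_cylinder_def ahV P_def by simp
    then show "w (P x) = L (P x) + b" by (rule w)
  qed
  also have "mean (side_cylinder ?S) P = cen ?W" by (rule *(3))
  finally show ?thesis .
qed

end

section \<open>Two simplices sharing a side\<close>

locale adjacent_simplices = V: full_simplex V + V': full_simplex V' for V V' :: "(real^'n) set" +
  fixes z z'
  assumes z: "z \<in> V" "z' \<in> V'" and side: "V - {z} = V' - {z'}"
    and disj: "interior (convex hull V) \<inter> interior (convex hull V') = {}"
begin

lemma bary_apex_nonzero: "bary V z z' \<noteq> 0"
  using V'.notin_affine_hull[OF z(2)] V.affine_hull_side[OF z(1)] side by auto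

text \<open>\<open>bary V z\<close> vanishes at the vertices of the common side, hence is a multiple
  of \<open>bary V' z'\<close>; the factor is its value at \<open>z'\<close>, where
  \<open>bary V' z'\<close> is 1.\<close>

lemma bgrad_apex: "bgrad V z = bary V z z' *\<^sub>R bgrad V' z'"
  and bary_apex: "bary V z x = bary V z z' * bary V' z' x"
proof -
  have *: "bgrad V z \<bullet> x + (1 - bgrad V z \<bullet> z) = bary V z x" for x
    by (simp add: bary_def inner_diff_right)
  have **: "bgrad V z \<bullet> y + (1 - bgrad V z \<bullet> z) = 0" if "y \<in> V' - {z'}" for y
    using that z unfolding side[symmetric] * by (simp add: V.bary_vertex)
  show "bgrad V z = bary V z z' *\<^sub>R bgrad V' z'" by (rule V'.bgrad_eqI(1)[OF z(2) * **])
  show "bary V z x = bary V z z' * bary V' z' x"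
    using V'.bgrad_eqI(2)[OF z(2) * **, of x] * by simp
qed

lemma bary_cen_side:
  "\<And>y. y \<in> V - {z} \<Longrightarrow> 0 < bary V y (cen (V - {z}))" "bary V z (cen (V - {z})) = 0"
  "\<And>y. y \<in> V - {z} \<Longrightarrow> 0 < bary V' y (cen (V - {z}))" "bary V' z' (cen (V - {z})) = 0"
proof -
  have sub: "V - {z} \<subseteq> V" "V - {z} \<subseteq> V'" using side by auto
  have pos: "0 < 1 / real (card (V - {z}))" using V.card_side[OF z(1)] by simp
  have z': "z' \<notin> V - {z}" using side by auto
  note b = V.bary_cen[OF sub(1) V.side_nonempty[OF z(1)]] V'.bary_cen[OF sub(2) V.side_nonempty[OF z(1)]]
  show "0 < bary V y (cen (V - {z}))" "0 < bary V' y (cen (V - {z}))" if "y \<in> V - {z}" for y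
    using b(1)[of y] b(2)[of y] that pos sub by (simp_all add: subset_iff)
  show "bary V z (cen (V - {z})) = 0" using b(1)[OF z(1)] by simp
  show "bary V' z' (cen (V - {z})) = 0" using b(2)[OF z(2)] unfolding if_not_P[OF z'] .
qed

text \<open>If both apexes lay on the same side of the common hyperplane, points near the barycentre
  of the common side, shifted slightly towards \<open>z\<close>, would have positive coordinates in
  both simplices and lie in both interiors.\<close>

lemma bary_apex_negative: "bary V z z' < 0"
proof (rule ccontr)
  assume "\<not> bary V z z' < 0"
  then have pos: "0 < bary V z z'" using bary_apex_nonzero by linarith
  let ?m = "cen (V - {z})"
  define x where "x = (\<lambda>e. ?m + e *\<^sub>R (z - ?m))"
  have lim: "((\<lambda>e. bary V'' y (x e)) \<longlongrightarrow> bary V'' y ?m) (at_right 0)" for V'' y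
  proof -
    have "((\<lambda>e. bary V'' y (x e)) \<longlongrightarrow> bgrad V'' y \<bullet> (?m + 0 *\<^sub>R (z - ?m) - y) + 1) (at_right 0)"
      unfolding bary_def x_def by (intro tendsto_intros)
    then show ?thesis by (simp add: bary_def)
  qed
  have ev: "\<forall>\<^sub>F e in at_right 0. \<forall>y\<in>V - {z}. 0 < bary V y (x e) \<and> 0 < bary V' y (x e)"
  proof (rule eventually_ball_finite)
    show "finite (V - {z})" using V.finite_V by simp
    show "\<forall>y\<in>V - {z}. \<forall>\<^sub>F e in at_right 0. 0 < bary V y (x e) \<and> 0 < bary V' y (x e)"
      using order_tendstoD(1)[OF lim] bary_cen_side by (auto intro!: eventually_conj)
  qed
  moreover have "\<forall>\<^sub>F e in at_right (0::real). 0 < e"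
    by (simp add: eventually_at_right_less)
  ultimately have "\<forall>\<^sub>F e in at_right (0::real). 0 < e \<and> (\<forall>y\<in>V - {z}. 0 < bary V y (x e) \<and> 0 < bary V' y (x e))"
    by (rule eventually_elim2) blast
  from eventually_happens'[OF trivial_limit_at_right_real this] obtain e where e: "0 < e" "\<And>y. y \<in> V - {z} \<Longrightarrow> 0 < bary V y (x e) \<and> 0 < bary V' y (x e)"
    by blast
  have "bary V z (x e) = e"
    using bary_add[of V z ?m] bary_diff[of V z z ?m, symmetric] bary_cen_side(2) z
    by (simp add: x_def V.bary_vertex)
  then have "0 < bary V z (x e)" "0 < bary V' z' (x e)"
    using e(1) pos bary_apex[of "x e"] by (simp, metis zero_less_mult_pos)
  then have "\<forall>y\<in>V. 0 < bary V y (x e)" "\<forall>y\<in>V'. 0 < bary V' y (x e)"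
    using e(2) side by (metis Diff_iff singletonD)+
  then have "x e \<in> interior (convex hull V) \<inter> interior (convex hull V')"
    by (simp add: V.interior_V V'.interior_V)
  then show False using disj by blast
qed

text \<open>The affine map that fixes the common side and sends \<open>z\<close> to
  \<open>z'\<close> carries one simplex onto the other and has determinant
  \<open>bary V z z'\<close>. Volumes scale by its absolute value, gradients by its inverse, and its
  negative sign makes the area-weighted normals opposite.\<close>

lemma measure_bgrad:
  "measure lebesgue (convex hull V') *\<^sub>R bgrad V' z' = - (measure lebesgue (convex hull V) *\<^sub>R bgrad V z)"
proof -
  let ?w = "z' - z"
  define L where "L = (\<lambda>x. x + (bgrad V z \<bullet> x + (1 - bgrad V z \<bullet> z)) *\<^sub>R ?w)"
  have L: "L x = x + bary V z x *\<^sub>R ?w" for x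
    by (simp add: L_def bary_def inner_diff_right)
  have LV: "L y = (if y = z then z' else y)" if "y \<in> V" for y
    using that z by (simp add: L V.bary_vertex)
  have "L ` V = V'"
  proof -
    have "L ` V = insert (L z) (L ` (V - {z}))" using z by blast
    also have "L ` (V - {z}) = V - {z}" using LV by auto
    also have "insert (L z) (V - {z}) = V'" using LV[OF z(1)] z(2) unfolding side by auto
    finally show ?thesis .
  qed
  moreover have "L ` (convex hull V) = convex hull (L ` V)"
  proof -
    define M where "M = (\<lambda>x. x + (bgrad V z \<bullet> x) *\<^sub>R ?w)"
    have lin: "linear M"
      unfolding M_def by (intro linearI) (simp_all add: algebra_simps inner_add_right)
    have LM: "L = (\<lambda>x. (1 - bgrad V z \<bullet> z) *\<^sub>R ?w + x) \<circ> M"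
      by (simp add: fun_eq_iff L_def M_def algebra_simps)
    show ?thesis
      unfolding LM image_comp[symmetric] convex_hull_translation convex_hull_linear_image[OF lin] ..
  qed
  ultimately have "measure lebesgue (convex hull V') = \<bar>1 + bgrad V z \<bullet> ?w\<bar> * measure lebesgue (convex hull V)"
    using measure_rank_one_image[OF V.compact_V, of "bgrad V z" "1 - bgrad V z \<bullet> z" ?w]
    unfolding L_def[symmetric] by simp
  also have "1 + bgrad V z \<bullet> ?w = bary V z z'"
    by (simp add: bary_def)
  finally show ?thesis
    using bary_apex_negative by (simp add: bgrad_apex)
qed

text \<open>On the common hyperplane the coordinates of the shared vertices agree in both simplices.
  Near \<open>p\<close> they stay positive in both, and the sign of \<open>bary V z\<close> decides
  which simplex contains a point.\<close>

lemma side_in_interior_union: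
  assumes p: "bary V z p = 0" "\<And>y. y \<in> V - {z} \<Longrightarrow> 0 < bary V y p"
  shows "p \<in> interior (convex hull V \<union> convex hull V')"
proof -
  have p': "bary V' y p = bary V y p" if "y \<in> V - {z}" for y
  proof -
    define u where "u = (\<lambda>y. if y = z' then 0 else bary V y p)"
    have "z' \<notin> V - {z}" using side by auto
    then have *: "u y = bary V y p" if "y \<in> V - {z}" for y using that by (auto simp: u_def)
    have s: "sum h V = h z + sum h (V - {z})" "sum h V' = h z' + sum h (V - {z})"
      for h :: "real^'n \<Rightarrow> 'z::comm_monoid_add"
      using sum.remove[OF V.finite_V z(1)] sum.remove[OF V'.finite_V z(2)] side by metis+
    have "sum u V' = 1" "p = (\<Sum>y\<in>V'. u y *\<^sub>R y)"
      using V.sum_bary[of p] V.sum_bary_scale[of p] p(1) * unfolding s by (auto simp: u_def)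
    from V'.bary_unique[OF this] that side show ?thesis by (metis * Diff_iff)
  qed
  define U where "U = (\<Inter>y\<in>V - {z}. {x. 0 < bary V y x} \<inter> {x. 0 < bary V' y x})"
  have "open U"
    unfolding U_def using V.finite_V
    by (intro open_INT open_Int ballI open_Collect_less continuous_intros) auto
  moreover have "p \<in> U" using p p' by (auto simp: U_def)
  moreover have "U \<subseteq> convex hull V \<union> convex hull V'"
  proof
    fix x assume x: "x \<in> U"
    show "x \<in> convex hull V \<union> convex hull V'"
    proof (cases "0 \<le> bary V z x")
      case True
      then have "\<forall>y\<in>V. 0 \<le> bary V y x" using x by (force simp: U_def intro: less_imp_le)
      then show ?thesis by (simp add: V.convex_hull_V)
    next
      case False
      then have "0 \<le> bary V' z' x"
        using bary_apex[of x] bary_apex_negative by (simp add: not_le mult_less_0_iff)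
      moreover have "\<forall>y\<in>V' - {z'}. 0 \<le> bary V' y x" using x unfolding side[symmetric] U_def by (auto intro: less_imp_le)
      ultimately have "\<forall>y\<in>V'. 0 \<le> bary V' y x" by blast
      then show ?thesis by (simp add: V'.convex_hull_V)
    qed
  qed
  ultimately show ?thesis by (rule interiorI)
qed

end


section \<open>Removing sets of codimension two\<close>

lemma negligible_affine_lowdim:
  fixes S :: "'a::euclidean_space set"
  assumes "aff_dim S < DIM('a)"
  shows "negligible S"
proof -
  obtain a b where "a \<noteq> 0" "S \<subseteq> {x. a \<bullet> x = b}"
    using aff_lowdim_subset_hyperplane[OF assms] by blast
  then show ?thesis using negligible_hyperplane negligible_subset by blast
qed

text \<open>Suppose \<open>P\<close> and \<open>Q\<close> split the rest. The removed set is null,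
  so their closures cover \<open>W\<close> and meet at some \<open>w\<close>. Near \<open>w\<close>,
  a point \<open>x\<close> of \<open>P\<close> is joined to a generic point \<open>y\<close> of
  \<open>Q\<close> by a segment that misses every removed set.\<close>

lemma connected_open_minus_codim2:
  fixes W :: "'a::euclidean_space set"
  assumes W: "open W" "connected W" and E: "finite \<E>" "\<And>E. E \<in> \<E> \<Longrightarrow> closed E"
    and dim: "\<And>E. E \<in> \<E> \<Longrightarrow> aff_dim E \<le> int DIM('a) - 2"
  shows "connected (W - \<Union>\<E>)"
proof (rule connectedI)
  fix A B assume AB: "open A" "open B" "A \<inter> (W - \<Union>\<E>) \<noteq> {}" "B \<inter> (W - \<Union>\<E>) \<noteq> {}"
    "A \<inter> B \<inter> (W - \<Union>\<E>) = {}" "W - \<Union>\<E> \<subseteq> A \<union> B"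
  have clN: "closed (\<Union>\<E>)" using E by blast
  have negN: "negligible (\<Union>\<E>)"
    using E(1) dim by (intro negligible_Union negligible_affine_lowdim) force+
  define P Q where "P = A \<inter> (W - \<Union>\<E>)" and "Q = B \<inter> (W - \<Union>\<E>)"
  have PQ: "open P" "open Q" "P \<noteq> {}" "Q \<noteq> {}" "P \<inter> Q = {}" "P \<union> Q = W - \<Union>\<E>"
    using AB W clN by (auto simp: P_def Q_def)
  have "W \<subseteq> closure P \<union> closure Q"
  proof (rule ccontr)
    assume "\<not> W \<subseteq> closure P \<union> closure Q"
    then have "W - (closure P \<union> closure Q) \<noteq> {}" by blast
    moreover have "open (W - (closure P \<union> closure Q))" using W by (intro open_Diff) auto
    moreover have "W - (closure P \<union> closure Q) \<subseteq> \<Union>\<E>"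
      using PQ(6) closure_subset[of P] closure_subset[of Q] by blast
    ultimately show False using open_not_negligible negligible_subset[OF negN] by blast
  qed
  moreover have "closure P \<inter> W \<noteq> {}" "closure Q \<inter> W \<noteq> {}"
    using PQ closure_subset[of P] closure_subset[of Q] by blast+
  ultimately have "closure P \<inter> closure Q \<inter> W \<noteq> {}"
    using W(2) closed_closure[of P] closed_closure[of Q] unfolding connected_closed by blast
  then obtain w where w: "w \<in> closure P" "w \<in> closure Q" "w \<in> W" by blast
  obtain e where e: "e > 0" "ball w e \<subseteq> W" using W(1) w(3) open_contains_ball by blast
  obtain x where x: "x \<in> P" "x \<in> ball w e"
    using w(1) e(1) by (metis closure_approachable dist_commute mem_ball)
  \<comment> \<open>Adding \<open>x\<close> raises the dimension by at most one, so these affine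
    hulls still have codimension at least one and are null.\<close>
  define Z where "Z = (\<Union>E\<in>\<E>. affine hull (insert x E))"
  have "negligible Z"
    unfolding Z_def
  proof (intro negligible_Union finite_imageI E)
    fix S assume "S \<in> (\<lambda>E. affine hull (insert x E)) ` \<E>"
    then obtain E where "E \<in> \<E>" "S = affine hull (insert x E)" by blast
    then have "aff_dim S < DIM('a)" using dim[of E] by (simp add: aff_dim_insert)
    then show "negligible S" by (rule negligible_affine_lowdim)
  qed
  moreover have "open (Q \<inter> ball w e)" using PQ by blast
  moreover have "Q \<inter> ball w e \<noteq> {}"
    using w(2) e(1) by (metis closure_approachable dist_commute mem_ball disjoint_iff)
  ultimately have "\<not> Q \<inter> ball w e \<subseteq> Z"
    using open_not_negligible negligible_subset by blast
  then obtain y where y: "y \<in> Q" "y \<in> ball w e" "y \<notin> Z" by blast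
  have seg: "closed_segment x y \<subseteq> ball w e"
    using x y by (simp add: closed_segment_subset)
  have "closed_segment x y \<inter> \<Union>\<E> = {}"
  proof (rule ccontr)
    assume "closed_segment x y \<inter> \<Union>\<E> \<noteq> {}"
    then obtain p E where p: "p \<in> closed_segment x y" "p \<in> E" "E \<in> \<E>" by blast
    then obtain t where t: "p = (1 - t) *\<^sub>R x + t *\<^sub>R y" by (auto simp: in_segment)
    have "p \<noteq> x" using p x PQ(6) by blast
    then have "t \<noteq> 0" using t by auto
    \<comment> \<open>A segment that meets \<open>E\<close> in \<open>p\<close> would put
      \<open>y\<close> on the line through \<open>x\<close> and \<open>p\<close>, hence into
      \<open>Z\<close>.\<close>
    then have "y = (1 - 1 / t) *\<^sub>R x + (1 / t) *\<^sub>R p"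
      unfolding t by (simp add: algebra_simps)
    moreover have "x \<in> affine hull (insert x E)" "p \<in> affine hull (insert x E)"
      using p by (simp_all add: hull_inc)
    ultimately have "y \<in> affine hull (insert x E)"
      using mem_affine[OF affine_affine_hull, of x "insert x E" p "1 - 1 / t" "1 / t"] by simp
    then show False using y(3) p(3) by (auto simp: Z_def)
  qed
  then have sub: "closed_segment x y \<subseteq> P \<union> Q" using PQ(6) e seg by blast
  have "x \<in> closed_segment x y" "y \<in> closed_segment x y" by auto
  then have "P \<inter> closed_segment x y \<noteq> {}" "Q \<inter> closed_segment x y \<noteq> {}" using x y by blast+
  with connectedD[OF connected_segment PQ(1,2), of x y] PQ(5) sub show False by blast
qed

section \<open>Combinatorics of the mesh\<close>

definition verts :: "(real^'n) set \<Rightarrow> (real^'n) set" where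
  "verts T = {v. v extreme_point_of T}"

lemma verts_convex_hull: "\<not> affine_dependent C \<Longrightarrow> verts (convex hull C) = C"
  by (auto simp: verts_def extreme_point_of_convex_hull_affine_independent)

lemma full_simplex_verts:
  assumes "int CARD('n) simplex (T :: (real^'n) set)"
  shows "full_simplex (verts T)" and "convex hull (verts T) = T"
proof -
  obtain C where C: "\<not> affine_dependent C" "int (card C) = int CARD('n) + 1" "T = convex hull C"
    using assms unfolding simplex_def by blast
  then show "full_simplex (verts T)" "convex hull (verts T) = T"
    by (simp_all add: verts_convex_hull full_simplex_def)
qed

context full_simplex
begin

lemma facet_iff: "S facet_of convex hull V \<longleftrightarrow> (\<exists>z\<in>V. S = convex hull (V - {z}))"
proof -
  have "convex hull (V - {z}) \<noteq> {}" if "z \<in> V" for z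
    using side_nonempty[OF that] by (simp only: convex_hull_eq_empty not_False_eq_True)
  then show ?thesis
    unfolding facet_of_convex_hull_affine_independent[OF indep] by blast
qed

lemma verts_side: "verts (convex hull (V - {z})) = V - {z}"
  using affine_independent_subset[OF indep, of "V - {z}"] by (simp add: verts_convex_hull)

lemma side_inject: "convex hull (V - {z}) = convex hull (V - {y}) \<Longrightarrow> z \<in> V \<Longrightarrow> y = z"
  by (metis verts_side Diff_iff insertCI singletonD)

end

text \<open>Rules out slits: from a boundary point, a small step along \<open>- e\<close> leads
  strictly below the graph, where an open set misses the domain; so points outside the closure are
  arbitrarily near.\<close>

lemma interior_closure_Lipschitz:
  fixes \<Omega> :: "(real^'n) set"
  assumes "polyhedral_lipschitz_domain \<Omega>"
  shows "interior (closure \<Omega>) = \<Omega>"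
proof
  have op: "open \<Omega>" using assms by (simp add: polyhedral_lipschitz_domain_def)
  then show "\<Omega> \<subseteq> interior (closure \<Omega>)"
    by (simp add: interior_maximal closure_subset)
  show "interior (closure \<Omega>) \<subseteq> \<Omega>"
  proof (rule ccontr)
    assume "\<not> interior (closure \<Omega>) \<subseteq> \<Omega>"
    then obtain z where z: "z \<in> interior (closure \<Omega>)" "z \<notin> \<Omega>" by blast
    then have "z \<in> frontier \<Omega>"
      using op interior_subset by (auto simp: frontier_def interior_open)
    then obtain e r L \<phi> where e: "norm e = 1" and r: "0 < r" and lip: "L-lipschitz_on {y. e \<bullet> y = 0} \<phi>"
      and gr: "\<And>x. x \<in> ball z r \<Longrightarrow> x \<in> \<Omega> \<longleftrightarrow> \<phi> (x - (e \<bullet> x) *\<^sub>R e) < e \<bullet> x"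
      using assms unfolding polyhedral_lipschitz_domain_def by metis
    have ee: "e \<bullet> e = 1" using e by (simp add: norm_eq_1)
    obtain s where s: "s > 0" "ball z s \<subseteq> closure \<Omega>"
      using z(1) by (auto simp: mem_interior)
    define t where "t = min r s / 2"
    have t: "0 < t" "t < r" "t < s" using r s by (auto simp: t_def min_def)
    define q where "q = z - t *\<^sub>R e"
    define h where "h x = \<phi> (x - (e \<bullet> x) *\<^sub>R e) - e \<bullet> x" for x
    have "continuous_on UNIV h"
      unfolding h_def
      by (intro continuous_intros continuous_on_compose2[OF lipschitz_on_continuous_on[OF lip]])
        (auto simp: inner_diff_right ee)
    then have oh: "open {x. 0 < h x}"
      by (intro open_Collect_less continuous_intros) auto
    have "h z \<ge> 0" using gr[of z] z(2) r by (simp add: h_def)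
    moreover have "h q = h z + t"
      by (simp add: h_def q_def inner_diff_right ee algebra_simps)
    ultimately have "q \<in> {x. 0 < h x} \<inter> ball z r"
      using t e by (simp add: q_def dist_norm)
    moreover have "q \<in> closure \<Omega>"
      using t e s(2) by (auto simp: q_def dist_norm)
    ultimately obtain x where "x \<in> \<Omega>" "0 < h x" "x \<in> ball z r"
      using oh open_Int_closure_eq_empty[of "{x. 0 < h x} \<inter> ball z r" \<Omega>] by blast
    then show False using gr[of x] by (simp add: h_def)
  qed
qed

locale mesh =
  fixes \<Omega> \<Gamma>D \<Gamma>N :: "(real^'n) set" and \<T> :: "(real^'n) set set"
  assumes dom: "polyhedral_lipschitz_domain \<Omega>"
    and parts: "boundary_parts \<Omega> \<Gamma>D \<Gamma>N"
    and mesh: "mesh_of \<Omega> \<Gamma>D \<Gamma>N \<T>"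
begin

lemma finite_mesh: "finite \<T>"
  using mesh by (simp add: mesh_of_def triangulation_def)

lemma Union_mesh: "\<Union>\<T> = closure \<Omega>"
  using mesh by (simp add: mesh_of_def)

lemma full_simplex_elt: "T \<in> \<T> \<Longrightarrow> full_simplex (verts T)"
  and hull_verts: "T \<in> \<T> \<Longrightarrow> convex hull (verts T) = T"
  using mesh full_simplex_verts by (auto simp: mesh_of_def)

lemma face_Int: "T \<in> \<T> \<Longrightarrow> T' \<in> \<T> \<Longrightarrow> (T \<inter> T') face_of T"
  using mesh by (simp add: mesh_of_def triangulation_def)

lemma open_domain: "open \<Omega>" and connected_domain: "connected \<Omega>"
  using dom by (auto simp: polyhedral_lipschitz_domain_def)

lemmas interior_closure_domain = interior_closure_Lipschitz[OF dom]

lemma compact_elt: "T \<in> \<T> \<Longrightarrow> compact T" and convex_elt: "T \<in> \<T> \<Longrightarrow> convex T"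
  using full_simplex.compact_V[OF full_simplex_elt] hull_verts convex_convex_hull by metis+

lemma interior_elt: "T \<in> \<T> \<Longrightarrow> interior T = {x. \<forall>z\<in>verts T. 0 < bary (verts T) z x}"
  and elt_eq: "T \<in> \<T> \<Longrightarrow> T = {x. \<forall>z\<in>verts T. 0 \<le> bary (verts T) z x}"
  using full_simplex.interior_V[OF full_simplex_elt] full_simplex.convex_hull_V[OF full_simplex_elt]
  by (simp_all add: hull_verts)

lemma interior_elt_nonempty: "T \<in> \<T> \<Longrightarrow> interior T \<noteq> {}"
  using full_simplex.cen_interior[OF full_simplex_elt] hull_verts by fastforce

lemma interior_elt_subset: assumes "T \<in> \<T>" shows "interior T \<subseteq> \<Omega>"
proof -
  have "T \<subseteq> closure \<Omega>" using Union_mesh assms by blast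
  then show ?thesis using interior_mono interior_closure_domain by metis
qed

text \<open>The common part is a face of both elements, and a proper face misses the interior. So a
  common point in the interior of \<open>T\<close> would make it equal to \<open>T\<close> and then
  to \<open>T'\<close>.\<close>

lemma interior_Int_elt:
  assumes "T \<in> \<T>" "T' \<in> \<T>" "T \<noteq> T'"
  shows "interior T \<inter> T' = {}"
proof (rule ccontr)
  assume ne: "interior T \<inter> T' \<noteq> {}"
  have f: "(T \<inter> T') face_of T" "(T \<inter> T') face_of T'"
    using face_Int[of T T'] face_Int[of T' T] assms by (auto simp: Int_commute)
  have "T \<inter> T' = T"
  proof (rule ccontr)
    assume "T \<inter> T' \<noteq> T"
    from face_of_disjoint_interior[OF f(1) this] ne interior_subset[of T] show False by blast
  qed
  then have TT': "T \<subseteq> T'" by blast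
  then have "interior T \<subseteq> interior T'" by (rule interior_mono)
  then have "T \<inter> T' = T'"
    using face_of_disjoint_interior[OF f(2)] ne interior_subset[of T] interior_elt_nonempty[OF assms(1)] TT' by blast
  then show False using \<open>T \<inter> T' = T\<close> assms(3) by blast
qed

lemma interiors_disjoint: "T \<in> \<T> \<Longrightarrow> T' \<in> \<T> \<Longrightarrow> T \<noteq> T' \<Longrightarrow> interior T \<inter> interior T' = {}"
  using interior_Int_elt interior_subset by blast

section \<open>Sides, opposite vertices and neighbouring elements\<close>

lemma facet_elt_iff:
  assumes "T \<in> \<T>"
  shows "S facet_of T \<longleftrightarrow> (\<exists>z\<in>verts T. S = convex hull (verts T - {z}))"
  using full_simplex.facet_iff[OF full_simplex_elt[OF assms], of S] by (simp add: hull_verts assms)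

definition apex :: "(real^'n) set \<Rightarrow> (real^'n) set \<Rightarrow> real^'n" where
  "apex T S = (THE z. z \<in> verts T \<and> S = convex hull (verts T - {z}))"

lemma apex_side:
  assumes "T \<in> \<T>" "z \<in> verts T"
  shows "apex T (convex hull (verts T - {z})) = z"
  unfolding apex_def
proof (rule the_equality)
  show "y = z" if "y \<in> verts T \<and> convex hull (verts T - {z}) = convex hull (verts T - {y})" for y
    using that assms(2) by (intro full_simplex.side_inject[OF full_simplex_elt[OF assms(1)]]) auto
qed (use assms in auto)

lemma apex:
  assumes "T \<in> \<T>" "S facet_of T"
  shows "apex T S \<in> verts T" "convex hull (verts T - {apex T S}) = S" "verts S = verts T - {apex T S}"
proof -
  obtain z where "z \<in> verts T" "S = convex hull (verts T - {z})"
    using assms facet_elt_iff by blast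
  then show "apex T S \<in> verts T" "convex hull (verts T - {apex T S}) = S" "verts S = verts T - {apex T S}"
    by (simp_all add: apex_side[OF assms(1)] full_simplex.verts_side[OF full_simplex_elt[OF assms(1)]])
qed

lemma mem_side_iff:
  assumes "T \<in> \<T>" "S facet_of T"
  shows "x \<in> S \<longleftrightarrow> bary (verts T) (apex T S) x = 0 \<and> (\<forall>y\<in>verts S. 0 \<le> bary (verts T) y x)"
proof -
  have "x \<in> convex hull (verts T - {apex T S}) \<longleftrightarrow> bary (verts T) (apex T S) x = 0 \<and>
    (\<forall>y\<in>verts T - {apex T S}. 0 \<le> bary (verts T) y x)"
    using full_simplex.convex_hull_side[OF full_simplex_elt[OF assms(1)] apex(1)[OF assms]] by simp
  then show ?thesis by (simp only: apex(2,3)[OF assms])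
qed

lemma adjacent:
  assumes "T \<in> \<T>" "T' \<in> \<T>" "T \<noteq> T'" "S facet_of T" "S facet_of T'"
  shows "adjacent_simplices (verts T) (verts T') (apex T S) (apex T' S)"
proof -
  interpret V: full_simplex "verts T" by (rule full_simplex_elt[OF assms(1)])
  interpret V': full_simplex "verts T'" by (rule full_simplex_elt[OF assms(2)])
  show ?thesis
  proof
    show "apex T S \<in> verts T" "apex T' S \<in> verts T'" "verts T - {apex T S} = verts T' - {apex T' S}"
      using apex assms by metis+
    show "interior (convex hull verts T) \<inter> interior (convex hull verts T') = {}"
      using interiors_disjoint assms by (simp add: hull_verts)
  qed
qed

lemma cen_side:
  assumes "T \<in> \<T>" "S facet_of T"
  shows "bary (verts T) (apex T S) (cen (verts S)) = 0"
    and "y \<in> verts S \<Longrightarrow> bary (verts T) y (cen (verts S)) = 1 / CARD('n)"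
    and "cen (verts S) \<in> S"
proof -
  interpret V: full_simplex "verts T" by (rule full_simplex_elt[OF assms(1)])
  note a = apex[OF assms]
  have sub: "verts S \<subseteq> verts T" "verts S \<noteq> {}" "card (verts S) = CARD('n)"
    unfolding a(3) using V.side_nonempty[OF a(1)] V.card_side[OF a(1)] by (blast, blast, simp)
  have "apex T S \<notin> verts S" unfolding a(3) by blast
  then show b: "bary (verts T) (apex T S) (cen (verts S)) = 0"
    using V.bary_cen[OF sub(1,2) a(1)] by simp
  show b': "bary (verts T) y (cen (verts S)) = 1 / CARD('n)" if "y \<in> verts S" for y
    using V.bary_cen[OF sub(1,2), of y] sub(1) that unfolding sub(3) by (simp add: subset_iff)
  show "cen (verts S) \<in> S"
    unfolding mem_side_iff[OF assms] using b b' by simp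
qed

text \<open>The two elements fill a neighbourhood of each relatively interior point of their common
  side, and the interior of the closed domain is \<open>\<Omega>\<close> itself.\<close>

lemma shared_side_interior:
  assumes "T \<in> \<T>" "T' \<in> \<T>" "T \<noteq> T'" "S facet_of T" "S facet_of T'"
    and "bary (verts T) (apex T S) p = 0" "\<And>y. y \<in> verts S \<Longrightarrow> 0 < bary (verts T) y p"
  shows "p \<in> \<Omega>"
proof -
  interpret adjacent_simplices "verts T" "verts T'" "apex T S" "apex T' S"
    by (rule adjacent[OF assms(1-5)])
  have "p \<in> interior (convex hull (verts T) \<union> convex hull (verts T'))"
    using assms(6,7) apex(3)[OF assms(1,4)] by (intro side_in_interior_union) auto
  also have "\<dots> \<subseteq> interior (closure \<Omega>)"
    using assms(1,2) Union_mesh by (intro interior_mono) (auto simp: hull_verts)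
  finally show ?thesis by (simp add: interior_closure_domain)
qed

lemma shared_side_not_boundary:
  assumes "T \<in> \<T>" "T' \<in> \<T>" "T \<noteq> T'" "S facet_of T" "S facet_of T'"
  shows "\<not> S \<subseteq> frontier \<Omega>"
proof -
  have "cen (verts S) \<in> \<Omega>"
    using cen_side[OF assms(1,4)] by (intro shared_side_interior[OF assms]) auto
  then show ?thesis
    using cen_side(3)[OF assms(1,4)] open_domain by (auto simp: frontier_def interior_open)
qed

text \<open>The face \<open>T \<inter> T'\<close> contains a point whose coordinates at all vertices
  of \<open>S\<close> are positive, hence contains all these vertices. It is not all of
  \<open>T\<close>, so it is \<open>S\<close>.\<close>

lemma side_interior_facet:
  assumes T: "T \<in> \<T>" "S facet_of T"
    and p: "bary (verts T) (apex T S) p = 0" "\<And>y. y \<in> verts S \<Longrightarrow> 0 < bary (verts T) y p"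
    and T': "T' \<in> \<T>" "T' \<noteq> T" "p \<in> T'"
  shows "S facet_of T'"
proof -
  interpret V: full_simplex "verts T" by (rule full_simplex_elt[OF T(1)])
  note a = apex[OF T]
  have pS: "p \<in> S"
    unfolding mem_side_iff[OF T] using p by (blast intro: less_imp_le)
  then have pT: "p \<in> T" using T(2) facet_of_imp_subset by blast
  have f: "(T \<inter> T') face_of T" "(T \<inter> T') face_of T'"
    using face_Int[of T T'] face_Int[of T' T] T(1) T'(1) by (auto simp: Int_commute)
  then obtain C where C: "C \<subseteq> verts T" "T \<inter> T' = convex hull C"
    using face_of_convex_hull_affine_independent[OF V.indep, of "T \<inter> T'"]
    unfolding hull_verts[OF T(1)] by blast
  have "y \<in> C" if y: "y \<in> verts S" for y
  proof (rule ccontr)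
    assume "y \<notin> C"
    then have "C \<subseteq> verts T - {y}" using C by blast
    then have "convex hull C \<subseteq> convex hull (verts T - {y})" by (rule hull_mono)
    moreover have "p \<in> convex hull C" using pT T'(3) C by blast
    ultimately have "bary (verts T) y p = 0"
      using V.convex_hull_side[of y] y unfolding a(3) by blast
    then show False using p(2)[OF y] by simp
  qed
  then have "verts S \<subseteq> C" by blast
  then consider "C = verts S" | "C = verts T" using C(1) a(1,3) by blast
  then show ?thesis
  proof cases
    case 1
    then have "T \<inter> T' = S" using C(2) unfolding 1 a(3) a(2) by blast
    then have "S face_of T'" using f by simp
    moreover have "aff_dim S = aff_dim T - 1" "S \<noteq> {}" using T(2) by (auto simp: facet_of_def)
    moreover have "aff_dim T = aff_dim T'"
      using interior_elt_nonempty T(1) T'(1) by (metis aff_dim_nonempty_interior)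
    ultimately show ?thesis by (simp add: facet_of_def)
  next
    case 2
    then have "T \<subseteq> T'" using C hull_verts[OF T(1)] by blast
    then show ?thesis
      using interior_Int_elt[OF T(1) T'(1)] T' interior_elt_nonempty[OF T(1)] interior_subset[of T] by blast
  qed
qed

text \<open>The other elements are finitely many, closed, and miss \<open>p\<close>, since otherwise
  \<open>S\<close> would be a side of them too. So near \<open>p\<close> the closed domain consists
  of \<open>T\<close> alone.\<close>

lemma unshared_side_nbhd:
  assumes T: "T \<in> \<T>" "S facet_of T" and un: "\<And>T'. T' \<in> \<T> \<Longrightarrow> S facet_of T' \<Longrightarrow> T' = T"
    and p: "bary (verts T) (apex T S) p = 0" "\<And>y. y \<in> verts S \<Longrightarrow> 0 < bary (verts T) y p"
  obtains U where "open U" "p \<in> U" "U \<inter> closure \<Omega> \<subseteq> T" "U \<inter> frontier \<Omega> \<subseteq> S" "p \<in> frontier \<Omega>"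
proof -
  interpret V: full_simplex "verts T" by (rule full_simplex_elt[OF T(1)])
  note a = apex[OF T]
  have pS: "p \<in> S"
    unfolding mem_side_iff[OF T] using p by (blast intro: less_imp_le)
  then have pT: "p \<in> T" using T(2) facet_of_imp_subset by blast
  have notin: "p \<notin> T'" if "T' \<in> \<T>" "T' \<noteq> T" for T'
    using side_interior_facet[OF T p that] un that by blast
  define U where "U = (\<Inter>y\<in>verts S. {x. 0 < bary (verts T) y x}) - \<Union>(\<T> - {T})"
  have "closed (\<Union>(\<T> - {T}))"
    using finite_mesh compact_elt compact_imp_closed by (intro closed_Union) auto
  moreover have "open (\<Inter>y\<in>verts S. {x. 0 < bary (verts T) y x})"
    using a(3) V.finite_V by (intro open_INT ballI open_Collect_less continuous_intros) auto
  ultimately have oU: "open U" unfolding U_def by (rule open_Diff[rotated])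
  have pU: "p \<in> U" using p(2) notin by (auto simp: U_def)
  have UT: "U \<inter> closure \<Omega> \<subseteq> T" unfolding U_def Union_mesh[symmetric] by blast
  have US: "U \<inter> frontier \<Omega> \<subseteq> S"
  proof
    fix q assume q: "q \<in> U \<inter> frontier \<Omega>"
    then have qT: "q \<in> T" using UT by (auto simp: frontier_def)
    have "q \<notin> interior T" using q interior_elt_subset[OF T(1)] open_domain by (auto simp: frontier_def interior_open)
    then have "\<not> 0 < bary (verts T) (apex T S) q"
      using q a(3) unfolding interior_elt[OF T(1)] U_def by auto
    moreover have "\<forall>y\<in>verts T. 0 \<le> bary (verts T) y q" using qT elt_eq[OF T(1)] by blast
    ultimately have "bary (verts T) (apex T S) q = 0" using a(1) by force
    then show "q \<in> S"
      using \<open>\<forall>y\<in>verts T. 0 \<le> bary (verts T) y q\<close> a(3) unfolding mem_side_iff[OF T] by blast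
  qed
  have "p \<notin> \<Omega>"
  proof
    assume "p \<in> \<Omega>"
    then have "p \<in> interior T"
      using oU pU UT open_domain closure_subset[of \<Omega>] by (intro interiorI[of "U \<inter> \<Omega>"]) auto
    then show False using p(1) a(1) interior_elt[OF T(1)] by force
  qed
  then have "p \<in> frontier \<Omega>"
    using pT T(1) Union_mesh open_domain by (auto simp: frontier_def interior_open)
  with oU pU UT US show thesis using that by blast
qed

text \<open>Relatively interior points of \<open>S\<close> are boundary points by the neighbourhoods
  above; every other point of \<open>S\<close> is a limit of such points along the segment to the
  barycentre of the side.\<close>

lemma unshared_side_boundary:
  assumes T: "T \<in> \<T>" "S facet_of T" and un: "\<And>T'. T' \<in> \<T> \<Longrightarrow> S facet_of T' \<Longrightarrow> T' = T"
  shows "S \<subseteq> frontier \<Omega>"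
proof
  fix x assume x: "x \<in> S"
  interpret V: full_simplex "verts T" by (rule full_simplex_elt[OF T(1)])
  note a = apex[OF T]
  let ?m = "cen (verts S)"
  define q where "q = (\<lambda>e::real. x + e *\<^sub>R (?m - x))"
  have x': "bary (verts T) (apex T S) x = 0" "\<And>y. y \<in> verts S \<Longrightarrow> 0 \<le> bary (verts T) y x"
    using x unfolding mem_side_iff[OF T] by blast+
  have bq: "bary (verts T) y (q e) = (1 - e) * bary (verts T) y x + e * bary (verts T) y ?m" for y e
  proof -
    have "bary (verts T) y (q e) = bary (verts T) y x + e * (bary (verts T) y ?m - bary (verts T) y x)"
      by (simp add: q_def bary_add bary_diff)
    then show ?thesis by (simp add: algebra_simps)
  qed
  have "\<forall>\<^sub>F e in at_right (0::real). q e \<in> frontier \<Omega>"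
  proof -
    have "\<forall>\<^sub>F e in at_right (0::real). e \<in> {0<..<1}"
      by (rule eventually_at_right_real) simp
    then show ?thesis
    proof (rule eventually_mono)
      fix e :: real assume e: "e \<in> {0<..<1}"
      have "bary (verts T) (apex T S) (q e) = 0" by (simp add: bq x' cen_side[OF T])
      moreover have "0 < bary (verts T) y (q e)" if "y \<in> verts S" for y
        using e x'(2)[OF that] cen_side(2)[OF T that] by (simp add: bq add_nonneg_pos)
      ultimately show "q e \<in> frontier \<Omega>"
        using unshared_side_nbhd[OF T un, of "q e"] by metis
    qed
  qed
  moreover have "(q \<longlongrightarrow> x + 0 *\<^sub>R (?m - x)) (at_right 0)"
    unfolding q_def by (intro tendsto_intros)
  ultimately have "x + 0 *\<^sub>R (?m - x) \<in> frontier \<Omega>"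
    by (intro Lim_in_closed_set[OF frontier_closed]) auto
  then show "x \<in> frontier \<Omega>" by simp
qed

section \<open>Boundary sides and the two parts of the boundary\<close>

lemma boundary_side_unshared:
  "T \<in> \<T> \<Longrightarrow> T' \<in> \<T> \<Longrightarrow> S facet_of T \<Longrightarrow> S facet_of T' \<Longrightarrow> S \<subseteq> frontier \<Omega> \<Longrightarrow> T' = T"
  using shared_side_not_boundary by metis

lemma boundary_side_cases:
  assumes "T \<in> \<T>" "S facet_of T" "S \<subseteq> frontier \<Omega>"
  shows "S \<subseteq> closure \<Gamma>D \<or> S \<subseteq> closure \<Gamma>N"
  using mesh assms by (auto simp: mesh_of_def)

lemma closure_parts: "closure \<Gamma>D \<subseteq> frontier \<Omega>" "closure \<Gamma>N \<subseteq> frontier \<Omega>"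
  "\<Gamma>D \<subseteq> frontier \<Omega>" "\<Gamma>N \<subseteq> frontier \<Omega>"
  using parts closure_subset unfolding boundary_parts_def by blast+

lemma parts_disjoint: "closure \<Gamma>D \<inter> \<Gamma>N = {}" "\<Gamma>D \<inter> closure \<Gamma>N = {}"
proof -
  obtain A B where "open A" "\<Gamma>D = frontier \<Omega> \<inter> A" "open B" "\<Gamma>N = frontier \<Omega> \<inter> B" "\<Gamma>D \<inter> \<Gamma>N = {}"
    using parts unfolding boundary_parts_def openin_open by blast
  moreover have "A \<inter> \<Gamma>N = {} \<Longrightarrow> A \<inter> closure \<Gamma>N = {}" "B \<inter> \<Gamma>D = {} \<Longrightarrow> B \<inter> closure \<Gamma>D = {}"
    using open_Int_closure_eq_empty \<open>open A\<close> \<open>open B\<close> by blast+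
  ultimately show "closure \<Gamma>D \<inter> \<Gamma>N = {}" "\<Gamma>D \<inter> closure \<Gamma>N = {}" by blast+
qed

text \<open>Sides are assigned to the closures, while the Neumann condition is imposed on
  \<open>\<Gamma>N\<close> itself. Near the barycentre of \<open>S\<close> the boundary consists of
  \<open>S\<close> alone, so the points of \<open>\<Gamma>N\<close> that approach it lie on
  \<open>S\<close>.\<close>

lemma Neumann_side_meets:
  assumes T: "T \<in> \<T>" "S facet_of T" and S: "S \<subseteq> closure \<Gamma>N"
  shows "S \<inter> \<Gamma>N \<noteq> {}"
proof -
  have un: "T' = T" if "T' \<in> \<T>" "S facet_of T'" for T'
    using boundary_side_unshared[OF T(1) that(1) T(2) that(2)] S closure_parts by blast
  have b: "bary (verts T) (apex T S) (cen (verts S)) = 0" by (rule cen_side(1)[OF T])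
  have b': "0 < bary (verts T) y (cen (verts S))" if "y \<in> verts S" for y
    using cen_side(2)[OF T that] by simp
  obtain U where U: "open U" "cen (verts S) \<in> U" "U \<inter> frontier \<Omega> \<subseteq> S"
    using unshared_side_nbhd[OF T un b b'] by metis
  have "cen (verts S) \<in> closure \<Gamma>N" using S cen_side(3)[OF T] by blast
  then have "U \<inter> \<Gamma>N \<noteq> {}" using U open_Int_closure_eq_empty by blast
  then show ?thesis using U(3) closure_parts(4) by blast
qed

lemma not_Dirichlet_and_Neumann:
  "T \<in> \<T> \<Longrightarrow> S facet_of T \<Longrightarrow> S \<subseteq> closure \<Gamma>N \<Longrightarrow> \<not> S \<subseteq> closure \<Gamma>D"
  using Neumann_side_meets parts_disjoint by blast

end

section \<open>Faces of codimension two and connectedness of the mesh\<close>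

context full_simplex
begin

lemma convex_hull_codim2:
  assumes "y \<in> V" "z \<in> V" "y \<noteq> z"
  shows "p \<in> convex hull V \<Longrightarrow> bary V y p = 0 \<Longrightarrow> bary V z p = 0 \<Longrightarrow> p \<in> convex hull (V - {y, z})"
    and "aff_dim (convex hull (V - {y, z})) \<le> int CARD('n) - 2"
proof -
  have fin: "finite (V - {y, z})" using finite_V by blast
  have card: "card (V - {y, z}) = CARD('n) - 1"
    using assms finite_V by (simp add: card_Diff_subset card_V)
  have s: "sum h V = h y + (h z + sum h (V - {y, z}))" for h :: "real^'n \<Rightarrow> 'z::comm_monoid_add"
  proof -
    have "sum h V = h y + sum h (V - {y})" using sum.remove[OF finite_V assms(1)] .
    also have "sum h (V - {y}) = h z + sum h (V - {y} - {z})"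
      using assms finite_V by (intro sum.remove) auto
    also have "V - {y} - {z} = V - {y, z}" by blast
    finally show ?thesis .
  qed
  show "p \<in> convex hull (V - {y, z})" if "p \<in> convex hull V" "bary V y p = 0" "bary V z p = 0"
  proof -
    have "\<forall>x\<in>V - {y, z}. 0 \<le> bary V x p" using that(1) unfolding convex_hull_V by blast
    moreover have "(\<Sum>x\<in>V - {y, z}. bary V x p) = 1" "(\<Sum>x\<in>V - {y, z}. bary V x p *\<^sub>R x) = p"
      using sum_bary[of p] sum_bary_scale[of p] that unfolding s by simp_all
    ultimately show ?thesis unfolding convex_hull_finite[OF fin] by auto
  qed
  have "\<not> affine_dependent (V - {y, z})"
    using affine_independent_subset[OF indep] by blast
  then have "aff_dim (V - {y, z}) = int (card (V - {y, z})) - 1"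
    using aff_dim_affine_independent[of "V - {y, z}"] by linarith
  then show "aff_dim (convex hull (V - {y, z})) \<le> int CARD('n) - 2"
    unfolding card aff_dim_convex_hull by (simp add: of_nat_diff Suc_leI)
qed

end

context mesh
begin

text \<open>The faces of dimension \<open>d - 2\<close>, one for each pair of omitted vertices.
  Without them, an element consists of its interior and the relative interiors of its sides.\<close>

definition codim2 :: "(real^'n) set set" where
  "codim2 = (\<Union>T\<in>\<T>. \<Union>y\<in>verts T. \<Union>z\<in>verts T - {y}. {convex hull (verts T - {y, z})})"

lemma codim2:
  shows "finite codim2" and "E \<in> codim2 \<Longrightarrow> closed E" and "E \<in> codim2 \<Longrightarrow> aff_dim E \<le> int CARD('n) - 2"
proof -
  have fin: "finite (verts T)" if "T \<in> \<T>" for T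
    using full_simplex.finite_V[OF full_simplex_elt[OF that]] .
  then show "finite codim2" unfolding codim2_def using finite_mesh by (intro finite_UN_I) auto
  assume "E \<in> codim2"
  then obtain T y z where T: "T \<in> \<T>" "y \<in> verts T" "z \<in> verts T" "y \<noteq> z" "E = convex hull (verts T - {y, z})"
    unfolding codim2_def by blast
  show "closed E" unfolding T(5) using fin[OF T(1)]
    by (intro compact_imp_closed finite_imp_compact_convex_hull) simp
  show "aff_dim E \<le> int CARD('n) - 2"
    unfolding T(5) by (rule full_simplex.convex_hull_codim2(2)[OF full_simplex_elt[OF T(1)] T(2-4)])
qed

lemma negligible_codim2: "negligible (\<Union>codim2)"
proof (rule negligible_Union[OF codim2(1)])
  fix E assume "E \<in> codim2"
  then have "aff_dim E < DIM(real^'n)" using codim2(3) by fastforce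
  then show "negligible E" by (rule negligible_affine_lowdim)
qed

text \<open>Two vanishing coordinates would put the point on a face in \<open>codim2\<close>, so at
  most one coordinate vanishes.\<close>

lemma elt_cases:
  assumes T: "T \<in> \<T>" "p \<in> T" "p \<notin> \<Union>codim2"
  obtains "p \<in> interior T"
  | S where "S facet_of T" "bary (verts T) (apex T S) p = 0" "\<And>y. y \<in> verts S \<Longrightarrow> 0 < bary (verts T) y p"
proof (cases "p \<in> interior T")
  case False
  have ge: "0 \<le> bary (verts T) y p" if "y \<in> verts T" for y
    using T(2) that elt_eq[OF T(1)] by blast
  obtain z where z: "z \<in> verts T" "bary (verts T) z p = 0"
    using False ge unfolding interior_elt[OF T(1)] by force
  define S where "S = convex hull (verts T - {z})"
  have S: "S facet_of T" unfolding facet_elt_iff[OF T(1)] S_def using z(1) by blast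
  have "0 < bary (verts T) y p" if y: "y \<in> verts T - {z}" for y
  proof (rule ccontr)
    assume "\<not> 0 < bary (verts T) y p"
    then have "bary (verts T) y p = 0" using ge[of y] y by force
    moreover have "p \<in> convex hull (verts T)" using T hull_verts by simp
    ultimately have "p \<in> convex hull (verts T - {y, z})"
      using full_simplex.convex_hull_codim2(1)[OF full_simplex_elt[OF T(1)], of y z p] y z by blast
    then show False using T(1,3) y z(1) unfolding codim2_def by blast
  qed
  moreover have "apex T S = z" unfolding S_def by (rule apex_side[OF T(1) z(1)])
  ultimately show thesis
    using that(2)[OF S] z(2) apex(3)[OF T(1) S] by simp
qed (rule that)

lemma open_minus_codim2_nonempty: "open U \<Longrightarrow> U \<noteq> {} \<Longrightarrow> U - \<Union>codim2 \<noteq> {}"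
  using open_not_negligible[of U] negligible_subset[OF negligible_codim2, of U] by blast

text \<open>Induction over the mesh across shared sides. Off \<open>codim2\<close>, distinct
  elements meet inside \<open>\<Omega>\<close> only in relative interiors of common sides, so the
  closed unions of \<open>\<A>\<close> and of its complement are disjoint there, and they cannot
  split the connected rest of \<open>\<Omega>\<close>.\<close>

lemma facet_connected:
  assumes "\<A> \<subseteq> \<T>" "\<A> \<noteq> {}"
    and step: "\<And>T T' S. T \<in> \<A> \<Longrightarrow> T' \<in> \<T> \<Longrightarrow> T \<noteq> T' \<Longrightarrow> S facet_of T \<Longrightarrow> S facet_of T' \<Longrightarrow> T' \<in> \<A>"
  shows "\<A> = \<T>"
proof (rule ccontr)
  assume "\<A> \<noteq> \<T>"
  let ?X = "\<Omega> - \<Union>codim2"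
  have con: "connected ?X"
    by (rule connected_open_minus_codim2[OF open_domain connected_domain codim2(1)]) (use codim2 in auto)
  have cl: "closed (\<Union>\<B>)" if "\<B> \<subseteq> \<T>" for \<B>
    using finite_subset[OF that finite_mesh]
    by (rule closed_Union) (use that compact_elt compact_imp_closed in blast)
  have ne: "\<Union>\<B> \<inter> ?X \<noteq> {}" if \<B>: "\<B> \<subseteq> \<T>" "\<B> \<noteq> {}" for \<B>
  proof -
    obtain T where T: "T \<in> \<B>" using \<B> by blast
    then have "interior T - \<Union>codim2 \<noteq> {}"
      using \<B>(1) by (intro open_minus_codim2_nonempty interior_elt_nonempty) auto
    moreover have "interior T \<subseteq> \<Omega>" "interior T \<subseteq> T"
      using interior_elt_subset \<B>(1) T interior_subset by blast+
    ultimately show ?thesis using T by blast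
  qed
  have "\<Union>\<A> \<inter> \<Union>(\<T> - \<A>) \<inter> ?X = {}"
  proof (rule ccontr)
    assume "\<Union>\<A> \<inter> \<Union>(\<T> - \<A>) \<inter> ?X \<noteq> {}"
    then obtain p T T' where p: "T \<in> \<A>" "p \<in> T" "T' \<in> \<T>" "T' \<notin> \<A>" "p \<in> T'" "p \<in> \<Omega>" "p \<notin> \<Union>codim2" by blast
    have T: "T \<in> \<T>" "T \<noteq> T'" using p assms(1) by blast+
    from T(1) p(2,7) show False
    proof (cases rule: elt_cases)
      case 1
      then show False using interior_Int_elt[OF T(1) p(3) T(2)] p(5) by blast
    next
      case (2 S)
      have "S facet_of T'"
        using side_interior_facet[OF T(1) 2 p(3) T(2)[symmetric] p(5)] .
      then show False using step[OF p(1,3) T(2) 2(1)] p(4) by blast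
    qed
  qed
  moreover have "?X \<subseteq> \<Union>\<A> \<union> \<Union>(\<T> - \<A>)"
    using Union_mesh closure_subset[of \<Omega>] by blast
  moreover have "\<Union>\<A> \<inter> ?X \<noteq> {}" "\<Union>(\<T> - \<A>) \<inter> ?X \<noteq> {}"
    using ne[of \<A>] ne[of "\<T> - \<A>"] assms(1,2) \<open>\<A> \<noteq> \<T>\<close> by blast+
  ultimately show False
    using con cl[OF assms(1)] cl[of "\<T> - \<A>"] unfolding connected_closed by blast
qed

text \<open>Otherwise some ball around \<open>z\<close> misses all boundary sides. Off
  \<open>codim2\<close>, each of its points lies in \<open>\<Omega>\<close> or outside the closure.
  Being connected and meeting \<open>\<Omega>\<close>, it has none of the latter kind, so
  \<open>z\<close> is interior to the closure and thus lies in \<open>\<Omega>\<close>.\<close>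

lemma frontier_cover:
  assumes "z \<in> frontier \<Omega>"
  obtains T S where "T \<in> \<T>" "S facet_of T" "S \<subseteq> frontier \<Omega>" "z \<in> S"
proof (rule ccontr)
  assume not: "\<not> thesis"
  define F where "F = \<Union>{S. S \<subseteq> frontier \<Omega> \<and> (\<exists>T\<in>\<T>. S facet_of T)}"
  have "closed F"
    unfolding F_def
  proof (intro closed_Union ballI)
    have "{S. S \<subseteq> frontier \<Omega> \<and> (\<exists>T\<in>\<T>. S facet_of T)}
        \<subseteq> (\<Union>T\<in>\<T>. (\<lambda>z. convex hull (verts T - {z})) ` verts T)"
      by (auto simp: facet_elt_iff)
    then show "finite {S. S \<subseteq> frontier \<Omega> \<and> (\<exists>T\<in>\<T>. S facet_of T)}"
      by (rule finite_subset) (use finite_mesh full_simplex.finite_V[OF full_simplex_elt] in auto)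
    fix S assume "S \<in> {S. S \<subseteq> frontier \<Omega> \<and> (\<exists>T\<in>\<T>. S facet_of T)}"
    then show "closed S"
      using facet_of_imp_face_of face_of_imp_compact[OF convex_elt compact_elt] compact_imp_closed by blast
  qed
  moreover have "z \<notin> F" using not that unfolding F_def by blast
  ultimately obtain e where e: "e > 0" "ball z e \<subseteq> - F"
    using open_contains_ball[of "- F"] by blast
  let ?X = "ball z e - \<Union>codim2"
  have con: "connected ?X"
    by (rule connected_open_minus_codim2[OF open_ball connected_ball codim2(1)]) (use codim2 in auto)
  have sub: "?X \<subseteq> \<Omega> \<union> - closure \<Omega>"
  proof
    fix p assume p: "p \<in> ?X"
    show "p \<in> \<Omega> \<union> - closure \<Omega>"
    proof (cases "p \<in> closure \<Omega>")
      case True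
      then obtain T where T: "T \<in> \<T>" "p \<in> T" using Union_mesh by blast
      have "p \<notin> \<Union>codim2" using p by blast
      with T have "p \<in> \<Omega>"
      proof (cases rule: elt_cases)
        case 1
        then show ?thesis using interior_elt_subset T by blast
      next
        case (2 S)
        have "p \<in> S" unfolding mem_side_iff[OF T(1) 2(1)] using 2 by (blast intro: less_imp_le)
        moreover have "p \<notin> F" using p e(2) by blast
        ultimately have "\<not> S \<subseteq> frontier \<Omega>" using T(1) 2(1) unfolding F_def by blast
        then obtain T' where "T' \<in> \<T>" "S facet_of T'" "T' \<noteq> T"
          using unshared_side_boundary[OF T(1) 2(1)] by blast
        then show ?thesis using shared_side_interior[OF T(1) _ _ 2(1) _ 2(2,3)] by blast
      qed
      then show ?thesis by blast
    qed blast
  qed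
  have "\<Omega> \<inter> ball z e \<noteq> {}"
  proof -
    have "z \<in> ball z e" "z \<in> closure \<Omega>" using assms e(1) by (simp_all add: frontier_def)
    then show ?thesis using open_Int_closure_eq_empty[of "ball z e" \<Omega>] by blast
  qed
  then have "\<Omega> \<inter> ?X \<noteq> {}"
    using open_minus_codim2_nonempty[of "\<Omega> \<inter> ball z e"] open_domain by blast
  moreover have "\<Omega> \<inter> - closure \<Omega> \<inter> ?X = {}" using closure_subset[of \<Omega>] by blast
  ultimately have "- closure \<Omega> \<inter> ?X = {}"
    using connectedD[OF con open_domain, of "- closure \<Omega>"] sub by blast
  then have "ball z e - closure \<Omega> \<subseteq> \<Union>codim2" by blast
  \<comment> \<open>The difference is open and contained in a null set, hence empty.\<close>
  then have "ball z e \<subseteq> closure \<Omega>"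
    using open_minus_codim2_nonempty[of "ball z e - closure \<Omega>"] by (auto simp: open_Diff)
  then have "z \<in> interior (closure \<Omega>)" using e(1) by (auto simp: mem_interior)
  then show False
    using assms open_domain by (simp add: interior_closure_domain frontier_def interior_open)
qed

text \<open>Starting from a point of \<open>\<Gamma>D\<close> itself, not merely of its closure,
  excludes that the covering side lies in the closure of \<open>\<Gamma>N\<close>.\<close>

lemma Dirichlet_side_exists: obtains T S where "T \<in> \<T>" "S facet_of T" "S \<subseteq> closure \<Gamma>D"
proof -
  obtain z where z: "z \<in> \<Gamma>D" using parts unfolding boundary_parts_def by blast
  then have "z \<in> frontier \<Omega>" using closure_parts(3) by blast
  then obtain T S where TS: "T \<in> \<T>" "S facet_of T" "S \<subseteq> frontier \<Omega>" "z \<in> S"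
    by (rule frontier_cover)
  then show thesis using boundary_side_cases[OF TS(1-3)] parts_disjoint(2) z that by blast
qed

lemma Neumann_side_exists:
  assumes "\<Gamma>N \<noteq> {}"
  obtains T S where "T \<in> \<T>" "S facet_of T" "S \<subseteq> closure \<Gamma>N"
proof -
  obtain z where z: "z \<in> \<Gamma>N" using assms by blast
  then have "z \<in> frontier \<Omega>" using closure_parts(4) by blast
  then obtain T S where TS: "T \<in> \<T>" "S facet_of T" "S \<subseteq> frontier \<Omega>" "z \<in> S"
    by (rule frontier_cover)
  then show thesis using boundary_side_cases[OF TS(1-3)] parts_disjoint(1) z that by blast
qed

end

section \<open>Calculus of piecewise affine functions\<close>

lemma multi_indices_0: "{\<alpha> :: 'n::finite \<Rightarrow> nat. (\<Sum>i\<in>UNIV. \<alpha> i) \<le> 0} = {\<lambda>_. 0}"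
  by auto

lemma multi_indices_1:
  "{\<alpha> :: 'n::finite \<Rightarrow> nat. (\<Sum>i\<in>UNIV. \<alpha> i) \<le> 1} = insert (\<lambda>_. 0) (range (\<lambda>i j. if j = i then 1 else 0))"
proof (intro equalityI subsetI)
  fix \<alpha> :: "'n \<Rightarrow> nat" assume "\<alpha> \<in> {\<alpha>. (\<Sum>i\<in>UNIV. \<alpha> i) \<le> 1}"
  then have le: "(\<Sum>i\<in>UNIV. \<alpha> i) \<le> 1" by simp
  show "\<alpha> \<in> insert (\<lambda>_. 0) (range (\<lambda>i j. if j = i then 1 else 0))"
  proof (cases "\<exists>i. \<alpha> i \<noteq> 0")
    case True
    then obtain i where i: "\<alpha> i \<noteq> 0" by blast
    have "(\<Sum>j\<in>UNIV. \<alpha> j) = \<alpha> i + (\<Sum>j\<in>UNIV - {i}. \<alpha> j)"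
      by (simp add: sum.remove[of UNIV i])
    with le i have "\<alpha> i = 1" "(\<Sum>j\<in>UNIV - {i}. \<alpha> j) = 0" by linarith+
    then have "\<alpha> = (\<lambda>j. if j = i then 1 else 0)" by (auto simp: fun_eq_iff)
    then show ?thesis by blast
  qed auto
qed auto

lemma Pk_0_iff: "v \<in> Pk 0 \<T> \<longleftrightarrow> (\<forall>T\<in>\<T>. \<exists>b. \<forall>x\<in>interior T. v x = b)"
  unfolding Pk_def multi_indices_0 mem_Collect_eq
proof (intro ball_cong refl iffI)
  fix T assume "\<exists>b. \<forall>x\<in>interior T. v x = b"
  then obtain b where "\<forall>x\<in>interior T. v x = b" by blast
  then show "\<exists>c. \<forall>x\<in>interior T. v x = (\<Sum>\<alpha>\<in>{\<lambda>_. 0}. (\<Prod>i\<in>UNIV. x $ i ^ \<alpha> i) *\<^sub>R c \<alpha>)"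
    by (intro exI[of _ "\<lambda>_. b"]) simp
qed auto

lemma Pk_1_iff:
  fixes v :: "real^'n \<Rightarrow> 'b::euclidean_space"
  shows "v \<in> Pk 1 \<T> \<longleftrightarrow> (\<forall>T\<in>\<T>. \<exists>L b. linear L \<and> (\<forall>x\<in>interior T. v x = L x + b))"
proof -
  let ?e = "\<lambda>(i::'n) j. if j = i then 1 else 0 :: nat"
  have inj: "inj ?e" by (rule injI) (metis zero_neq_one)
  have nz: "(\<lambda>_. 0) \<notin> range ?e" by (auto simp: fun_eq_iff split: if_splits)
  have sum: "(\<Sum>\<alpha> | (\<Sum>i\<in>UNIV. \<alpha> i) \<le> 1. (\<Prod>i\<in>UNIV. x $ i ^ \<alpha> i) *\<^sub>R c \<alpha>)
      = c (\<lambda>_. 0) + (\<Sum>i\<in>UNIV. x $ i *\<^sub>R c (?e i))"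
    for x :: "real^'n" and c :: "('n \<Rightarrow> nat) \<Rightarrow> 'b"
  proof -
    have "(\<Prod>j\<in>UNIV. x $ j ^ ?e i j) = x $ i" for i
      by (simp add: if_distrib[of "\<lambda>k. _ ^ k"] cong: if_cong)
    then show ?thesis
      unfolding multi_indices_1 using nz by (simp add: sum.reindex[OF inj])
  qed
  show ?thesis
    unfolding Pk_def mem_Collect_eq sum
  proof (intro ball_cong refl iffI)
    fix T assume "\<exists>c. \<forall>x\<in>interior T. v x = c (\<lambda>_. 0) + (\<Sum>i\<in>UNIV. x $ i *\<^sub>R c (?e i))"
    then obtain c where c: "\<forall>x\<in>interior T. v x = c (\<lambda>_. 0) + (\<Sum>i\<in>UNIV. x $ i *\<^sub>R c (?e i))"
      by (elim exE) (rule that)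
    define L where "L = (\<lambda>x :: real^'n. \<Sum>i\<in>UNIV. x $ i *\<^sub>R c (?e i))"
    have "linear L"
      unfolding L_def by (intro linearI) (simp_all add: scaleR_add_left sum.distrib scaleR_sum_right)
    moreover have "\<forall>x\<in>interior T. v x = L x + c (\<lambda>_. 0)"
      using c unfolding L_def by (subst add.commute)
    ultimately show "\<exists>L b. linear L \<and> (\<forall>x\<in>interior T. v x = L x + b)"
      by (intro exI[of _ L] exI[of _ "c (\<lambda>_. 0)"] conjI)
  next
    fix T assume "\<exists>L b. linear L \<and> (\<forall>x\<in>interior T. v x = L x + b)"
    then obtain L b where L: "linear L" "\<forall>x\<in>interior T. v x = L x + b"
      by (elim exE conjE) (rule that)
    \<comment> \<open>Weighting by \<open>\<alpha> k\<close> yields \<open>L (axis i 1)\<close> at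
      the \<open>i\<close>-th unit multi-index without having to recover \<open>i\<close> from
      it.\<close>
    define c where "c = (\<lambda>\<alpha>. if \<alpha> = (\<lambda>_. 0) then b else \<Sum>k\<in>UNIV. real (\<alpha> k) *\<^sub>R L (axis k 1))"
    have "c (?e i) = L (axis i 1)" for i
    proof -
      have "?e i \<noteq> (\<lambda>_. 0)"
      proof
        assume "?e i = (\<lambda>_. 0)"
        from fun_cong[OF this, of i] show False by simp
      qed
      then have "c (?e i) = (\<Sum>k\<in>UNIV. real (?e i k) *\<^sub>R L (axis k 1))" by (simp add: c_def)
      also have "\<dots> = (\<Sum>k\<in>UNIV. if k = i then L (axis k 1) else 0)"
        by (intro sum.cong) auto
      finally show ?thesis by simp
    qed
    moreover have "(\<Sum>i\<in>UNIV. x $ i *\<^sub>R L (axis i 1)) = L x" for x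
    proof -
      have "(\<Sum>i\<in>UNIV. x $ i *\<^sub>R L (axis i 1)) = L (\<Sum>i\<in>UNIV. x $ i *\<^sub>R axis i 1)"
        by (simp add: linear_sum[OF L(1)] linear_cmul[OF L(1)])
      also have "(\<Sum>i\<in>UNIV. x $ i *\<^sub>R axis i 1) = x"
        using basis_expansion[of x] by (simp only: scalar_mult_eq_scaleR)
      finally show ?thesis .
    qed
    moreover have "c (\<lambda>_. 0) = b" by (simp add: c_def)
    ultimately have "v x = c (\<lambda>_. 0) + (\<Sum>i\<in>UNIV. x $ i *\<^sub>R c (?e i))" if "x \<in> interior T" for x
      using L(2) that by simp
    then show "\<exists>c. \<forall>x\<in>interior T. v x = c (\<lambda>_. 0) + (\<Sum>i\<in>UNIV. x $ i *\<^sub>R c (?e i))"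
      by (intro exI[of _ c] ballI)
  qed
qed

lemma jacobian_affine:
  fixes v :: "real^'n \<Rightarrow> real^'m"
  assumes "\<And>x. x \<in> interior T \<Longrightarrow> v x = b + A *v (x - m)" "x \<in> interior T"
  shows "jacobian v (at x) = A"
proof -
  have "((\<lambda>x. b + A *v (x - m)) has_derivative (\<lambda>h. A *v h)) (at x)"
    by (auto intro!: derivative_eq_intros bounded_linear.has_derivative[OF matrix_vector_mul_bounded_linear])
  then have "(v has_derivative (\<lambda>h. A *v h)) (at x)"
    using assms by (elim has_derivative_transform_within_open[of _ _ _ _ "interior T"]) auto
  then have "frechet_derivative v (at x) = (\<lambda>h. A *v h)"
    by (rule frechet_derivative_at[symmetric])
  then show ?thesis by (simp add: jacobian_def)
qed

section \<open>Null sets, means and integrals over the mesh\<close>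

context mesh
begin

lemma negligible_frontier_elt: "T \<in> \<T> \<Longrightarrow> negligible (frontier T)"
  using convex_elt by (rule negligible_convex_frontier)

lemma AE_iff_interiors:
  "(AE x in lebesgue_on \<Omega>. P x) \<longleftrightarrow> (\<forall>T\<in>\<T>. negligible {x \<in> interior T. \<not> P x})"
proof -
  have meas: "\<Omega> \<in> sets lebesgue" using open_domain by simp
  have "(AE x in lebesgue_on \<Omega>. P x) \<longleftrightarrow> negligible {x \<in> \<Omega>. \<not> P x}"
    using meas by (simp add: AE_restrict_space_iff eventually_ae_filter_negligible)
      (metis (no_types, lifting) negligible_subset order_refl)
  also have "\<dots> \<longleftrightarrow> (\<forall>T\<in>\<T>. negligible {x \<in> interior T. \<not> P x})"
  proof
    assume "negligible {x \<in> \<Omega>. \<not> P x}"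
    then show "\<forall>T\<in>\<T>. negligible {x \<in> interior T. \<not> P x}"
      using interior_elt_subset by (blast intro: negligible_subset)
  next
    assume R: "\<forall>T\<in>\<T>. negligible {x \<in> interior T. \<not> P x}"
    have "negligible (\<Union>T\<in>\<T>. {x \<in> interior T. \<not> P x} \<union> frontier T)"
      using R finite_mesh negligible_frontier_elt by (intro negligible_Union finite_imageI) auto
    moreover have "{x \<in> \<Omega>. \<not> P x} \<subseteq> (\<Union>T\<in>\<T>. {x \<in> interior T. \<not> P x} \<union> frontier T)"
    proof
      fix x assume x: "x \<in> {x \<in> \<Omega>. \<not> P x}"
      then obtain T where T: "T \<in> \<T>" "x \<in> T" using Union_mesh closure_subset[of \<Omega>] by blast
      then have "x \<in> interior T \<or> x \<in> frontier T" using closure_subset[of T] by (auto simp: frontier_def)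
      with T(1) x show "x \<in> (\<Union>T\<in>\<T>. {x \<in> interior T. \<not> P x} \<union> frontier T)" by blast
    qed
    ultimately show "negligible {x \<in> \<Omega>. \<not> P x}" by (rule negligible_subset)
  qed
  finally show ?thesis .
qed

lemma AE_interiorsI:
  assumes "\<And>T x. T \<in> \<T> \<Longrightarrow> x \<in> interior T \<Longrightarrow> P x"
  shows "AE x in lebesgue_on \<Omega>. P x"
proof -
  have "{x \<in> interior T. \<not> P x} = {}" if "T \<in> \<T>" for T using assms that by blast
  then show ?thesis unfolding AE_iff_interiors by (metis negligible_empty)
qed

text \<open>A nonempty open set is not null, so a condition that does not vary over the interior of
  \<open>T\<close> cannot fail there. This turns identities almost everywhere into identities of
  coefficients.\<close>

lemma AE_constD:
  assumes "AE x in lebesgue_on \<Omega>. P x" "T \<in> \<T>" "\<And>x. x \<in> interior T \<Longrightarrow> P x \<longleftrightarrow> c"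
  shows c
proof (rule ccontr)
  assume "\<not> c"
  then have "{x \<in> interior T. \<not> P x} = interior T" using assms(3) by blast
  then show False
    using assms(1,2) interior_elt_nonempty[OF assms(2)] open_not_negligible[OF open_interior, of T]
    unfolding AE_iff_interiors by force
qed

definition vol :: "(real^'n) set \<Rightarrow> real" where "vol T = measure lebesgue T"

definition ctr :: "(real^'n) set \<Rightarrow> real^'n" where "ctr T = cen (verts T)"

lemma vol_pos: "T \<in> \<T> \<Longrightarrow> 0 < vol T"
  using full_simplex.measure_pos[OF full_simplex_elt] by (simp add: vol_def hull_verts)

lemma mean_elt_affine:
  fixes L :: "real^'n \<Rightarrow> 'b::euclidean_space"
  assumes "T \<in> \<T>" "linear L" "\<And>x. x \<in> interior T \<Longrightarrow> w x = b + L (x - ctr T)"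
  shows "mean T w = b"
  using full_simplex.mean_affine[OF full_simplex_elt[OF assms(1)] assms(2), of w "b - L (ctr T)"] assms
  by (simp add: hull_verts linear_diff ctr_def algebra_simps)

lemma \<Pi>h_affine:
  fixes L :: "real^'n \<Rightarrow> 'b::euclidean_space"
  assumes "T \<in> \<T>" "linear L" "\<And>x. x \<in> interior T \<Longrightarrow> w x = b + L (x - ctr T)" "x \<in> interior T"
  shows "\<Pi>h \<T> w x = b"
proof -
  have "\<Pi>h \<T> w x = (\<Sum>T'\<in>\<T>. if T' = T then mean T w else 0)"
    unfolding \<Pi>h_def
    using interiors_disjoint[OF _ assms(1)] assms(4) by (intro sum.cong refl) (auto simp: indicator_def)
  then show ?thesis
    using finite_mesh assms(1) mean_elt_affine[OF assms(1-3)] by simp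
qed

text \<open>The mean of an affine function is its value at the barycentre, so the centred linear
  part \<open>l T\<close> drops out.\<close>

lemma integral_piecewise_affine:
  fixes h :: "real^'n \<Rightarrow> real"
  assumes "\<And>T x. T \<in> \<T> \<Longrightarrow> x \<in> interior T \<Longrightarrow> h x = b T + l T \<bullet> (x - ctr T)"
  shows "integral \<Omega> h = (\<Sum>T\<in>\<T>. vol T * b T)"
proof -
  have int: "(h has_integral vol T * b T) T" if T: "T \<in> \<T>" for T
  proof -
    have neg: "negligible (frontier T)" using convex_elt[OF T] by (rule negligible_convex_frontier)
    have "(\<lambda>x. b T + l T \<bullet> (x - ctr T)) integrable_on T"
      by (intro integrable_continuous_compact compact_elt T continuous_intros)
    then have "h integrable_on T"
    proof (rule integrable_spike[OF _ neg])
      fix x assume "x \<in> T - frontier T"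
      then have "x \<in> interior T" using closure_subset[of T] by (auto simp: frontier_def)
      then show "h x = b T + l T \<bullet> (x - ctr T)" by (rule assms[OF T])
    qed
    moreover have "mean T h = b T"
      using mean_elt_affine[OF T, of "\<lambda>x. l T \<bullet> x" h "b T"] assms[OF T]
      by (simp add: bounded_linear.linear[OF bounded_linear_inner_right])
    ultimately show ?thesis
      using vol_pos[OF T] by (simp add: has_integral_iff mean_def vol_def field_simps)
  qed
  have "(h has_integral (\<Sum>T\<in>\<T>. vol T * b T)) (\<Union>\<T>)"
  proof (rule has_integral_Union[OF finite_mesh])
    show "pairwise (\<lambda>S S'. negligible (S \<inter> S')) \<T>"
    proof (rule pairwiseI)
      fix T T' assume *: "T \<in> \<T>" "T' \<in> \<T>" "T \<noteq> T'"
      then have "T \<inter> T' \<subseteq> frontier T"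
        using interior_Int_elt[OF *] closure_subset[of T] by (auto simp: frontier_def)
      then show "negligible (T \<inter> T')"
        using negligible_convex_frontier[OF convex_elt[OF *(1)]] negligible_subset by blast
    qed
  qed (use int in auto)
  moreover have "negligible (closure \<Omega> - \<Omega>)"
  proof (rule negligible_subset)
    show "negligible (\<Union>(frontier ` \<T>))"
      using finite_mesh negligible_frontier_elt by (intro negligible_Union finite_imageI) auto
    show "closure \<Omega> - \<Omega> \<subseteq> \<Union>(frontier ` \<T>)"
      using interior_elt_subset closure_subset unfolding Union_mesh[symmetric] frontier_def by blast
  qed
  ultimately have "(h has_integral (\<Sum>T\<in>\<T>. vol T * b T)) \<Omega>"
    unfolding Union_mesh using closure_subset[of \<Omega>]
    by (subst has_integral_spike_set_eq[of \<Omega> "closure \<Omega>"]) (auto intro: negligible_subset)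
  then show ?thesis by (rule integral_unique)
qed

text \<open>\<open>T\<close> is the closure of its interior, so each of its points is a limit point
  of the interior, and the limit is the value of the affine extension.\<close>

lemma restr_affine:
  fixes L :: "real^'n \<Rightarrow> 'b::euclidean_space"
  assumes "T \<in> \<T>" "linear L" "\<And>x. x \<in> interior T \<Longrightarrow> w x = b + L (x - m)" "x \<in> T"
  shows "restr T w x = b + L (x - m)"
  unfolding restr_def
proof (rule tendsto_Lim)
  have "T = closure (interior T)"
    using convex_closure_interior[OF convex_elt interior_elt_nonempty] assms(1) compact_elt compact_imp_closed
    by (metis closure_closed)
  then have "x \<in> closure (interior T)" using assms(4) by simp
  then have "x islimpt interior T"
    using interior_limit_point[of x "interior T"] by (auto simp: closure_def)
  then show "at x within interior T \<noteq> bot" by (simp add: trivial_limit_within)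
  have "continuous_on UNIV (\<lambda>y. b + L (y - m))"
    using assms(2) by (intro continuous_intros linear_continuous_on_compose[of _ "\<lambda>y. y - m" L])
  then have "((\<lambda>y. b + L (y - m)) \<longlongrightarrow> b + L (x - m)) (at x within interior T)"
    using continuous_on_eq_continuous_at[OF open_UNIV] continuous_at_imp_continuous_at_within continuous_within by blast
  then show "(w \<longlongrightarrow> b + L (x - m)) (at x within interior T)"
    by (rule Lim_transform_eventually) (auto simp: eventually_at_filter assms(3))
qed

end

section \<open>Element-wise integration by parts\<close>

lemma linear_outer: "linear (\<lambda>x. a \<otimes>\<^sub>v x)"
  by (intro linearI) (simp_all add: vec_eq_iff outer_def algebra_simps)

lemma linear_outer_left: "linear (\<lambda>x. x \<otimes>\<^sub>v a)"
  by (intro linearI) (simp_all add: vec_eq_iff outer_def algebra_simps)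

context full_simplex
begin

text \<open>The transpose of \<open>sum_bgrad_inner\<close>; it shows that the gradients span the
  space.\<close>

lemma sum_inner_bgrad: "(\<Sum>z\<in>V. (z \<bullet> x) *\<^sub>R bgrad V z) = x"
proof -
  have "(\<Sum>z\<in>V. (z \<bullet> x) *\<^sub>R bgrad V z) \<bullet> y = x \<bullet> y" for y
  proof -
    have "(\<Sum>z\<in>V. (z \<bullet> x) *\<^sub>R bgrad V z) \<bullet> y = x \<bullet> (\<Sum>z\<in>V. (bgrad V z \<bullet> y) *\<^sub>R z)"
      by (simp add: inner_sum_left inner_sum_right) (simp add: inner_commute mult.commute)
    then show ?thesis by (simp add: sum_bgrad_inner)
  qed
  then show ?thesis by (metis vector_eq_rdot)
qed

lemma matrix_eq_0_bgrad:
  fixes M :: "real^'n^'m"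
  assumes "\<And>z. z \<in> V \<Longrightarrow> M *v bgrad V z = 0"
  shows "M = 0"
proof -
  have "M *v x = 0" for x
  proof -
    have "M *v x = M *v (\<Sum>z\<in>V. (z \<bullet> x) *\<^sub>R bgrad V z)" by (simp only: sum_inner_bgrad)
    also have "\<dots> = (\<Sum>z\<in>V. (z \<bullet> x) *\<^sub>R (M *v bgrad V z))"
      by (simp add: linear_sum[OF matrix_vector_mul_linear] linear_cmul[OF matrix_vector_mul_linear])
    finally show ?thesis using assms by simp
  qed
  then show ?thesis by (simp add: matrix_eq)
qed

text \<open>The algebra behind the Raviart-Thomas form. As the normal component is constant along
  the side, \<open>L h *v bgrad V z\<close> depends on \<open>h\<close> only through
  \<open>bgrad V z \<bullet> h\<close>, which gives a vector \<open>m z\<close>. The gradients sum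
  to zero, so all \<open>m z\<close> are equal, and they span the space, so this vector determines
  \<open>L\<close>.\<close>

lemma constant_normal_structure:
  fixes L :: "real^'n \<Rightarrow> real^'n^'m"
  assumes L: "linear L"
    and const: "\<And>z y y'. z \<in> V \<Longrightarrow> y \<in> V - {z} \<Longrightarrow> y' \<in> V - {z} \<Longrightarrow>
      L y *v bgrad V z = L y' *v bgrad V z"
  shows "\<exists>m. \<forall>h. L h = (\<chi> i j. m $ i * h $ j)"
proof -
  have Lv: "linear (\<lambda>h. L h *v g)" for g
    using linear_add[OF L] linear_cmul[OF L]
    by (intro linearI) (simp_all add: matrix_vector_mult_add_rdistrib scaleR_matrix_vector_assoc)
  have "\<exists>m. \<forall>h. L h *v bgrad V z = (bgrad V z \<bullet> h) *\<^sub>R m" if z: "z \<in> V" for z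
  proof -
    obtain y0 where y0: "y0 \<in> V" "y0 \<noteq> z" by (rule exists_other_vertex)
    have "L h *v bgrad V z = (bgrad V z \<bullet> h) *\<^sub>R (L z *v bgrad V z - L y0 *v bgrad V z)" for h
    proof -
      have "L h *v bgrad V z = L (\<Sum>y\<in>V. (bgrad V y \<bullet> h) *\<^sub>R y) *v bgrad V z"
        by (simp only: sum_bgrad_inner)
      also have "\<dots> = (\<Sum>y\<in>V. (bgrad V y \<bullet> h) *\<^sub>R (L y *v bgrad V z))"
        by (simp only: linear_sum[OF Lv] linear_cmul[OF Lv])
      also have "\<dots> = (\<Sum>y\<in>V. (bgrad V y \<bullet> h) *\<^sub>R (L y0 *v bgrad V z)
          + (if y = z then (bgrad V y \<bullet> h) *\<^sub>R (L y *v bgrad V z - L y0 *v bgrad V z) else 0))"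
      proof (intro sum.cong refl)
        fix y assume y: "y \<in> V"
        show "(bgrad V y \<bullet> h) *\<^sub>R (L y *v bgrad V z) = (bgrad V y \<bullet> h) *\<^sub>R (L y0 *v bgrad V z)
          + (if y = z then (bgrad V y \<bullet> h) *\<^sub>R (L y *v bgrad V z - L y0 *v bgrad V z) else 0)"
        proof (cases "y = z")
          case False
          have "L y *v bgrad V z = L y0 *v bgrad V z"
            using False y y0 by (intro const z) auto
          then show ?thesis using False by simp
        qed (simp add: scaleR_diff_right)
      qed
      also have "\<dots> = (\<Sum>y\<in>V. bgrad V y \<bullet> h) *\<^sub>R (L y0 *v bgrad V z)
          + (bgrad V z \<bullet> h) *\<^sub>R (L z *v bgrad V z - L y0 *v bgrad V z)"
        using finite_V z by (simp add: sum.distrib scaleR_sum_left)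
      also have "(\<Sum>y\<in>V. bgrad V y \<bullet> h) = 0"
        by (simp add: inner_sum_left[symmetric] sum_bgrad)
      finally show ?thesis by simp
    qed
    then show ?thesis by blast
  qed
  then obtain m where m: "\<And>z h. z \<in> V \<Longrightarrow> L h *v bgrad V z = (bgrad V z \<bullet> h) *\<^sub>R m z" by metis
  have eq: "m y = m y'" if y: "y \<in> V" "y' \<in> V" for y y'
  proof -
    \<comment> \<open>Along \<open>y - y'\<close> only two coordinates vary: that of
      \<open>y\<close> by 1 and that of \<open>y'\<close> by -1.\<close>
    have "0 = L (y - y') *v (\<Sum>z\<in>V. bgrad V z)" by (simp add: sum_bgrad)
    also have "\<dots> = (\<Sum>z\<in>V. (bgrad V z \<bullet> (y - y')) *\<^sub>R m z)"
      by (simp add: linear_sum[OF matrix_vector_mul_linear] m)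
    also have "\<dots> = (\<Sum>z\<in>V. (if z = y then m z else 0) - (if z = y' then m z else 0))"
      using y by (intro sum.cong refl) (auto simp: bary_diff[symmetric] bary_vertex)
    also have "\<dots> = m y - m y'" using y finite_V by (simp add: sum_subtractf)
    finally show ?thesis by simp
  qed
  obtain z0 where z0: "z0 \<in> V" using exists_other_vertex by blast
  have "L h = (\<chi> i j. m z0 $ i * h $ j)" for h
  proof -
    have "(L h - (\<chi> i j. m z0 $ i * h $ j)) *v bgrad V z = 0" if "z \<in> V" for z
    proof -
      have "(\<chi> i j. m z0 $ i * h $ j) *v bgrad V z = (bgrad V z \<bullet> h) *\<^sub>R m z0"
        by (simp add: vec_eq_iff matrix_vector_mult_def inner_vec_def sum_distrib_left sum_distrib_right ac_simps)
      then show ?thesis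
        using m[OF that] eq[OF that z0] by (simp add: matrix_vector_mult_diff_rdistrib)
    qed
    from matrix_eq_0_bgrad[OF this] show ?thesis by simp
  qed
  then show ?thesis by blast
qed

text \<open>The divergence theorem on one simplex, divided by its volume:
  \<open>- d bgrad V z\<close> is the area-weighted outer normal over the volume and
  \<open>d a\<close> is the divergence of the field. The normal component is constant on each side,
  so the affine function enters through its value at the barycentre of the side.\<close>

lemma integration_by_parts:
  fixes A C :: "real^'n^'n" and a b :: "real^'n"
  shows "A \<bullet> C + CARD('n) * (a \<bullet> b)
    = (\<Sum>z\<in>V. (b + A *v (cen (V - {z}) - cen V)) \<bullet>
              ((C + a \<otimes>\<^sub>v (cen (V - {z}) - cen V)) *v (- real CARD('n) *\<^sub>R bgrad V z)))"
proof -
  let ?d = "real CARD('n)" and ?c = "cen V"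
  let ?m = "\<lambda>z. cen (V - {z})" and ?g = "bgrad V"
  have d: "?d > 0" by simp
  have sumV: "\<Sum>V = (?d + 1) *\<^sub>R ?c"
  proof -
    have "real (card V) = ?d + 1" by (simp add: card_V)
    then have "?c = \<Sum>V /\<^sub>R (?d + 1)" by (simp only: cen_def)
    moreover have "?d + 1 \<noteq> 0" using d by linarith
    ultimately show ?thesis by (metis scaleR_one scaleR_scaleR right_inverse)
  qed
  have mc: "?m z - ?c = (1 / ?d) *\<^sub>R (?c - z)" if z: "z \<in> V" for z
  proof -
    have "?d *\<^sub>R ?m z = \<Sum>(V - {z})" using card_side[OF z] d by (simp add: cen_def)
    also have "\<dots> = \<Sum>V - z" using sum.remove[OF finite_V z, of "\<lambda>x. x"] by simp
    finally have "?d *\<^sub>R (?m z - ?c) = ?c - z" by (simp add: sumV algebra_simps)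
    then show ?thesis using d by (metis divideR_right inverse_eq_divide less_irrefl)
  qed
  \<comment> \<open>The coordinate of \<open>z\<close> is \<open>1 / (d + 1)\<close> at the
    barycentre of the simplex and 0 on the side.\<close>
  have gm: "(?m z - ?c) \<bullet> ?g z = - (1 / (?d + 1))" if z: "z \<in> V" for z
  proof -
    have "(?m z - ?c) \<bullet> ?g z = bary V z (?m z) - bary V z ?c" by (simp add: bary_diff inner_commute)
    also have "bary V z (?m z) = 0" using bary_cen[OF _ side_nonempty[OF z] z] by simp
    also have "bary V z ?c = 1 / (?d + 1)" using bary_cen[of V z] z card_V by (auto simp: add.commute)
    finally show ?thesis by simp
  qed
  have AC: "(\<Sum>z\<in>V. (A *v z) \<bullet> (C *v ?g z)) = A \<bullet> C"
  proof -
    have "(\<Sum>z\<in>V. (A *v z) \<bullet> (C *v ?g z)) = (\<Sum>z\<in>V. \<Sum>i\<in>UNIV. (A $ i \<bullet> z) * (?g z \<bullet> C $ i))"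
      by (simp add: inner_vec_def[of "_ *v _"] matrix_vector_mul_component inner_commute)
    also have "\<dots> = (\<Sum>i\<in>UNIV. A $ i \<bullet> (\<Sum>z\<in>V. (?g z \<bullet> C $ i) *\<^sub>R z))"
      by (subst sum.swap) (simp add: inner_sum_right mult.commute)
    also have "\<dots> = A \<bullet> C" by (simp only: sum_bgrad_inner inner_vec_def[of A])
    finally show ?thesis .
  qed
  have Asum: "(\<Sum>z\<in>V. A *v (?c - z)) = 0"
  proof -
    have "(\<Sum>z\<in>V. A *v (?c - z)) = A *v (\<Sum>z\<in>V. ?c - z)"
      by (simp add: linear_sum[OF matrix_vector_mul_linear])
    also have "(\<Sum>z\<in>V. ?c - z) = real (card V) *\<^sub>R ?c - \<Sum>V"
      by (simp add: sum_subtractf sum_constant_scaleR del: sum_constant)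
    also have "\<dots> = 0" unfolding sumV card_V by simp
    finally show ?thesis by simp
  qed
  have Cg: "(\<Sum>z\<in>V. C *v ?g z) = 0"
    using linear_sum[OF matrix_vector_mul_linear, of C ?g V] by (simp add: sum_bgrad)
  \<comment> \<open>Arranged so that, after summation over the vertices, only the first and the last
    term survive.\<close>
  have summand: "(b + A *v (?m z - ?c)) \<bullet> ((C + a \<otimes>\<^sub>v (?m z - ?c)) *v (- ?d *\<^sub>R ?g z))
      = ?d / (?d + 1) * (b \<bullet> a) + (A *v (?c - z)) \<bullet> a / (?d + 1)
        - (?d *\<^sub>R b + A *v ?c) \<bullet> (C *v ?g z) + (A *v z) \<bullet> (C *v ?g z)" if z: "z \<in> V" for z
  proof -
    have 1: "(C + a \<otimes>\<^sub>v (?m z - ?c)) *v (- ?d *\<^sub>R ?g z) = (- ?d) *\<^sub>R (C *v ?g z - (1 / (?d + 1)) *\<^sub>R a)"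
      by (simp only: linear_cmul[OF matrix_vector_mul_linear] matrix_vector_mult_add_rdistrib outer_mul_vec gm[OF z])
        simp
    have 2: "b + A *v (?m z - ?c) = (1 / ?d) *\<^sub>R (?d *\<^sub>R b + A *v (?c - z))"
      using d by (simp add: mc[OF z] linear_cmul[OF matrix_vector_mul_linear] scaleR_add_right)
    have 3: "A *v (?c - z) = A *v ?c - A *v z" by (rule matrix_vector_mult_diff_distrib)
    have "(b + A *v (?m z - ?c)) \<bullet> ((C + a \<otimes>\<^sub>v (?m z - ?c)) *v (- ?d *\<^sub>R ?g z))
        = - ((?d *\<^sub>R b + A *v (?c - z)) \<bullet> (C *v ?g z - (1 / (?d + 1)) *\<^sub>R a))"
      unfolding 1 2 using d by simp
    also have "\<dots> = (?d *\<^sub>R b + A *v (?c - z)) \<bullet> a / (?d + 1) - (?d *\<^sub>R b + A *v (?c - z)) \<bullet> (C *v ?g z)"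
      by (simp add: inner_diff_right)
    also have "(?d *\<^sub>R b + A *v (?c - z)) \<bullet> a / (?d + 1) = ?d / (?d + 1) * (b \<bullet> a) + (A *v (?c - z)) \<bullet> a / (?d + 1)"
      by (simp add: inner_add_left add_divide_distrib)
    also have "(?d *\<^sub>R b + A *v (?c - z)) \<bullet> (C *v ?g z)
        = (?d *\<^sub>R b + A *v ?c) \<bullet> (C *v ?g z) - (A *v z) \<bullet> (C *v ?g z)"
      unfolding 3 by (simp add: inner_add_left inner_diff_left)
    finally show ?thesis by simp
  qed
  have "(\<Sum>z\<in>V. (b + A *v (?m z - ?c)) \<bullet> ((C + a \<otimes>\<^sub>v (?m z - ?c)) *v (- ?d *\<^sub>R ?g z)))
      = (\<Sum>z\<in>V. ?d / (?d + 1) * (b \<bullet> a) + (A *v (?c - z)) \<bullet> a / (?d + 1)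
        - (?d *\<^sub>R b + A *v ?c) \<bullet> (C *v ?g z) + (A *v z) \<bullet> (C *v ?g z))"
    by (rule sum.cong[OF refl summand])
  also have "\<dots> = (\<Sum>z\<in>V. ?d / (?d + 1) * (b \<bullet> a)) + (\<Sum>z\<in>V. A *v (?c - z)) \<bullet> a / (?d + 1)
        - (?d *\<^sub>R b + A *v ?c) \<bullet> (\<Sum>z\<in>V. C *v ?g z) + (\<Sum>z\<in>V. (A *v z) \<bullet> (C *v ?g z))"
    by (simp only: sum.distrib sum_subtractf inner_sum_left inner_sum_right sum_divide_distrib)
  also have "\<dots> = real (card V) * (?d / (?d + 1) * (b \<bullet> a)) + A \<bullet> C"
    unfolding Asum Cg AC by simp
  also have "real (card V) * (?d / (?d + 1) * (b \<bullet> a)) = ?d * (a \<bullet> b)"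
    unfolding card_V using d by (simp add: inner_commute field_simps)
  finally show ?thesis by simp
qed

end

section \<open>Traces and fluxes\<close>

context mesh
begin

text \<open>Centring at the barycentre makes \<open>b T\<close> the element mean; \<open>A T\<close>
  is the gradient.\<close>

definition pwaff :: "(real^'n \<Rightarrow> real^'n) \<Rightarrow> ((real^'n) set \<Rightarrow> real^'n) \<Rightarrow> ((real^'n) set \<Rightarrow> real^'n^'n) \<Rightarrow> bool" where
  "pwaff v b A \<longleftrightarrow> (\<forall>T\<in>\<T>. \<forall>x\<in>interior T. v x = b T + A T *v (x - ctr T))"

text \<open>Here \<open>C T\<close> is the element mean, and \<open>d\<close> times
  \<open>a T\<close> is the row-wise divergence.\<close>

definition pwrt :: "(real^'n \<Rightarrow> real^'n^'n) \<Rightarrow> ((real^'n) set \<Rightarrow> real^'n^'n) \<Rightarrow> ((real^'n) set \<Rightarrow> real^'n) \<Rightarrow> bool" where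
  "pwrt \<tau> C a \<longleftrightarrow> (\<forall>T\<in>\<T>. \<forall>x\<in>interior T. \<tau> x = C T + a T \<otimes>\<^sub>v (x - ctr T))"

lemma pwaffD: "pwaff v b A \<Longrightarrow> T \<in> \<T> \<Longrightarrow> x \<in> interior T \<Longrightarrow> v x = b T + A T *v (x - ctr T)"
  by (simp add: pwaff_def)

lemma pwrtD: "pwrt \<tau> C a \<Longrightarrow> T \<in> \<T> \<Longrightarrow> x \<in> interior T \<Longrightarrow> \<tau> x = C T + a T \<otimes>\<^sub>v (x - ctr T)"
  by (simp add: pwrt_def)

lemma piecewise_exists: "\<exists>v. \<forall>T\<in>\<T>. \<forall>x\<in>interior T. v x = \<phi> T x"
proof (intro exI[of _ "\<lambda>x. \<phi> (SOME T. T \<in> \<T> \<and> x \<in> interior T) x"] ballI)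
  fix T x assume T: "T \<in> \<T>" "x \<in> interior T"
  have "(SOME T. T \<in> \<T> \<and> x \<in> interior T) = T"
  proof (rule some_equality)
    show "T' = T" if "T' \<in> \<T> \<and> x \<in> interior T'" for T'
      using interiors_disjoint[of T' T] that T by blast
  qed (use T in blast)
  then show "\<phi> (SOME T. T \<in> \<T> \<and> x \<in> interior T) x = \<phi> T x" by simp
qed

lemma pwaff_exists: "\<exists>v. pwaff v b A" and pwrt_exists: "\<exists>\<tau>. pwrt \<tau> C a"
  unfolding pwaff_def pwrt_def by (rule piecewise_exists)+

lemma Pk_1_iff_pwaff: "v \<in> Pk 1 \<T> \<longleftrightarrow> (\<exists>b A. pwaff v b A)"
proof
  assume "v \<in> Pk 1 \<T>"
  then have "\<forall>T\<in>\<T>. \<exists>L b. linear L \<and> (\<forall>x\<in>interior T. v x = L x + b)" unfolding Pk_1_iff .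
  then obtain L b where L: "\<And>T. T \<in> \<T> \<Longrightarrow> linear (L T)" "\<And>T x. T \<in> \<T> \<Longrightarrow> x \<in> interior T \<Longrightarrow> v x = L T x + b T"
    by metis
  have "pwaff v (\<lambda>T. b T + L T (ctr T)) (\<lambda>T. matrix (L T))"
    unfolding pwaff_def
  proof (intro ballI)
    fix T x assume T: "T \<in> \<T>" "x \<in> interior T"
    have "matrix (L T) *v (x - ctr T) = L T (x - ctr T)" using L(1)[OF T(1)] by simp
    then show "v x = b T + L T (ctr T) + matrix (L T) *v (x - ctr T)"
      using L(2)[OF T] linear_diff[OF L(1)[OF T(1)]] by simp
  qed
  then show "\<exists>b A. pwaff v b A" by blast
next
  assume "\<exists>b A. pwaff v b A"
  then obtain b A where v: "pwaff v b A" by blast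
  show "v \<in> Pk 1 \<T>"
    unfolding Pk_1_iff
  proof
    fix T assume T: "T \<in> \<T>"
    show "\<exists>L b. linear L \<and> (\<forall>x\<in>interior T. v x = L x + b)"
      using pwaffD[OF v T]
      by (intro exI[of _ "\<lambda>x. A T *v x"] exI[of _ "b T - A T *v ctr T"]) (simp add: matrix_vector_mult_diff_distrib)
  qed
qed

lemma pwrt_Pk_1: assumes "pwrt \<tau> C a" shows "\<tau> \<in> Pk 1 \<T>"
  unfolding Pk_1_iff
proof
  fix T assume T: "T \<in> \<T>"
  show "\<exists>L b. linear L \<and> (\<forall>x\<in>interior T. \<tau> x = L x + b)"
    using pwrtD[OF assms T]
    by (intro exI[of _ "\<lambda>x. a T \<otimes>\<^sub>v x"] exI[of _ "C T - a T \<otimes>\<^sub>v ctr T"])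
      (simp add: linear_outer linear_diff[OF linear_outer])
qed

section \<open>Side values, fluxes and area-weighted normals\<close>

definition sctr :: "(real^'n) set \<Rightarrow> real^'n" where "sctr S = cen (verts S)"

text \<open>The outer normal of the side \<open>S\<close> of \<open>T\<close>, scaled by the surface measure of \<open>S\<close>.\<close>

definition area_normal :: "(real^'n) set \<Rightarrow> (real^'n) set \<Rightarrow> real^'n" where
  "area_normal T S = vol T *\<^sub>R (- real CARD('n) *\<^sub>R bgrad (verts T) (apex T S))"

text \<open>The mean over \<open>S\<close> of the trace from \<open>T\<close>, since an affine
  function attains its mean at the barycentre.\<close>

definition side_val :: "((real^'n) set \<Rightarrow> real^'n) \<Rightarrow> ((real^'n) set \<Rightarrow> real^'n^'n) \<Rightarrow> (real^'n) set \<Rightarrow> (real^'n) set \<Rightarrow> real^'n" where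
  "side_val b A T S = b T + A T *v (sctr S - ctr T)"

text \<open>The integral over \<open>S\<close> of the normal component of the trace from
  \<open>T\<close>, which is constant on \<open>S\<close>.\<close>

definition flux :: "((real^'n) set \<Rightarrow> real^'n^'n) \<Rightarrow> ((real^'n) set \<Rightarrow> real^'n) \<Rightarrow> (real^'n) set \<Rightarrow> (real^'n) set \<Rightarrow> real^'n" where
  "flux C a T S = (C T + a T \<otimes>\<^sub>v (sctr S - ctr T)) *v area_normal T S"

lemma area_normal_outer:
  assumes "T \<in> \<T>" "S facet_of T"
  obtains k where "0 < k" "outer_normal T S = k *\<^sub>R area_normal T S"
proof
  interpret V: full_simplex "verts T" by (rule full_simplex_elt[OF assms(1)])
  let ?g = "bgrad (verts T) (apex T S)"
  note a = apex[OF assms]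
  have pos: "0 < norm ?g" "0 < vol T * CARD('n)"
    using V.bgrad_nonzero[OF a(1)] vol_pos[OF assms(1)] by auto
  then show "0 < inverse (norm ?g) / (vol T * CARD('n))" by simp
  have "outer_normal T S = - (?g /\<^sub>R norm ?g)"
    using V.outer_normal_side[OF a(1)] unfolding a(2) hull_verts[OF assms(1)] .
  then show "outer_normal T S = (inverse (norm ?g) / (vol T * CARD('n))) *\<^sub>R area_normal T S"
    using pos vol_pos[OF assms(1)] by (simp add: area_normal_def)
qed

lemma area_normal_nonzero: "T \<in> \<T> \<Longrightarrow> S facet_of T \<Longrightarrow> area_normal T S \<noteq> 0"
  using vol_pos full_simplex.bgrad_nonzero[OF full_simplex_elt apex(1)] by (fastforce simp: area_normal_def)

lemma area_normal_shared:
  assumes "T \<in> \<T>" "T' \<in> \<T>" "T \<noteq> T'" "S facet_of T" "S facet_of T'"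
  shows "area_normal T' S = - area_normal T S"
proof -
  interpret adjacent_simplices "verts T" "verts T'" "apex T S" "apex T' S"
    by (rule adjacent[OF assms])
  have "vol T' *\<^sub>R bgrad (verts T') (apex T' S) = - (vol T *\<^sub>R bgrad (verts T) (apex T S))"
    using measure_bgrad assms(1,2) by (simp add: vol_def hull_verts)
  then have "(- real CARD('n)) *\<^sub>R (vol T' *\<^sub>R bgrad (verts T') (apex T' S)) = - ((- real CARD('n)) *\<^sub>R (vol T *\<^sub>R bgrad (verts T) (apex T S)))"
    by simp
  then show ?thesis by (simp add: area_normal_def mult.commute)
qed

lemma outer_normal_shared:
  assumes "T \<in> \<T>" "T' \<in> \<T>" "T \<noteq> T'" "S facet_of T" "S facet_of T'"
  obtains k where "0 < k" "outer_normal T S = k *\<^sub>R area_normal T S" "outer_normal T S = - (k *\<^sub>R area_normal T' S)"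
proof -
  obtain k where "0 < k" "outer_normal T S = k *\<^sub>R area_normal T S"
    using area_normal_outer assms by metis
  then show thesis using that area_normal_shared[OF assms] by simp
qed

text \<open>Area-weighted normals of distinct elements at \<open>S\<close> are opposite; three
  pairwise opposite vectors would vanish.\<close>

lemma elements_at_side:
  assumes "T \<in> \<T>" "T' \<in> \<T>" "T \<noteq> T'" "S facet_of T" "S facet_of T'"
  shows "{T \<in> \<T>. S facet_of T} = {T, T'}"
proof -
  have False if "T'' \<in> \<T>" "S facet_of T''" "T'' \<noteq> T" "T'' \<noteq> T'" for T''
  proof -
    have "area_normal T'' S = - area_normal T S" "area_normal T'' S = - area_normal T' S"
      "area_normal T' S = - area_normal T S"
      using area_normal_shared[OF assms(1) that(1) that(3)[symmetric] assms(4) that(2)]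
        area_normal_shared[OF assms(2) that(1) that(4)[symmetric] assms(5) that(2)]
        area_normal_shared[OF assms] by blast+
    then have "2 *\<^sub>R area_normal T S = 0" by (simp add: scaleR_2)
    then have "area_normal T S = 0" by simp
    then show False using area_normal_nonzero assms by blast
  qed
  then show ?thesis using assms by blast
qed

lemma finite_facets: "T \<in> \<T> \<Longrightarrow> finite {S. S facet_of T}"
proof -
  assume T: "T \<in> \<T>"
  have "{S. S facet_of T} = (\<lambda>z. convex hull (verts T - {z})) ` verts T"
    using facet_elt_iff[OF T] by blast
  then show ?thesis using full_simplex.finite_V[OF full_simplex_elt[OF T]] by simp
qed

lemma sum_facets:
  assumes T: "T \<in> \<T>"
  shows "(\<Sum>S | S facet_of T. f S) = (\<Sum>z\<in>verts T. f (convex hull (verts T - {z})))"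
proof (rule sum.reindex_bij_betw[symmetric])
  show "bij_betw (\<lambda>z. convex hull (verts T - {z})) (verts T) {S. S facet_of T}"
    unfolding bij_betw_def
  proof
    show "inj_on (\<lambda>z. convex hull (verts T - {z})) (verts T)"
      by (rule inj_on_inverseI[of _ "apex T"]) (rule apex_side[OF T])
    show "(\<lambda>z. convex hull (verts T - {z})) ` verts T = {S. S facet_of T}"
      using facet_elt_iff[OF T] by blast
  qed
qed

lemma elt_integration_by_parts:
  assumes T: "T \<in> \<T>"
  shows "vol T * (A T \<bullet> C T + CARD('n) * (a T \<bullet> b T)) = (\<Sum>S | S facet_of T. side_val b A T S \<bullet> flux C a T S)"
proof -
  interpret V: full_simplex "verts T" by (rule full_simplex_elt[OF T])
  have "vol T * (A T \<bullet> C T + CARD('n) * (a T \<bullet> b T))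
      = (\<Sum>z\<in>verts T. (b T + A T *v (cen (verts T - {z}) - ctr T)) \<bullet>
        (vol T *\<^sub>R ((C T + a T \<otimes>\<^sub>v (cen (verts T - {z}) - ctr T)) *v (- real CARD('n) *\<^sub>R bgrad (verts T) z))))"
    unfolding V.integration_by_parts ctr_def by (simp only: sum_distrib_left inner_scaleR_right)
  also have "\<dots> = (\<Sum>z\<in>verts T. side_val b A T (convex hull (verts T - {z})) \<bullet> flux C a T (convex hull (verts T - {z})))"
  proof (rule sum.cong[OF refl])
    fix z assume z: "z \<in> verts T"
    show "(b T + A T *v (cen (verts T - {z}) - ctr T)) \<bullet>
        (vol T *\<^sub>R ((C T + a T \<otimes>\<^sub>v (cen (verts T - {z}) - ctr T)) *v (- real CARD('n) *\<^sub>R bgrad (verts T) z)))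
      = side_val b A T (convex hull (verts T - {z})) \<bullet> flux C a T (convex hull (verts T - {z}))"
      unfolding side_val_def flux_def area_normal_def sctr_def V.verts_side apex_side[OF T z]
        linear_cmul[OF matrix_vector_mul_linear, of _ "vol T"] ..
  qed
  finally show ?thesis unfolding sum_facets[OF T] .
qed

lemma restr_pwaff:
  assumes "pwaff v b A" "T \<in> \<T>" "x \<in> T"
  shows "restr T v x = b T + A T *v (x - ctr T)"
  by (rule restr_affine[OF assms(2) matrix_vector_mul_linear pwaffD[OF assms(1,2)] assms(3)])

lemma restr_pwrt:
  assumes "pwrt \<tau> C a" "T \<in> \<T>" "x \<in> T"
  shows "restr T \<tau> x = C T + a T \<otimes>\<^sub>v (x - ctr T)"
  by (rule restr_affine[OF assms(2) linear_outer pwrtD[OF assms(1,2)] assms(3)])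

lemma side_mean_elt:
  fixes L :: "real^'n \<Rightarrow> 'b::euclidean_space"
  assumes T: "T \<in> \<T>" "S facet_of T" and "linear L" "\<And>x. x \<in> S \<Longrightarrow> w x = L x + b"
  shows "side_mean S w = L (sctr S) + b"
  using full_simplex.side_mean_affine[OF full_simplex_elt[OF T(1)] apex(1)[OF T] assms(3), of w b] assms(4)
  by (simp add: apex(2,3)[OF T] sctr_def)

lemma side_mean_pwaff:
  assumes "pwaff v b A" "T \<in> \<T>" "S facet_of T"
  shows "side_mean S (restr T v) = side_val b A T S"
proof -
  have "restr T v x = A T *v x + (b T - A T *v ctr T)" if "x \<in> S" for x
  proof -
    have "x \<in> T" using that facet_of_imp_subset assms(3) by blast
    then show ?thesis by (simp add: restr_pwaff[OF assms(1,2)] algebra_simps)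
  qed
  from side_mean_elt[OF assms(2,3) matrix_vector_mul_linear this] show ?thesis
    by (simp add: side_val_def matrix_vector_mult_diff_distrib)
qed

lemma side_mean_jump_pwaff:
  assumes "pwaff v b A" "T \<in> \<T>" "T' \<in> \<T>" "S facet_of T" "S facet_of T'"
  shows "side_mean S (\<lambda>x. restr T v x - restr T' v x) = side_val b A T S - side_val b A T' S"
proof -
  have "restr T v x - restr T' v x
      = (A T - A T') *v x + (b T - A T *v ctr T - (b T' - A T' *v ctr T'))" if "x \<in> S" for x
  proof -
    have "x \<in> T" "x \<in> T'" using that facet_of_imp_subset assms(4,5) by blast+
    then show ?thesis
      by (simp add: restr_pwaff[OF assms(1,2)] restr_pwaff[OF assms(1,3)] algebra_simps)
  qed
  from side_mean_elt[OF assms(2,4) matrix_vector_mul_linear this] show ?thesis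
    by (simp add: side_val_def matrix_vector_mult_diff_distrib matrix_vector_mult_diff_rdistrib)
qed

section \<open>The discrete spaces in terms of side values and fluxes\<close>

lemma CR_D_iff:
  assumes "pwaff v b A"
  shows "v \<in> CR_D \<T> \<Gamma>D \<longleftrightarrow>
    (\<forall>T\<in>\<T>. \<forall>T'\<in>\<T>. \<forall>S. T \<noteq> T' \<and> S facet_of T \<and> S facet_of T' \<longrightarrow> side_val b A T S = side_val b A T' S) \<and>
    (\<forall>T\<in>\<T>. \<forall>S. S facet_of T \<and> S \<subseteq> closure \<Gamma>D \<longrightarrow> side_val b A T S = 0)"
proof -
  have "v \<in> Pk 1 \<T>" using assms Pk_1_iff_pwaff by blast
  then have "v \<in> CR \<T> \<longleftrightarrow> (\<forall>T\<in>\<T>. \<forall>T'\<in>\<T>. \<forall>S. T \<noteq> T' \<and> S facet_of T \<and> S facet_of T' \<longrightarrow> side_val b A T S = side_val b A T' S)"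
    unfolding CR_def using side_mean_jump_pwaff[OF assms] by auto
  moreover have "(\<forall>T\<in>\<T>. \<forall>S. S facet_of T \<and> S \<subseteq> closure \<Gamma>D \<longrightarrow> side_mean S (restr T v) = 0)
      \<longleftrightarrow> (\<forall>T\<in>\<T>. \<forall>S. S facet_of T \<and> S \<subseteq> closure \<Gamma>D \<longrightarrow> side_val b A T S = 0)"
    using side_mean_pwaff[OF assms] by auto
  ultimately show ?thesis unfolding CR_D_def by blast
qed

text \<open>Differences of points of \<open>S\<close> are orthogonal to the normal, so the linear
  part of \<open>\<tau>\<close> contributes the same normal component all over
  \<open>S\<close>.\<close>

lemma restr_area_normal:
  assumes "pwrt \<tau> C a" "T \<in> \<T>" "S facet_of T" "x \<in> S"
  shows "restr T \<tau> x *v area_normal T S = flux C a T S"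
proof -
  have "x \<in> T" using assms(3,4) facet_of_imp_subset by blast
  have "bgrad (verts T) (apex T S) \<bullet> (x - sctr S) = 0"
    using assms(4) cen_side(1)[OF assms(2,3)] unfolding mem_side_iff[OF assms(2,3)] sctr_def
    by (simp add: bary_diff[symmetric])
  then have "(x - ctr T) \<bullet> area_normal T S = (sctr S - ctr T) \<bullet> area_normal T S"
    by (simp add: area_normal_def inner_diff_left inner_diff_right inner_commute)
  then show ?thesis
    unfolding restr_pwrt[OF assms(1,2) \<open>x \<in> T\<close>] flux_def
    by (simp add: matrix_vector_mult_add_rdistrib outer_mul_vec)
qed

lemma matrix_vector_scaleR: "(M :: real^'n^'m) *v (k *\<^sub>R x) = k *\<^sub>R (M *v x)"
  by (rule linear_cmul[OF matrix_vector_mul_linear])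

text \<open>Continuity is stated with the normal of \<open>T\<close> for both traces, whereas each
  \<open>flux\<close> uses the normal of its own element; the change of sign turns the equality into
  a vanishing sum.\<close>

lemma RT_iff:
  assumes \<tau>: "pwrt \<tau> C a"
  shows "\<tau> \<in> RT \<T> \<longleftrightarrow>
    (\<forall>T\<in>\<T>. \<forall>T'\<in>\<T>. \<forall>S. T \<noteq> T' \<and> S facet_of T \<and> S facet_of T' \<longrightarrow> flux C a T S + flux C a T' S = 0)"
proof -
  have const: "\<exists>c. \<forall>x\<in>S. restr T \<tau> x *v outer_normal T S = c" if T: "T \<in> \<T>" "S facet_of T" for T S
  proof -
    obtain k where "0 < k" "outer_normal T S = k *\<^sub>R area_normal T S" using area_normal_outer[OF T] .
    then show ?thesis
      using restr_area_normal[OF \<tau> T] by (intro exI[of _ "k *\<^sub>R flux C a T S"]) (simp add: matrix_vector_scaleR)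
  qed
  have jump: "(\<forall>x\<in>S. restr T \<tau> x *v outer_normal T S = restr T' \<tau> x *v outer_normal T S)
      \<longleftrightarrow> flux C a T S + flux C a T' S = 0"
    if T: "T \<in> \<T>" "T' \<in> \<T>" "T \<noteq> T'" "S facet_of T" "S facet_of T'" for T T' S
  proof -
    obtain k where k: "0 < k" "outer_normal T S = k *\<^sub>R area_normal T S" "outer_normal T S = - (k *\<^sub>R area_normal T' S)"
      using outer_normal_shared[OF T] .
    have 1: "restr T \<tau> x *v outer_normal T S = k *\<^sub>R flux C a T S" if "x \<in> S" for x
      unfolding k(2) matrix_vector_scaleR restr_area_normal[OF \<tau> T(1,4) that] ..
    have 2: "restr T' \<tau> x *v outer_normal T S = - (k *\<^sub>R flux C a T' S)" if "x \<in> S" for x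
      unfolding k(3) scaleR_minus_left[symmetric] matrix_vector_scaleR restr_area_normal[OF \<tau> T(2,5) that] ..
    have "S \<noteq> {}" using T(4) by (simp add: facet_of_def)
    moreover have "k *\<^sub>R flux C a T S = - (k *\<^sub>R flux C a T' S) \<longleftrightarrow> flux C a T S + flux C a T' S = 0"
    proof -
      have "k *\<^sub>R flux C a T S = - (k *\<^sub>R flux C a T' S) \<longleftrightarrow> k *\<^sub>R (flux C a T S + flux C a T' S) = 0"
        by (simp only: scaleR_add_right eq_neg_iff_add_eq_0)
      then show ?thesis using k(1) by simp
    qed
    ultimately show ?thesis using 1 2 by auto
  qed
  show ?thesis
    unfolding RT_def using pwrt_Pk_1[OF \<tau>] const jump by auto
qed

text \<open>The normal component is constant on a side, so its vanishing at one point is its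
  vanishing on the side; and a boundary side has a point in \<open>\<Gamma>N\<close> exactly if it
  lies in the closure.\<close>

lemma RT_N_iff:
  assumes \<tau>: "pwrt \<tau> C a"
  shows "\<tau> \<in> RT_N \<Omega> \<T> \<Gamma>N \<longleftrightarrow>
    (\<forall>T\<in>\<T>. \<forall>T'\<in>\<T>. \<forall>S. T \<noteq> T' \<and> S facet_of T \<and> S facet_of T' \<longrightarrow> flux C a T S + flux C a T' S = 0) \<and>
    (\<forall>T\<in>\<T>. \<forall>S. S facet_of T \<and> S \<subseteq> closure \<Gamma>N \<longrightarrow> flux C a T S = 0)"
proof -
  have *: "(S \<subseteq> frontier \<Omega> \<longrightarrow> (\<forall>x\<in>S \<inter> \<Gamma>N. restr T \<tau> x *v outer_normal T S = 0))
      \<longleftrightarrow> (S \<subseteq> closure \<Gamma>N \<longrightarrow> flux C a T S = 0)" if T: "T \<in> \<T>" "S facet_of T" for T S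
  proof -
    obtain k where k: "0 < k" "outer_normal T S = k *\<^sub>R area_normal T S" using area_normal_outer[OF T] .
    have "restr T \<tau> x *v outer_normal T S = 0 \<longleftrightarrow> flux C a T S = 0" if "x \<in> S" for x
      unfolding k(2) matrix_vector_scaleR restr_area_normal[OF \<tau> T that] using k(1) by simp
    then have "(\<forall>x\<in>S \<inter> \<Gamma>N. restr T \<tau> x *v outer_normal T S = 0) \<longleftrightarrow> S \<inter> \<Gamma>N = {} \<or> flux C a T S = 0"
      by blast
    moreover have "S \<subseteq> frontier \<Omega> \<and> S \<inter> \<Gamma>N \<noteq> {} \<longleftrightarrow> S \<subseteq> closure \<Gamma>N"
      using boundary_side_cases[OF T] Neumann_side_meets[OF T] parts_disjoint(1) closure_parts(2) by blast
    ultimately show ?thesis by argo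
  qed
  have "(S facet_of T \<and> S \<subseteq> frontier \<Omega> \<longrightarrow> (\<forall>x\<in>S \<inter> \<Gamma>N. restr T \<tau> x *v outer_normal T S = 0))
      \<longleftrightarrow> (S facet_of T \<and> S \<subseteq> closure \<Gamma>N \<longrightarrow> flux C a T S = 0)" if "T \<in> \<T>" for T S
  proof (cases "S facet_of T")
    case True
    show ?thesis unfolding imp_conjL *[OF that True] ..
  qed simp
  then show ?thesis
    unfolding RT_N_def mem_Collect_eq RT_iff[OF \<tau>, symmetric]
    by (intro conj_cong refl ball_cong all_cong1)
qed

text \<open>Evaluating the constant normal components at the vertices of each side brings the linear
  part into the form that \<open>constant_normal_structure\<close> expects.\<close>

lemma RT_pwrt:
  assumes "\<tau> \<in> RT \<T>"
  shows "\<exists>C a. pwrt \<tau> C a"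
proof -
  have "\<forall>T\<in>\<T>. \<exists>C a. \<forall>x\<in>interior T. \<tau> x = C + a \<otimes>\<^sub>v (x - ctr T)"
  proof
    fix T assume T: "T \<in> \<T>"
    interpret V: full_simplex "verts T" by (rule full_simplex_elt[OF T])
    have "\<tau> \<in> Pk 1 \<T>" using assms by (simp add: RT_def)
    then have "\<exists>L b. linear L \<and> (\<forall>x\<in>interior T. \<tau> x = L x + b)"
      unfolding Pk_1_iff using T by (rule bspec)
    then obtain L b where L: "linear L" "\<forall>x\<in>interior T. \<tau> x = L x + b"
      by (elim exE conjE) (rule that)
    have r: "restr T \<tau> x = b + L (x - 0)" if "x \<in> T" for x
      by (rule restr_affine[OF T L(1) _ that]) (use L(2) in \<open>simp add: add.commute\<close>)
    have "L y *v bgrad (verts T) z = L y' *v bgrad (verts T) z"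
      if z: "z \<in> verts T" "y \<in> verts T - {z}" "y' \<in> verts T - {z}" for z y y'
    proof -
      define S where "S = convex hull (verts T - {z})"
      have S: "S facet_of T" unfolding facet_elt_iff[OF T] S_def using z(1) by blast
      have yS: "y \<in> S" "y' \<in> S" unfolding S_def using z by (simp_all add: hull_inc)
      then have yT: "y \<in> T" "y' \<in> T" using facet_of_imp_subset[OF S] by blast+
      have "restr T \<tau> y *v outer_normal T S = restr T \<tau> y' *v outer_normal T S"
        using assms T S yS unfolding RT_def by fastforce
      then have "L y *v outer_normal T S = L y' *v outer_normal T S"
        by (simp add: r yT matrix_vector_mult_add_rdistrib)
      moreover have "outer_normal T S = - (bgrad (verts T) z /\<^sub>R norm (bgrad (verts T) z))"
        using V.outer_normal_side[OF z(1)] by (simp add: S_def hull_verts[OF T])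
      ultimately have "(- inverse (norm (bgrad (verts T) z))) *\<^sub>R (L y *v bgrad (verts T) z)
          = (- inverse (norm (bgrad (verts T) z))) *\<^sub>R (L y' *v bgrad (verts T) z)"
        by (simp only: matrix_vector_scaleR[symmetric] scaleR_minus_left)
      then show ?thesis using V.bgrad_nonzero[OF z(1)] by simp
    qed
    then obtain m where m: "\<And>h. L h = (\<chi> i j. m $ i * h $ j)"
      using V.constant_normal_structure[OF L(1)] by blast
    have "\<tau> x = (b + L (ctr T)) + m \<otimes>\<^sub>v (x - ctr T)" if "x \<in> interior T" for x
    proof -
      have "m \<otimes>\<^sub>v (x - ctr T) = L (x - ctr T)" unfolding outer_def m ..
      then show ?thesis using L(2) that linear_diff[OF L(1)] by simp
    qed
    then show "\<exists>C a. \<forall>x\<in>interior T. \<tau> x = C + a \<otimes>\<^sub>v (x - ctr T)" by blast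
  qed
  then obtain C a where "\<And>T. T \<in> \<T> \<Longrightarrow> \<forall>x\<in>interior T. \<tau> x = C T + a T \<otimes>\<^sub>v (x - ctr T)" by metis
  then show ?thesis unfolding pwrt_def by blast
qed

section \<open>Volume-weighted sums and the discrete integration by parts\<close>

definition msum :: "((real^'n) set \<Rightarrow> real) \<Rightarrow> real" where
  "msum \<phi> = (\<Sum>T\<in>\<T>. vol T * \<phi> T)"

lemma msum_cong: "(\<And>T. T \<in> \<T> \<Longrightarrow> \<phi> T = \<psi> T) \<Longrightarrow> msum \<phi> = msum \<psi>"
  by (simp add: msum_def)

lemma msum_add: "msum (\<lambda>T. \<phi> T + \<psi> T) = msum \<phi> + msum \<psi>"
  and msum_diff: "msum (\<lambda>T. \<phi> T - \<psi> T) = msum \<phi> - msum \<psi>"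
  and msum_cmul: "msum (\<lambda>T. c * \<phi> T) = c * msum \<phi>"
  and msum_minus: "msum (\<lambda>T. - \<phi> T) = - msum \<phi>"
  by (simp_all add: msum_def distrib_left right_diff_distrib sum.distrib sum_subtractf sum_distrib_left
      sum_negf mult.left_commute)

lemma msum_nonneg: "(\<And>T. T \<in> \<T> \<Longrightarrow> 0 \<le> \<phi> T) \<Longrightarrow> 0 \<le> msum \<phi>"
  unfolding msum_def by (intro sum_nonneg mult_nonneg_nonneg) (simp_all add: less_imp_le vol_pos)

lemma msum_nonneg_eq_0D:
  assumes "msum \<phi> \<le> 0" "\<And>T. T \<in> \<T> \<Longrightarrow> 0 \<le> \<phi> T" "T \<in> \<T>"
  shows "\<phi> T = 0"
proof -
  have "msum \<phi> = 0" using assms(1) msum_nonneg[of \<phi>] assms(2) by fastforce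
  then have "\<forall>T\<in>\<T>. vol T * \<phi> T = 0"
    unfolding msum_def using assms(2) vol_pos finite_mesh
    by (subst (asm) sum_nonneg_eq_0_iff) (simp_all add: less_imp_le)
  then show ?thesis using assms(3) vol_pos[OF assms(3)] by auto
qed

lemma integration_by_parts:
  "msum (\<lambda>T. A T \<bullet> C T + CARD('n) * (a T \<bullet> b T))
    = (\<Sum>S\<in>(\<Union>T\<in>\<T>. {S. S facet_of T}). \<Sum>T\<in>{T \<in> \<T>. S facet_of T}. side_val b A T S \<bullet> flux C a T S)"
proof -
  let ?\<S> = "\<Union>T\<in>\<T>. {S. S facet_of T}"
  have fin: "finite ?\<S>" using finite_mesh finite_facets by blast
  have "msum (\<lambda>T. A T \<bullet> C T + CARD('n) * (a T \<bullet> b T))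
      = (\<Sum>T\<in>\<T>. \<Sum>S\<in>{S \<in> ?\<S>. S facet_of T}. side_val b A T S \<bullet> flux C a T S)"
    unfolding msum_def
  proof (rule sum.cong[OF refl])
    fix T assume T: "T \<in> \<T>"
    then have "{S \<in> ?\<S>. S facet_of T} = {S. S facet_of T}" by blast
    then show "vol T * (A T \<bullet> C T + CARD('n) * (a T \<bullet> b T))
        = (\<Sum>S\<in>{S \<in> ?\<S>. S facet_of T}. side_val b A T S \<bullet> flux C a T S)"
      using elt_integration_by_parts[OF T, of A C a b] by simp
  qed
  then show ?thesis using sum.swap_restrict[OF finite_mesh fin] by simp
qed

lemma sides_cases:
  assumes "T \<in> \<T>" "S facet_of T"
  obtains (shared) T' where "T' \<in> \<T>" "T' \<noteq> T" "S facet_of T'" "{T \<in> \<T>. S facet_of T} = {T, T'}"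
  | (boundary) "S \<subseteq> frontier \<Omega>" "{T \<in> \<T>. S facet_of T} = {T}"
proof (cases "\<exists>T'\<in>\<T>. S facet_of T' \<and> T' \<noteq> T")
  case True
  then obtain T' where T': "T' \<in> \<T>" "S facet_of T'" "T' \<noteq> T" by blast
  show thesis
    using elements_at_side[OF assms(1) T'(1) T'(3)[symmetric] assms(2) T'(2)] by (intro shared[of T'] T')
next
  case False
  then have un: "T' = T" if "T' \<in> \<T>" "S facet_of T'" for T' using that by blast
  show thesis
  proof (rule boundary)
    show "S \<subseteq> frontier \<Omega>" by (rule unshared_side_boundary[OF assms un])
    show "{T \<in> \<T>. S facet_of T} = {T}" using un assms by blast
  qed
qed

lemma CR_D_shared:
  assumes "pwaff v b A" "v \<in> CR_D \<T> \<Gamma>D" "T \<in> \<T>" "T' \<in> \<T>" "T \<noteq> T'" "S facet_of T" "S facet_of T'"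
  shows "side_val b A T S = side_val b A T' S"
  using conjunct1[OF CR_D_iff[OF assms(1), THEN iffD1, OF assms(2)], rule_format, OF assms(3,4)] assms(5-7)
  by blast

lemma CR_D_Dirichlet:
  assumes "pwaff v b A" "v \<in> CR_D \<T> \<Gamma>D" "T \<in> \<T>" "S facet_of T" "S \<subseteq> closure \<Gamma>D"
  shows "side_val b A T S = 0"
  using conjunct2[OF CR_D_iff[OF assms(1), THEN iffD1, OF assms(2)], rule_format, OF assms(3)] assms(4,5)
  by blast

lemma RT_N_shared:
  assumes "pwrt \<tau> C a" "\<tau> \<in> RT_N \<Omega> \<T> \<Gamma>N" "T \<in> \<T>" "T' \<in> \<T>" "T \<noteq> T'" "S facet_of T" "S facet_of T'"
  shows "flux C a T S + flux C a T' S = 0"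
  using conjunct1[OF RT_N_iff[OF assms(1), THEN iffD1, OF assms(2)], rule_format, OF assms(3,4)] assms(5-7)
  by blast

lemma RT_N_Neumann:
  assumes "pwrt \<tau> C a" "\<tau> \<in> RT_N \<Omega> \<T> \<Gamma>N" "T \<in> \<T>" "S facet_of T" "S \<subseteq> closure \<Gamma>N"
  shows "flux C a T S = 0"
  using conjunct2[OF RT_N_iff[OF assms(1), THEN iffD1, OF assms(2)], rule_format, OF assms(3)] assms(4,5)
  by blast

text \<open>At a shared side equal values meet opposite fluxes. A boundary side lies in one of the
  two closures, where the value or the flux vanishes.\<close>

lemma discrete_integration_by_parts:
  assumes v: "pwaff v b A" "v \<in> CR_D \<T> \<Gamma>D" and \<tau>: "pwrt \<tau> C a" "\<tau> \<in> RT_N \<Omega> \<T> \<Gamma>N"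
  shows "msum (\<lambda>T. A T \<bullet> C T + CARD('n) * (a T \<bullet> b T)) = 0"
  unfolding integration_by_parts
proof (rule sum.neutral, rule ballI)
  fix S assume "S \<in> (\<Union>T\<in>\<T>. {S. S facet_of T})"
  then obtain T where T: "T \<in> \<T>" "S facet_of T" by blast
  from T show "(\<Sum>T\<in>{T \<in> \<T>. S facet_of T}. side_val b A T S \<bullet> flux C a T S) = 0"
  proof (cases rule: sides_cases)
    case (shared T')
    have "side_val b A T S = side_val b A T' S" "flux C a T S + flux C a T' S = 0"
      using CR_D_shared[OF v T(1) shared(1) shared(2)[symmetric] T(2) shared(3)]
        RT_N_shared[OF \<tau> T(1) shared(1) shared(2)[symmetric] T(2) shared(3)] .
    then show ?thesis using shared(2,4) by (simp add: inner_add_right[symmetric])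
  next
    case boundary
    then have "side_val b A T S = 0 \<or> flux C a T S = 0"
      using boundary_side_cases[OF T boundary(1)] CR_D_Dirichlet[OF v T] RT_N_Neumann[OF \<tau> T] by blast
    then show ?thesis using boundary(2) by auto
  qed
qed

section \<open>Basis functions and the converse of the orthogonality\<close>

lemma sum_sides_single:
  assumes "T \<in> \<T>" "S facet_of T"
    and "\<And>T S'. T \<in> \<T> \<Longrightarrow> S' facet_of T \<Longrightarrow> S' \<noteq> S \<Longrightarrow> \<phi> T S' = (0::real)"
  shows "(\<Sum>S\<in>(\<Union>T\<in>\<T>. {S. S facet_of T}). \<Sum>T\<in>{T \<in> \<T>. S facet_of T}. \<phi> T S) = (\<Sum>T\<in>{T \<in> \<T>. S facet_of T}. \<phi> T S)"
proof -
  have "finite (\<Union>T\<in>\<T>. {S. S facet_of T})" using finite_mesh finite_facets by blast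
  moreover have "S \<in> (\<Union>T\<in>\<T>. {S. S facet_of T})" using assms by blast
  moreover have "(\<Sum>T\<in>{T \<in> \<T>. S' facet_of T}. \<phi> T S') = 0" if "S' \<noteq> S" for S'
    using assms(3) that by (intro sum.neutral) blast
  ultimately show ?thesis by (simp add: sum.remove)
qed

lemma sctr_bgrad:
  assumes T: "T \<in> \<T>" "S facet_of T" "S' facet_of T"
  shows "bary (verts T) (apex T S) (sctr S') = (if S' = S then 0 else 1 / CARD('n))"
proof (cases "S' = S")
  case True
  then show ?thesis using cen_side(1)[OF T(1,2)] by (simp add: sctr_def)
next
  case False
  have "apex T S \<noteq> apex T S'" using apex(2)[OF T(1,2)] apex(2)[OF T(1,3)] False by metis
  then have "apex T S \<in> verts S'" using apex(1)[OF T(1,2)] apex(3)[OF T(1,3)] by blast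
  then show ?thesis using cen_side(2)[OF T(1,3)] False by (simp add: sctr_def)
qed

text \<open>The Crouzeix--Raviart basis function of the side \<open>S\<close> is \<open>1 - d \<lambda>\<close> on each element at \<open>S\<close>, with \<open>\<lambda>\<close>
  the barycentric coordinate of the vertex opposite to \<open>S\<close>.\<close>

lemma CR_basis:
  obtains v b A where "pwaff v b A"
    "\<And>T S'. T \<in> \<T> \<Longrightarrow> S' facet_of T \<Longrightarrow> side_val b A T S' = (if S' = S then e else 0)"
proof -
  let ?d = "real CARD('n)"
  \<comment> \<open>The value of \<open>1 - d \<lambda>\<close> at the barycentre, where
    \<open>\<lambda>\<close> is \<open>1 / (d + 1)\<close>.\<close>
  define b where "b T = (if S facet_of T then (1 / (?d + 1)) *\<^sub>R e else 0)" for T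
  define A where "A T = (if S facet_of T then e \<otimes>\<^sub>v ((- ?d) *\<^sub>R bgrad (verts T) (apex T S)) else 0)" for T
  obtain v where "pwaff v b A" using pwaff_exists by blast
  moreover have "side_val b A T S' = (if S' = S then e else 0)" if T: "T \<in> \<T>" "S' facet_of T" for T S'
  proof (cases "S facet_of T")
    case True
    have c: "bary (verts T) (apex T S) (ctr T) = 1 / (?d + 1)"
      using full_simplex.bary_cen[OF full_simplex_elt[OF T(1)] order_refl _ apex(1)[OF T(1) True]]
        apex(1)[OF T(1) True] full_simplex.card_V[OF full_simplex_elt[OF T(1)]]
      by (auto simp: ctr_def add.commute)
    have d: "?d > 0" by simp
    have "bgrad (verts T) (apex T S) \<bullet> (sctr S' - ctr T) = (if S' = S then 0 else 1 / ?d) - 1 / (?d + 1)"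
      using sctr_bgrad[OF T(1) True T(2)] c by (simp add: bary_diff[symmetric])
    then have "side_val b A T S' = (1 / (?d + 1) - ?d * ((if S' = S then 0 else 1 / ?d) - 1 / (?d + 1))) *\<^sub>R e"
      using True by (simp add: side_val_def b_def A_def outer_mul_vec scaleR_diff_left)
    also have "1 / (?d + 1) - ?d * ((if S' = S then 0 else 1 / ?d) - 1 / (?d + 1)) = (if S' = S then 1 else 0)"
      using d by (simp add: field_simps)
    finally show ?thesis by simp
  next
    case False
    then show ?thesis using T by (auto simp: side_val_def b_def A_def)
  qed
  ultimately show thesis by (rule that)
qed

text \<open>On an element at \<open>S\<close>, the Raviart--Thomas basis field of \<open>S\<close> is proportional to \<open>x - z\<close>, where \<open>z\<close> is the
  vertex opposite to \<open>S\<close>.\<close>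

lemma RT_basis:
  obtains \<tau> C a where "pwrt \<tau> C a"
    "\<And>T S'. T \<in> \<T> \<Longrightarrow> S' facet_of T \<Longrightarrow> flux C a T S' = (if S' = S then \<epsilon> T *\<^sub>R e else 0)"
proof -
  let ?d = "real CARD('n)"
  \<comment> \<open>The vector from the opposite vertex to the barycentre of \<open>S\<close> has
    inner product \<open>d vol T\<close> with the area normal, which the factor normalises. The
    weight \<open>\<epsilon> T\<close> allows opposite signs on the two elements at
    \<open>S\<close>.\<close>
  define a where "a T = (if S facet_of T then (\<epsilon> T / (?d * vol T)) *\<^sub>R e else 0)" for T
  define C where "C T = a T \<otimes>\<^sub>v (ctr T - apex T S)" for T
  obtain \<tau> where "pwrt \<tau> C a" using pwrt_exists by blast
  moreover have "flux C a T S' = (if S' = S then \<epsilon> T *\<^sub>R e else 0)" if T: "T \<in> \<T>" "S' facet_of T" for T S'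
  proof (cases "S facet_of T")
    case True
    have "C T + a T \<otimes>\<^sub>v (sctr S' - ctr T) = a T \<otimes>\<^sub>v (sctr S' - apex T S)"
      unfolding C_def linear_add[OF linear_outer, symmetric] by simp
    then have f: "flux C a T S' = ((sctr S' - apex T S) \<bullet> area_normal T S') *\<^sub>R a T"
      by (simp add: flux_def outer_mul_vec)
    have "bgrad (verts T) (apex T S') \<bullet> (sctr S' - apex T S) = - bary (verts T) (apex T S') (apex T S)"
      using sctr_bgrad[OF T(1) T(2) T(2)] by (simp add: bary_diff[symmetric])
    also have "bary (verts T) (apex T S') (apex T S) = (if S' = S then 1 else 0)"
      using full_simplex.bary_vertex[OF full_simplex_elt[OF T(1)] apex(1)[OF T] apex(1)[OF T(1) True]]
        apex(2)[OF T] apex(2)[OF T(1) True] by (metis (full_types))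
    finally have "(sctr S' - apex T S) \<bullet> area_normal T S' = (if S' = S then ?d * vol T else 0)"
      by (simp add: area_normal_def inner_commute)
    then show ?thesis
      unfolding f using True vol_pos[OF T(1)] by (simp add: a_def)
  next
    case False
    then have "a T = 0" "S' \<noteq> S" using T by (auto simp: a_def)
    then show ?thesis by (simp add: flux_def C_def linear_0[OF linear_outer_left])
  qed
  ultimately show thesis by (rule that)
qed

text \<open>The basis function of a side is taken in the direction of the residual flux there, so
  that orthogonality yields the squared norm of the residual. Dirichlet sides are left out: their
  basis functions are not in \<open>CR_D\<close>, and no flux condition is imposed there.\<close>

lemma RT_N_of_orthogonal:
  assumes \<tau>: "pwrt \<tau> C a"
    and orth: "\<And>v b A. pwaff v b A \<Longrightarrow> v \<in> CR_D \<T> \<Gamma>D \<Longrightarrow> msum (\<lambda>T. A T \<bullet> C T + CARD('n) * (a T \<bullet> b T)) = 0"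
  shows "\<tau> \<in> RT_N \<Omega> \<T> \<Gamma>N"
proof -
  have key: "(\<Sum>T\<in>{T \<in> \<T>. S facet_of T}. flux C a T S) = 0"
    if T: "T \<in> \<T>" "S facet_of T" and S: "\<not> S \<subseteq> closure \<Gamma>D" for T S
  proof -
    let ?e = "\<Sum>T\<in>{T \<in> \<T>. S facet_of T}. flux C a T S"
    obtain v b A where v: "pwaff v b A"
      and val: "\<And>T S'. T \<in> \<T> \<Longrightarrow> S' facet_of T \<Longrightarrow> side_val b A T S' = (if S' = S then ?e else 0)"
      by (rule CR_basis[of S ?e]) (rule that)
    have "v \<in> CR_D \<T> \<Gamma>D"
      unfolding CR_D_iff[OF v] using S val by auto
    from orth[OF v this] have "0 = (\<Sum>T\<in>{T \<in> \<T>. S facet_of T}. side_val b A T S \<bullet> flux C a T S)"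
      unfolding integration_by_parts using sum_sides_single[OF T, of "\<lambda>T S. side_val b A T S \<bullet> flux C a T S"] val by simp
    also have "\<dots> = ?e \<bullet> ?e"
      using val by (simp add: inner_sum_right)
    finally show ?thesis by simp
  qed
  show ?thesis
    unfolding RT_N_iff[OF \<tau>]
  proof (intro conjI ballI allI impI)
    fix T T' S assume T: "T \<in> \<T>" "T' \<in> \<T>" "T \<noteq> T' \<and> S facet_of T \<and> S facet_of T'"
    then have "\<not> S \<subseteq> closure \<Gamma>D"
      using shared_side_not_boundary[of T T' S] closure_parts(1) by blast
    then have "(\<Sum>T\<in>{T, T'}. flux C a T S) = 0"
      using key[of T S] elements_at_side[of T T' S] T by simp
    then show "flux C a T S + flux C a T' S = 0" using T by simp
  next
    fix T S assume T: "T \<in> \<T>" "S facet_of T \<and> S \<subseteq> closure \<Gamma>N"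
    then have "S \<subseteq> frontier \<Omega>" using closure_parts(2) by blast
    then have "{T \<in> \<T>. S facet_of T} = {T}" using boundary_side_unshared T by blast
    then show "flux C a T S = 0"
      using key[of T S] not_Dirichlet_and_Neumann[of T S] T by simp
  qed
qed

text \<open>As for fluxes, each side is tested with its own residual. The weights
  \<open>\<epsilon>\<close> have opposite signs on neighbours, which makes the test field admissible
  and the residual a jump.\<close>

lemma CR_D_of_orthogonal:
  assumes v: "pwaff v b A"
    and orth: "\<And>\<tau> C a. pwrt \<tau> C a \<Longrightarrow> \<tau> \<in> RT_N \<Omega> \<T> \<Gamma>N \<Longrightarrow> msum (\<lambda>T. A T \<bullet> C T + CARD('n) * (a T \<bullet> b T)) = 0"
  shows "v \<in> CR_D \<T> \<Gamma>D"
proof -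
  have key: "(\<Sum>T\<in>{T \<in> \<T>. S facet_of T}. \<epsilon> T *\<^sub>R side_val b A T S) = 0"
    if T: "T \<in> \<T>" "S facet_of T" and S: "\<not> S \<subseteq> closure \<Gamma>N"
      and \<epsilon>: "\<And>T T'. T \<in> \<T> \<Longrightarrow> T' \<in> \<T> \<Longrightarrow> T \<noteq> T' \<Longrightarrow> S facet_of T \<Longrightarrow> S facet_of T' \<Longrightarrow> \<epsilon> T + \<epsilon> T' = 0"
    for T S and \<epsilon> :: "(real^'n) set \<Rightarrow> real"
  proof -
    let ?e = "\<Sum>T\<in>{T \<in> \<T>. S facet_of T}. \<epsilon> T *\<^sub>R side_val b A T S"
    obtain \<tau> C a where \<tau>: "pwrt \<tau> C a"
      and val: "\<And>T S'. T \<in> \<T> \<Longrightarrow> S' facet_of T \<Longrightarrow> flux C a T S' = (if S' = S then \<epsilon> T *\<^sub>R ?e else 0)"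
      by (rule RT_basis[of S \<epsilon> ?e]) (rule that)
    have "\<tau> \<in> RT_N \<Omega> \<T> \<Gamma>N"
      unfolding RT_N_iff[OF \<tau>] using S val \<epsilon> by (auto simp: scaleR_add_left[symmetric])
    from orth[OF \<tau> this] have "0 = (\<Sum>T\<in>{T \<in> \<T>. S facet_of T}. side_val b A T S \<bullet> flux C a T S)"
      unfolding integration_by_parts using sum_sides_single[OF T, of "\<lambda>T S. side_val b A T S \<bullet> flux C a T S"] val by simp
    also have "\<dots> = (\<Sum>T\<in>{T \<in> \<T>. S facet_of T}. (\<epsilon> T *\<^sub>R side_val b A T S) \<bullet> ?e)"
      using val by (intro sum.cong) auto
    also have "\<dots> = ?e \<bullet> ?e"
      by (simp only: inner_sum_left)
    finally show ?thesis by simp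
  qed
  show ?thesis
    unfolding CR_D_iff[OF v]
  proof (intro conjI ballI allI impI)
    fix T T' S assume T: "T \<in> \<T>" "T' \<in> \<T>" "T \<noteq> T' \<and> S facet_of T \<and> S facet_of T'"
    then have "\<not> S \<subseteq> closure \<Gamma>N"
      using shared_side_not_boundary[of T T' S] closure_parts(2) by blast
    moreover have pair: "{T \<in> \<T>. S facet_of T} = {T, T'}" using elements_at_side T by blast
    moreover define \<epsilon> where "\<epsilon> = (\<lambda>X. if X = T then 1 else -1 :: real)"
    have "\<epsilon> X + \<epsilon> X' = 0" if "X \<in> \<T>" "X' \<in> \<T>" "X \<noteq> X'" "S facet_of X" "S facet_of X'" for X X'
    proof -
      have "X \<in> {T, T'}" "X' \<in> {T, T'}" unfolding pair[symmetric] using that by blast+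
      with that(3) T(3) show ?thesis by (auto simp: \<epsilon>_def)
    qed
    ultimately have "(\<Sum>X\<in>{T, T'}. \<epsilon> X *\<^sub>R side_val b A X S) = 0"
      using key[of T S \<epsilon>] T by metis
    moreover have "T' \<noteq> T" using T(3) by blast
    ultimately show "side_val b A T S = side_val b A T' S" by (simp add: \<epsilon>_def)
  next
    fix T S assume T: "T \<in> \<T>" "S facet_of T \<and> S \<subseteq> closure \<Gamma>D"
    then have "S \<subseteq> frontier \<Omega>" using closure_parts(1) by blast
    then have un: "{T \<in> \<T>. S facet_of T} = {T}" using boundary_side_unshared T by blast
    \<comment> \<open>A Dirichlet side belongs to one element only, so the weight 1 meets the sign
      condition vacuously.\<close>
    have "(\<Sum>T\<in>{T \<in> \<T>. S facet_of T}. 1 *\<^sub>R side_val b A T S) = 0"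
    proof (rule key)
      show "\<not> S \<subseteq> closure \<Gamma>N" using not_Dirichlet_and_Neumann T by blast
      show "1 + 1 = (0::real)" if "X \<in> \<T>" "X' \<in> \<T>" "X \<noteq> X'" "S facet_of X" "S facet_of X'" for X X'
        using that un by blast
    qed (use T in auto)
    then show "side_val b A T S = 0" unfolding un by simp
  qed
qed

text \<open>Without gradients, all side values on an element are equal. The value 0 starts at an
  element with a Dirichlet side and spreads across shared sides.\<close>

lemma CR_D_piecewise_constant:
  assumes v: "pwaff v b A" "v \<in> CR_D \<T> \<Gamma>D" and A: "\<And>T. T \<in> \<T> \<Longrightarrow> A T = 0" and "T \<in> \<T>"
  shows "b T = 0"
proof -
  have val: "side_val b A T S = b T" if "T \<in> \<T>" for T S using A[OF that] by (simp add: side_val_def)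
  obtain T0 S where "T0 \<in> \<T>" "S facet_of T0" "S \<subseteq> closure \<Gamma>D" by (rule Dirichlet_side_exists)
  then have T0: "b T0 = 0" "T0 \<in> \<T>" using CR_D_Dirichlet[OF v, of T0 S] val by simp_all
  have "{T \<in> \<T>. b T = 0} = \<T>"
  proof (rule facet_connected)
    fix X X' S assume "X \<in> {T \<in> \<T>. b T = 0}" "X' \<in> \<T>" "X \<noteq> X'" "S facet_of X" "S facet_of X'"
    then show "X' \<in> {T \<in> \<T>. b T = 0}" using CR_D_shared[OF v, of X X' S] val by simp
  qed (use T0 in auto)
  then show ?thesis using assms(4) by blast
qed

text \<open>The flux of \<open>q\<close> times the identity is \<open>q\<close> times the nonzero
  area normal, so \<open>q\<close> agrees across shared sides and is 0 at a Neumann side. Without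
  Neumann sides a constant multiple of the identity survives, the freedom that the normalisation of
  the stress removes.\<close>

lemma RT_N_piecewise_spherical:
  assumes \<tau>: "pwrt \<tau> C a" "\<tau> \<in> RT_N \<Omega> \<T> \<Gamma>N"
    and C: "\<And>T. T \<in> \<T> \<Longrightarrow> C T = q T *\<^sub>R mat 1" "\<And>T. T \<in> \<T> \<Longrightarrow> a T = 0"
  shows "\<exists>c. (\<forall>T\<in>\<T>. q T = c) \<and> (\<Gamma>N \<noteq> {} \<longrightarrow> c = 0)"
proof -
  have flux: "flux C a T S = q T *\<^sub>R area_normal T S" if "T \<in> \<T>" for T S
    using C[OF that] by (simp add: flux_def linear_0[OF linear_outer_left] scaleR_matrix_vector_assoc[symmetric])
  obtain T0 where T0: "T0 \<in> \<T>" using Dirichlet_side_exists by blast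
  have "{T \<in> \<T>. q T = q T0} = \<T>"
  proof (rule facet_connected)
    fix X X' S assume X: "X \<in> {T \<in> \<T>. q T = q T0}" "X' \<in> \<T>" "X \<noteq> X'" "S facet_of X" "S facet_of X'"
    then have "flux C a X S + flux C a X' S = 0" using RT_N_shared[OF \<tau>, of X X' S] by simp
    then have "(q X - q X') *\<^sub>R area_normal X S = 0"
      using X flux area_normal_shared[of X X' S] by (simp add: scaleR_diff_left)
    then have "q X = q X'" using area_normal_nonzero X by auto
    then show "X' \<in> {T \<in> \<T>. q T = q T0}" using X by simp
  qed (use T0 in auto)
  then have all: "q T = q T0" if "T \<in> \<T>" for T using that by blast
  moreover have "q T0 = 0" if ne: "\<Gamma>N \<noteq> {}"
  proof -
    obtain T S where T: "T \<in> \<T>" "S facet_of T" "S \<subseteq> closure \<Gamma>N" using ne by (rule Neumann_side_exists)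
    then have "q T *\<^sub>R area_normal T S = 0" using RT_N_Neumann[OF \<tau>, of T S] flux by simp
    then show ?thesis using area_normal_nonzero T all by auto
  qed
  ultimately show ?thesis by blast
qed

end

section \<open>Matrix identities\<close>

lemma nonpos_of_mult_nonpos: "c * x \<le> 0 \<Longrightarrow> 0 < c \<Longrightarrow> x \<le> (0 :: real)"
  by (simp add: mult_le_0_iff)

lemma inner_mat_1: "A \<bullet> mat 1 = trace (A :: real^'n^'n)"
  by (simp add: inner_vec_def trace_def mat_def if_distrib cong: if_cong)

lemma trace_scaleR: "trace (c *\<^sub>R A) = c * trace (A :: real^'n^'n)"
  by (simp add: trace_def sum_distrib_left)

lemma trace_mat_1: "trace (mat 1 :: real^'n^'n) = CARD('n)"
  by (simp add: trace_def mat_def)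

lemma trace_outer: "trace (a \<otimes>\<^sub>v y) = a \<bullet> y"
  by (simp add: trace_def outer_def inner_vec_def)

lemma linear_dev: "linear dev"
  by (intro linearI) (simp_all add: dev_def trace_add trace_scaleR add_divide_distrib algebra_simps)

lemmas dev_add = linear_add[OF linear_dev] and dev_diff = linear_diff[OF linear_dev]
  and dev_scaleR = linear_cmul[OF linear_dev]

lemma trace_dev: "trace (dev A) = 0"
  by (simp add: dev_def trace_sub trace_scaleR trace_mat_1)

lemma dev_mat_1: "dev (mat 1) = 0"
  by (simp add: dev_def trace_mat_1)

lemma dev_trace_free: "trace A = 0 \<Longrightarrow> dev A = A"
  by (simp add: dev_def)

text \<open>\<open>dev M\<close> differs from \<open>M\<close> by a multiple of the identity, which
  is orthogonal to trace-free matrices.\<close>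

lemma inner_dev: "trace A = 0 \<Longrightarrow> A \<bullet> dev M = A \<bullet> M"
  by (simp add: dev_def inner_diff_right inner_mat_1)

context mesh
begin

section \<open>Operators and inner products in terms of coefficients\<close>

lemma gradh_pwaff: "pwaff v b A \<Longrightarrow> T \<in> \<T> \<Longrightarrow> x \<in> interior T \<Longrightarrow> gradh v x = A T"
  unfolding gradh_def by (rule jacobian_affine[OF pwaffD])

lemma divh_pwaff: "pwaff v b A \<Longrightarrow> T \<in> \<T> \<Longrightarrow> x \<in> interior T \<Longrightarrow> divh v x = trace (A T)"
  using gradh_pwaff by (simp add: divh_def gradh_def)

lemma \<Pi>h_pwaff: "pwaff v b A \<Longrightarrow> T \<in> \<T> \<Longrightarrow> x \<in> interior T \<Longrightarrow> \<Pi>h \<T> v x = b T"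
  by (rule \<Pi>h_affine[OF _ matrix_vector_mul_linear pwaffD])

lemma \<Pi>h_pwrt: "pwrt \<tau> C a \<Longrightarrow> T \<in> \<T> \<Longrightarrow> x \<in> interior T \<Longrightarrow> \<Pi>h \<T> \<tau> x = C T"
  by (rule \<Pi>h_affine[OF _ linear_outer pwrtD])

lemma \<Pi>h_id: "T \<in> \<T> \<Longrightarrow> x \<in> interior T \<Longrightarrow> \<Pi>h \<T> (\<lambda>y. y) x = ctr T"
  by (rule \<Pi>h_affine[OF _ linear_ident]) auto

text \<open>Row \<open>i\<close> has the Jacobian \<open>a T $ i\<close> times the identity, whose
  trace brings in the factor \<open>d\<close>.\<close>

lemma Divh_pwrt:
  assumes "pwrt \<tau> C a" "T \<in> \<T>" "x \<in> interior T"
  shows "Divh \<tau> x = real CARD('n) *\<^sub>R a T"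
proof -
  have "divh (\<lambda>y. \<tau> y $ i) x = real CARD('n) * a T $ i" for i
  proof -
    have "\<tau> y $ i = C T $ i + (a T $ i *\<^sub>R mat 1) *v (y - ctr T)" if "y \<in> interior T" for y
      using pwrtD[OF assms(1,2) that] by (simp add: outer_def vec_eq_iff scaleR_matrix_vector_assoc[symmetric])
    from jacobian_affine[OF this assms(3)] show ?thesis
      by (simp add: divh_def trace_scaleR trace_mat_1)
  qed
  then show ?thesis by (simp add: Divh_def vec_eq_iff)
qed

text \<open>The remainder \<open>l\<close> is meant for products of a constant and an affine field;
  centred at the barycentre, it integrates to zero.\<close>

lemma l2_inner_msum:
  assumes "\<And>T x. T \<in> \<T> \<Longrightarrow> x \<in> interior T \<Longrightarrow> v x \<bullet> w x = \<phi> T + l T \<bullet> (x - ctr T)"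
  shows "l2_inner \<Omega> v w = msum \<phi>"
  unfolding l2_inner_def msum_def by (rule integral_piecewise_affine[OF assms])

lemma l2_inner_const:
  assumes "\<And>T x. T \<in> \<T> \<Longrightarrow> x \<in> interior T \<Longrightarrow> v x \<bullet> w x = \<phi> T"
  shows "l2_inner \<Omega> v w = msum \<phi>"
  by (rule l2_inner_msum[where l = "\<lambda>_. 0"]) (simp add: assms)

lemma l2_norm_const:
  assumes "\<And>T x. T \<in> \<T> \<Longrightarrow> x \<in> interior T \<Longrightarrow> v x = D T"
  shows "(l2_norm \<Omega> v)\<^sup>2 = msum (\<lambda>T. D T \<bullet> D T)"
proof -
  have "l2_inner \<Omega> v v = msum (\<lambda>T. D T \<bullet> D T)" by (rule l2_inner_const) (simp add: assms)
  then show ?thesis by (simp add: l2_norm_def msum_nonneg)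
qed

lemma pwaff_add: "pwaff v b A \<Longrightarrow> pwaff w c B \<Longrightarrow> pwaff (\<lambda>x. v x + w x) (\<lambda>T. b T + c T) (\<lambda>T. A T + B T)"
  by (simp add: pwaff_def matrix_vector_mult_add_rdistrib)

lemma pwaff_diff: "pwaff v b A \<Longrightarrow> pwaff w c B \<Longrightarrow> pwaff (\<lambda>x. v x - w x) (\<lambda>T. b T - c T) (\<lambda>T. A T - B T)"
  by (simp add: pwaff_def matrix_vector_mult_diff_rdistrib)

lemma pwrt_diff: "pwrt v C a \<Longrightarrow> pwrt w B b \<Longrightarrow> pwrt (\<lambda>x. v x - w x) (\<lambda>T. C T - B T) (\<lambda>T. a T - b T)"
  by (simp add: pwrt_def linear_diff[OF linear_outer_left])

lemma CR_D_diff: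
  assumes v: "pwaff v b A" "v \<in> CR_D \<T> \<Gamma>D" and w: "pwaff w c B" "w \<in> CR_D \<T> \<Gamma>D"
  shows "(\<lambda>x. v x - w x) \<in> CR_D \<T> \<Gamma>D"
proof -
  have *: "side_val (\<lambda>T. b T - c T) (\<lambda>T. A T - B T) T S = side_val b A T S - side_val c B T S" for T S
    by (simp add: side_val_def matrix_vector_mult_diff_rdistrib)
  show ?thesis
    unfolding CR_D_iff[OF pwaff_diff[OF v(1) w(1)]] *
  proof (intro conjI ballI allI impI)
    fix T T' S assume "T \<in> \<T>" "T' \<in> \<T>" "T \<noteq> T' \<and> S facet_of T \<and> S facet_of T'"
    then show "side_val b A T S - side_val c B T S = side_val b A T' S - side_val c B T' S"
      using CR_D_shared[OF v, of T T' S] CR_D_shared[OF w, of T T' S] by simp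
  next
    fix T S assume "T \<in> \<T>" "S facet_of T \<and> S \<subseteq> closure \<Gamma>D"
    then show "side_val b A T S - side_val c B T S = 0"
      using CR_D_Dirichlet[OF v, of T S] CR_D_Dirichlet[OF w, of T S] by simp
  qed
qed

lemma RT_N_diff:
  assumes v: "pwrt v C a" "v \<in> RT_N \<Omega> \<T> \<Gamma>N" and w: "pwrt w B b" "w \<in> RT_N \<Omega> \<T> \<Gamma>N"
  shows "(\<lambda>x. v x - w x) \<in> RT_N \<Omega> \<T> \<Gamma>N"
proof -
  have *: "flux (\<lambda>T. C T - B T) (\<lambda>T. a T - b T) T S = flux C a T S - flux B b T S" for T S
    by (simp add: flux_def linear_diff[OF linear_outer_left] matrix_vector_mult_diff_rdistrib
        matrix_vector_mult_add_rdistrib)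
  show ?thesis
    unfolding RT_N_iff[OF pwrt_diff[OF v(1) w(1)]] *
  proof (intro conjI ballI allI impI)
    fix T T' S assume "T \<in> \<T>" "T' \<in> \<T>" "T \<noteq> T' \<and> S facet_of T \<and> S facet_of T'"
    then have "flux C a T S + flux C a T' S = 0" "flux B b T S + flux B b T' S = 0"
      using RT_N_shared[OF v, of T T' S] RT_N_shared[OF w, of T T' S] by simp_all
    then show "flux C a T S - flux B b T S + (flux C a T' S - flux B b T' S) = 0"
      by (simp add: algebra_simps eq_neg_iff_add_eq_0[symmetric])
  next
    fix T S assume "T \<in> \<T>" "S facet_of T \<and> S \<subseteq> closure \<Gamma>N"
    then show "flux C a T S - flux B b T S = 0"
      using RT_N_Neumann[OF v, of T S] RT_N_Neumann[OF w, of T S] by simp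
  qed
qed

end

section \<open>Reconstruction and optimality\<close>

text \<open>The coefficients of the data on the elements are parameters, so that both functionals
  become volume-weighted sums.\<close>

locale discrete_Stokes = mesh \<Omega> \<Gamma>D \<Gamma>N \<T>
  for \<Omega> \<Gamma>D \<Gamma>N :: "(real^'n) set" and \<T> +
  fixes \<nu> :: real and uD f :: "real^'n \<Rightarrow> real^'n" and F :: "real^'n \<Rightarrow> real^'n^'n"
    and bD fT :: "(real^'n) set \<Rightarrow> real^'n" and AD FT :: "(real^'n) set \<Rightarrow> real^'n^'n"
  assumes \<nu>: "0 < \<nu>"
    and uD: "pwaff uD bD AD" and divD: "\<And>T. T \<in> \<T> \<Longrightarrow> trace (AD T) = 0"
    and f: "\<And>T x. T \<in> \<T> \<Longrightarrow> x \<in> interior T \<Longrightarrow> f x = fT T"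
    and F: "\<And>T x. T \<in> \<T> \<Longrightarrow> x \<in> interior T \<Longrightarrow> F x = FT T"
begin

lemma pwrt_F_add: "pwrt \<sigma> C a \<Longrightarrow> pwrt (\<lambda>x. F x + \<sigma> x) (\<lambda>T. FT T + C T) a"
  using F by (simp add: pwrt_def add.assoc)

lemma K_u_iff:
  assumes "pwaff v b A"
  shows "v \<in> K_u \<Omega> \<T> \<Gamma>D \<longleftrightarrow> v \<in> CR_D \<T> \<Gamma>D \<and> (\<forall>T\<in>\<T>. trace (A T) = 0)"
proof -
  have "(AE x in lebesgue_on \<Omega>. divh v x = 0) \<longleftrightarrow> (\<forall>T\<in>\<T>. trace (A T) = 0)"
  proof
    assume ae: "AE x in lebesgue_on \<Omega>. divh v x = 0"
    show "\<forall>T\<in>\<T>. trace (A T) = 0"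
      using AE_constD[OF ae] divh_pwaff[OF assms] by metis
  qed (auto intro!: AE_interiorsI simp: divh_pwaff[OF assms])
  then show ?thesis by (simp add: K_u_def)
qed

lemma CR_D_pwaff: "v \<in> CR_D \<T> \<Gamma>D \<Longrightarrow> \<exists>b A. pwaff v b A"
  using Pk_1_iff_pwaff[of v] by (simp add: CR_D_def CR_def)

lemma K_T_I:
  assumes "pwrt \<sigma> C a" "\<sigma> \<in> RT_N \<Omega> \<T> \<Gamma>N" "\<And>T. T \<in> \<T> \<Longrightarrow> real CARD('n) *\<^sub>R a T = - fT T"
  shows "(\<lambda>x. F x + \<sigma> x) \<in> K_T \<Omega> \<T> \<Gamma>N f F"
  unfolding K_T_def shifted_RT_N_def
  using assms(2,3) by (auto intro!: AE_interiorsI simp: Divh_pwrt[OF assms(1)] f)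

lemma K_T_E:
  assumes "\<tau> \<in> K_T \<Omega> \<T> \<Gamma>N f F"
  obtains \<sigma> C a where "\<tau> = (\<lambda>x. F x + \<sigma> x)" "\<sigma> \<in> RT_N \<Omega> \<T> \<Gamma>N" "pwrt \<sigma> C a"
    "\<And>T. T \<in> \<T> \<Longrightarrow> real CARD('n) *\<^sub>R a T = - fT T"
proof -
  obtain \<sigma> where \<sigma>: "\<tau> = (\<lambda>x. F x + \<sigma> x)" "\<sigma> \<in> RT_N \<Omega> \<T> \<Gamma>N"
    and ae: "AE x in lebesgue_on \<Omega>. Divh (\<lambda>y. \<tau> y - F y) x = - f x"
    using assms unfolding K_T_def shifted_RT_N_def by blast
  have "\<sigma> \<in> RT \<T>" using \<sigma>(2) by (simp add: RT_N_def)
  from RT_pwrt[OF this] obtain C a where Ca: "pwrt \<sigma> C a" by (elim exE) (rule that)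
  have ae': "AE x in lebesgue_on \<Omega>. Divh \<sigma> x = - f x" using ae by (simp add: \<sigma>(1))
  have "real CARD('n) *\<^sub>R a T = - fT T" if T: "T \<in> \<T>" for T
    by (rule AE_constD[OF ae' T]) (simp add: Divh_pwrt[OF Ca T] f[OF T])
  with \<sigma> Ca show thesis by (rule that)
qed

lemma I_h_eq:
  assumes v: "pwaff v b A" "v \<in> K_u \<Omega> \<T> \<Gamma>D"
  shows "I_h \<Omega> \<T> \<Gamma>D \<nu> f F uD v
    = ereal (msum (\<lambda>T. \<nu> / 2 * ((A T + AD T) \<bullet> (A T + AD T)) - fT T \<bullet> b T - FT T \<bullet> A T))"
proof -
  have "(l2_norm \<Omega> (gradh (\<lambda>x. v x + uD x)))\<^sup>2 = msum (\<lambda>T. (A T + AD T) \<bullet> (A T + AD T))"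
    by (rule l2_norm_const) (rule gradh_pwaff[OF pwaff_add[OF v(1) uD]])
  moreover have "l2_inner \<Omega> f (\<Pi>h \<T> v) = msum (\<lambda>T. fT T \<bullet> b T)"
    by (rule l2_inner_const) (simp add: f \<Pi>h_pwaff[OF v(1)])
  moreover have "l2_inner \<Omega> F (gradh v) = msum (\<lambda>T. FT T \<bullet> A T)"
    by (rule l2_inner_const) (simp add: F gradh_pwaff[OF v(1)])
  ultimately show ?thesis
    using v(2) unfolding I_h_def by (simp only: if_True msum_diff msum_cmul)
qed

lemma D_h_eq:
  assumes \<tau>: "pwrt \<tau> C a" "\<tau> \<in> K_T \<Omega> \<T> \<Gamma>N f F"
  shows "D_h \<Omega> \<T> \<Gamma>N \<nu> f F uD \<tau>
    = ereal (msum (\<lambda>T. - (1 / (2 * \<nu>)) * (dev (C T) \<bullet> dev (C T)) + dev (C T) \<bullet> AD T))"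
proof -
  have "(l2_norm \<Omega> (\<lambda>x. dev (\<Pi>h \<T> \<tau> x)))\<^sup>2 = msum (\<lambda>T. dev (C T) \<bullet> dev (C T))"
    by (rule l2_norm_const) (simp add: \<Pi>h_pwrt[OF \<tau>(1)])
  moreover have "l2_inner \<Omega> (\<lambda>x. dev (\<Pi>h \<T> \<tau> x)) (gradh uD) = msum (\<lambda>T. dev (C T) \<bullet> AD T)"
    by (rule l2_inner_const) (simp add: \<Pi>h_pwrt[OF \<tau>(1)] gradh_pwaff[OF uD])
  ultimately show ?thesis
    using \<tau>(2) unfolding D_h_def by (simp only: if_True msum_add msum_cmul)
qed

text \<open>In the uses, \<open>\<rho>\<close> is the linear term of an expansion around the
  candidate and \<open>\<xi>\<close> the squared deviation; \<open>c\<close> is negative for the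
  dual functional and positive for the primal one.\<close>

lemma msum_energy_split:
  assumes "\<And>T. T \<in> \<T> \<Longrightarrow> \<phi> T = \<psi> T + \<rho> T + c * \<xi> T" "msum \<rho> = 0"
  shows "msum \<phi> = msum \<psi> + c * msum \<xi>"
proof -
  have "msum \<phi> = msum (\<lambda>T. \<psi> T + \<rho> T + c * \<xi> T)" by (rule msum_cong) (rule assms(1))
  then show ?thesis using assms(2) by (simp add: msum_add msum_cmul)
qed

text \<open>For the reconstructed stress \<open>dev C = \<nu> (Au + AD)\<close>, so the derivative
  of the dual functional there is \<open>- Au\<close>. By the discrete integration by parts,
  \<open>Au\<close> is orthogonal to differences of admissible stresses.\<close>

lemma dual_from_primal:
  assumes u: "primal_solution \<Omega> \<T> \<Gamma>D \<nu> f F uD u"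
    and p: "primal_multiplier \<Omega> \<T> \<Gamma>D \<Gamma>N \<nu> f F uD u p"
  defines "T\<^sub>h \<equiv> \<lambda>x. \<nu> *\<^sub>R gradh (\<lambda>y. u y + uD y) x - p x *\<^sub>R mat 1
                   - (1 / real CARD('n)) *\<^sub>R (f x \<otimes>\<^sub>v (x - \<Pi>h \<T> (\<lambda>y. y) x))"
  shows "dual_solution \<Omega> \<T> \<Gamma>N \<nu> f F uD T\<^sub>h"
    and "dual_solution \<Omega> \<T> \<Gamma>N \<nu> f F uD T \<Longrightarrow> AE x in lebesgue_on \<Omega>. T x = T\<^sub>h x"
proof -
  let ?d = "real CARD('n)"
  have uK: "u \<in> K_u \<Omega> \<T> \<Gamma>D" using u by (simp add: primal_solution_def)
  then have uCR: "u \<in> CR_D \<T> \<Gamma>D" by (simp add: K_u_def)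
  then obtain bu Au where Au: "pwaff u bu Au" using CR_D_pwaff by blast
  have trAu: "trace (Au X) = 0" if "X \<in> \<T>" for X using uK that K_u_iff[OF Au] by blast
  obtain pT where pT: "\<And>X x. X \<in> \<T> \<Longrightarrow> x \<in> interior X \<Longrightarrow> p x = pT X"
    using p unfolding primal_multiplier_def Pk_0_iff by metis
  have p': "l2_inner \<Omega> (\<lambda>x. \<nu> *\<^sub>R gradh (\<lambda>y. u y + uD y) x - p x *\<^sub>R mat 1) (gradh v)
        = l2_inner \<Omega> f v + l2_inner \<Omega> F (gradh v)" if "v \<in> CR_D \<T> \<Gamma>D" for v
    using p that unfolding primal_multiplier_def by blast
  define C where "C X = \<nu> *\<^sub>R (Au X + AD X) - pT X *\<^sub>R mat 1" for X
  \<comment> \<open>The factor \<open>1 / d\<close> makes the divergence \<open>d a\<close> equal to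
    \<open>- fT\<close>.\<close>
  define a where "a X = - ((1 / ?d) *\<^sub>R fT X)" for X
  have da: "?d *\<^sub>R a X = - fT X" for X by (simp add: a_def)
  have Th: "pwrt T\<^sub>h C a"
    unfolding pwrt_def T\<^sub>h_def
    by (simp add: gradh_pwaff[OF pwaff_add[OF Au uD]] pT f \<Pi>h_id C_def a_def
        linear_neg[OF linear_outer_left] linear_cmul[OF linear_outer_left])
  define \<sigma> where "\<sigma> x = T\<^sub>h x - F x" for x
  have \<sigma>: "pwrt \<sigma> (\<lambda>X. C X - FT X) a"
    using Th F by (simp add: pwrt_def \<sigma>_def)
  have ThF: "T\<^sub>h = (\<lambda>x. F x + \<sigma> x)" by (simp add: \<sigma>_def)
  have \<sigma>RT: "\<sigma> \<in> RT_N \<Omega> \<T> \<Gamma>N"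
  proof (rule RT_N_of_orthogonal[OF \<sigma>])
    fix v b A assume v: "pwaff v b A" "v \<in> CR_D \<T> \<Gamma>D"
    have "l2_inner \<Omega> (\<lambda>x. \<nu> *\<^sub>R gradh (\<lambda>y. u y + uD y) x - p x *\<^sub>R mat 1) (gradh v) = msum (\<lambda>X. C X \<bullet> A X)"
      by (rule l2_inner_const) (simp add: gradh_pwaff[OF pwaff_add[OF Au uD]] gradh_pwaff[OF v(1)] pT C_def)
    \<comment> \<open>On an element \<open>f \<bullet> v\<close> is affine, and its centred linear
      part integrates to zero; so \<open>v\<close> may be replaced by its mean.\<close>
    moreover have "l2_inner \<Omega> f v = msum (\<lambda>X. fT X \<bullet> b X)"
      by (rule l2_inner_msum[where l = "\<lambda>X. fT X v* A X"])
        (simp add: f pwaffD[OF v(1)] inner_add_right dot_lmul_matrix)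
    moreover have "l2_inner \<Omega> F (gradh v) = msum (\<lambda>X. FT X \<bullet> A X)"
      by (rule l2_inner_const) (simp add: F gradh_pwaff[OF v(1)])
    ultimately have eq: "msum (\<lambda>X. C X \<bullet> A X) = msum (\<lambda>X. fT X \<bullet> b X) + msum (\<lambda>X. FT X \<bullet> A X)"
      using p'[OF v(2)] by simp
    have "A X \<bullet> (C X - FT X) + ?d * (a X \<bullet> b X) = C X \<bullet> A X - fT X \<bullet> b X - FT X \<bullet> A X" for X
      unfolding inner_scaleR_left[symmetric] da by (simp add: inner_diff_right inner_commute)
    then show "msum (\<lambda>X. A X \<bullet> (C X - FT X) + ?d * (a X \<bullet> b X)) = 0"
      using eq by (simp add: msum_diff)
  qed
  have ThK: "T\<^sub>h \<in> K_T \<Omega> \<T> \<Gamma>N f F"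
    unfolding ThF by (rule K_T_I[OF \<sigma> \<sigma>RT da])
  have devC: "dev (C X) = \<nu> *\<^sub>R (Au X + AD X)" if "X \<in> \<T>" for X
    using trAu[OF that] divD[OF that]
    by (simp add: C_def dev_diff dev_scaleR dev_mat_1 dev_trace_free trace_add)
  define E where "E C' X = dev (C' X) - dev (C X)" for C' X
  have split: "D_h \<Omega> \<T> \<Gamma>N \<nu> f F uD (\<lambda>x. F x + \<sigma>' x)
      = ereal (msum (\<lambda>X. - (1 / (2 * \<nu>)) * (dev (C X) \<bullet> dev (C X)) + dev (C X) \<bullet> AD X)
          - 1 / (2 * \<nu>) * msum (\<lambda>X. E (\<lambda>X. FT X + C' X) X \<bullet> E (\<lambda>X. FT X + C' X) X))"
    if \<sigma>': "\<sigma>' \<in> RT_N \<Omega> \<T> \<Gamma>N" "pwrt \<sigma>' C' a'" "\<And>X. X \<in> \<T> \<Longrightarrow> ?d *\<^sub>R a' X = - fT X" for \<sigma>' C' a'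
  proof -
    let ?C = "\<lambda>X. FT X + C' X" and ?E = "\<lambda>X. E (\<lambda>X. FT X + C' X) X"
    \<comment> \<open>Two stresses of equal divergence, both tested with \<open>u\<close>: the
      divergence terms cancel. As \<open>Au\<close> is trace-free, the remaining difference of means
      may be replaced by its deviator.\<close>
    have "msum (\<lambda>X. Au X \<bullet> C' X + ?d * (a' X \<bullet> bu X)) - msum (\<lambda>X. Au X \<bullet> (C X - FT X) + ?d * (a X \<bullet> bu X)) = 0"
      using discrete_integration_by_parts[OF Au uCR \<sigma>'(2,1)] discrete_integration_by_parts[OF Au uCR \<sigma> \<sigma>RT] by simp
    also have "msum (\<lambda>X. Au X \<bullet> C' X + ?d * (a' X \<bullet> bu X)) - msum (\<lambda>X. Au X \<bullet> (C X - FT X) + ?d * (a X \<bullet> bu X))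
        = msum (\<lambda>X. Au X \<bullet> ?E X)"
      unfolding msum_diff[symmetric]
    proof (rule msum_cong)
      fix X assume X: "X \<in> \<T>"
      have "Au X \<bullet> ?E X = Au X \<bullet> (FT X + C' X) - Au X \<bullet> C X"
        by (simp add: E_def inner_diff_right inner_dev[OF trAu[OF X]])
      moreover have "?d * (a' X \<bullet> bu X) = ?d * (a X \<bullet> bu X)"
        unfolding inner_scaleR_left[symmetric] \<sigma>'(3)[OF X] da ..
      ultimately show "Au X \<bullet> C' X + ?d * (a' X \<bullet> bu X) - (Au X \<bullet> (C X - FT X) + ?d * (a X \<bullet> bu X)) = Au X \<bullet> ?E X"
        by (simp add: inner_add_right inner_diff_right)
    qed
    finally have 0: "msum (\<lambda>X. - (Au X \<bullet> ?E X)) = 0" by (simp add: msum_minus)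
    have "msum (\<lambda>X. - (1 / (2 * \<nu>)) * (dev (?C X) \<bullet> dev (?C X)) + dev (?C X) \<bullet> AD X)
        = msum (\<lambda>X. - (1 / (2 * \<nu>)) * (dev (C X) \<bullet> dev (C X)) + dev (C X) \<bullet> AD X)
          + (- (1 / (2 * \<nu>))) * msum (\<lambda>X. ?E X \<bullet> ?E X)"
    proof (rule msum_energy_split[OF _ 0])
      fix X assume X: "X \<in> \<T>"
      have C': "dev (?C X) = dev (C X) + ?E X" by (simp add: E_def)
      have "- (1 / (2 * \<nu>)) * (dev (?C X) \<bullet> dev (?C X))
          = - (1 / (2 * \<nu>)) * (dev (C X) \<bullet> dev (C X)) - (1 / \<nu>) * (dev (C X) \<bullet> ?E X) - (1 / (2 * \<nu>)) * (?E X \<bullet> ?E X)"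
        unfolding C' by (simp add: inner_add_left inner_add_right inner_commute distrib_left add_divide_distrib)
      \<comment> \<open>The \<open>AD\<close> part of this product cancels the change of the
        boundary-data term of the functional, which leaves \<open>- Au\<close> paired with the
        deviation as the linear term.\<close>
      also have "(1 / \<nu>) * (dev (C X) \<bullet> ?E X) = (Au X + AD X) \<bullet> ?E X"
        using \<nu> by (simp add: devC[OF X])
      also have "(Au X + AD X) \<bullet> ?E X = Au X \<bullet> ?E X + AD X \<bullet> ?E X" by (rule inner_add_left)
      moreover have "dev (?C X) \<bullet> AD X = dev (C X) \<bullet> AD X + AD X \<bullet> ?E X"
        unfolding C' by (simp only: inner_add_left inner_commute[of "?E X"])
      ultimately show "- (1 / (2 * \<nu>)) * (dev (?C X) \<bullet> dev (?C X)) + dev (?C X) \<bullet> AD X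
          = - (1 / (2 * \<nu>)) * (dev (C X) \<bullet> dev (C X)) + dev (C X) \<bullet> AD X + - (Au X \<bullet> ?E X)
            + - (1 / (2 * \<nu>)) * (?E X \<bullet> ?E X)"
        by linarith
    qed
    then show ?thesis
      using D_h_eq[OF pwrt_F_add[OF \<sigma>'(2)] K_T_I[OF \<sigma>'(2,1,3)]] by simp
  qed
  have Dh: "D_h \<Omega> \<T> \<Gamma>N \<nu> f F uD T\<^sub>h
      = ereal (msum (\<lambda>X. - (1 / (2 * \<nu>)) * (dev (C X) \<bullet> dev (C X)) + dev (C X) \<bullet> AD X))"
    by (rule D_h_eq[OF Th ThK])
  have opt: "D_h \<Omega> \<T> \<Gamma>N \<nu> f F uD \<tau> \<le> D_h \<Omega> \<T> \<Gamma>N \<nu> f F uD T\<^sub>h" for \<tau>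
  proof (cases "\<tau> \<in> K_T \<Omega> \<T> \<Gamma>N f F")
    case True
    then obtain \<sigma>' C' a' where \<sigma>': "\<tau> = (\<lambda>x. F x + \<sigma>' x)" "\<sigma>' \<in> RT_N \<Omega> \<T> \<Gamma>N" "pwrt \<sigma>' C' a'"
      "\<And>X. X \<in> \<T> \<Longrightarrow> ?d *\<^sub>R a' X = - fT X" by (rule K_T_E) blast
    have "D_h \<Omega> \<T> \<Gamma>N \<nu> f F uD \<tau>
        = ereal (msum (\<lambda>X. - (1 / (2 * \<nu>)) * (dev (C X) \<bullet> dev (C X)) + dev (C X) \<bullet> AD X)
          - 1 / (2 * \<nu>) * msum (\<lambda>X. E (\<lambda>X. FT X + C' X) X \<bullet> E (\<lambda>X. FT X + C' X) X))"
      unfolding \<sigma>'(1) by (rule split[OF \<sigma>'(2-4)])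
    moreover have "0 \<le> 1 / (2 * \<nu>) * msum (\<lambda>X. E (\<lambda>X. FT X + C' X) X \<bullet> E (\<lambda>X. FT X + C' X) X)"
      using \<nu> by (intro mult_nonneg_nonneg msum_nonneg) auto
    ultimately show ?thesis unfolding Dh by simp
  next
    case False
    then show ?thesis by (simp add: D_h_def)
  qed
  have tr_int: "integral \<Omega> (\<lambda>x. trace (\<tau> x)) = msum (\<lambda>X. trace (B X))" if "pwrt \<tau> B b" for \<tau> B b
    unfolding msum_def
    by (rule integral_piecewise_affine[where l = b]) (simp add: pwrtD[OF that] trace_add trace_outer)
  \<comment> \<open>The gradients are trace-free, so the trace integral of the stress is
    \<open>- d\<close> times the integral of the pressure.\<close>
  have norm: "integral \<Omega> (\<lambda>x. trace (T\<^sub>h x)) = 0" if "\<Gamma>N = {}"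
  proof -
    have "integral \<Omega> p = msum pT"
      unfolding msum_def by (rule integral_piecewise_affine[where l = "\<lambda>_. 0"]) (simp add: pT)
    then have "msum pT = 0" using p that by (simp add: primal_multiplier_def)
    moreover have "msum (\<lambda>X. trace (C X)) = msum (\<lambda>X. (- ?d) * pT X)"
      by (rule msum_cong) (simp add: C_def trace_sub trace_add trace_scaleR trace_mat_1 trAu divD)
    ultimately show ?thesis by (simp only: tr_int[OF Th] msum_cmul)
  qed
  show dual: "dual_solution \<Omega> \<T> \<Gamma>N \<nu> f F uD T\<^sub>h"
    unfolding dual_solution_def using ThK opt norm by blast
  show "AE x in lebesgue_on \<Omega>. T x = T\<^sub>h x" if T: "dual_solution \<Omega> \<T> \<Gamma>N \<nu> f F uD T"
  proof -
    have "T \<in> K_T \<Omega> \<T> \<Gamma>N f F" using T by (simp add: dual_solution_def)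
    then obtain \<sigma>' C' a' where \<sigma>': "T = (\<lambda>x. F x + \<sigma>' x)" "\<sigma>' \<in> RT_N \<Omega> \<T> \<Gamma>N" "pwrt \<sigma>' C' a'"
      "\<And>X. X \<in> \<T> \<Longrightarrow> ?d *\<^sub>R a' X = - fT X" by (rule K_T_E) blast
    let ?E = "\<lambda>X. E (\<lambda>X. FT X + C' X) X"
    have "T\<^sub>h \<in> shifted_RT_N \<Omega> \<T> \<Gamma>N F" using ThK by (simp add: K_T_def)
    \<comment> \<open>A second maximiser has at least the value of the reconstructed one, which
      leaves no room for the squared deviation.\<close>
    then have "D_h \<Omega> \<T> \<Gamma>N \<nu> f F uD T\<^sub>h \<le> D_h \<Omega> \<T> \<Gamma>N \<nu> f F uD T"
      using T by (simp add: dual_solution_def)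
    moreover have "D_h \<Omega> \<T> \<Gamma>N \<nu> f F uD T
        = ereal (msum (\<lambda>X. - (1 / (2 * \<nu>)) * (dev (C X) \<bullet> dev (C X)) + dev (C X) \<bullet> AD X)
          - 1 / (2 * \<nu>) * msum (\<lambda>X. ?E X \<bullet> ?E X))"
      unfolding \<sigma>'(1) by (rule split[OF \<sigma>'(2-4)])
    ultimately have "1 / (2 * \<nu>) * msum (\<lambda>X. ?E X \<bullet> ?E X) \<le> 0"
      unfolding Dh by simp
    moreover have "0 < 1 / (2 * \<nu>)" using \<nu> by simp
    ultimately have le0: "msum (\<lambda>X. ?E X \<bullet> ?E X) \<le> 0" by (rule nonpos_of_mult_nonpos)
    have dev0: "dev (FT X + C' X - C X) = 0" if "X \<in> \<T>" for X
    proof -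
      have "?E X \<bullet> ?E X = 0"
        by (rule msum_nonneg_eq_0D[of "\<lambda>X. ?E X \<bullet> ?E X", OF le0 inner_ge_zero that])
      then have "?E X = 0" by (simp only: inner_eq_zero_iff)
      then show ?thesis unfolding E_def dev_diff .
    qed
    \<comment> \<open>Equal deviators leave only a spherical difference, with this factor.\<close>
    define q where "q X = trace (FT X + C' X - C X) / ?d" for X
    have q: "C' X - (C X - FT X) = q X *\<^sub>R mat 1" if "X \<in> \<T>" for X
    proof -
      have "FT X + C' X - C X = q X *\<^sub>R mat 1"
        using dev0[OF that] unfolding dev_def q_def by (simp only: right_minus_eq)
      moreover have "C' X - (C X - FT X) = FT X + C' X - C X" by simp
      ultimately show ?thesis by (rule trans[rotated])
    qed
    have aa: "a' X = a X" if "X \<in> \<T>" for X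
    proof -
      have "?d *\<^sub>R a' X = ?d *\<^sub>R a X" unfolding da \<sigma>'(4)[OF that] ..
      then show ?thesis by simp
    qed
    obtain c where c: "\<And>X. X \<in> \<T> \<Longrightarrow> q X = c" "\<Gamma>N \<noteq> {} \<Longrightarrow> c = 0"
    proof -
      have "\<exists>c. (\<forall>X\<in>\<T>. q X = c) \<and> (\<Gamma>N \<noteq> {} \<longrightarrow> c = 0)"
        by (rule RT_N_piecewise_spherical[OF pwrt_diff[OF \<sigma>'(3) \<sigma>] RT_N_diff[OF \<sigma>'(3,2) \<sigma> \<sigma>RT]])
          (simp_all only: q aa diff_self)
      then show thesis using that by blast
    qed
    have CC: "FT X + C' X = C X + c *\<^sub>R mat 1" if "X \<in> \<T>" for X
    proof -
      have "FT X + C' X = C X + (C' X - (C X - FT X))" by simp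
      then show ?thesis unfolding q[OF that] c(1)[OF that] .
    qed
    \<comment> \<open>In the pure Dirichlet case both trace integrals vanish, while they differ by
      \<open>c d\<close> times the total volume.\<close>
    have "c = 0"
    proof (cases "\<Gamma>N = {}")
      case True
      then have "msum (\<lambda>X. trace (FT X + C' X)) = 0"
        using T tr_int[OF pwrt_F_add[OF \<sigma>'(3)]] by (simp add: dual_solution_def \<sigma>'(1))
      moreover have "msum (\<lambda>X. trace (C X)) = 0" using norm[OF True] tr_int[OF Th] by simp
      moreover have "msum (\<lambda>X. trace (FT X + C' X)) = msum (\<lambda>X. trace (C X) + c * ?d)"
        by (rule msum_cong) (simp add: CC trace_add trace_scaleR trace_mat_1)
      ultimately have "msum (\<lambda>X. c * ?d) = 0" by (simp add: msum_add)
      moreover have "0 < (\<Sum>X\<in>\<T>. vol X)"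
      proof -
        obtain X where "X \<in> \<T>" using Dirichlet_side_exists by blast
        then show ?thesis using finite_mesh vol_pos by (intro sum_pos) auto
      qed
      ultimately show ?thesis by (simp add: msum_def sum_distrib_right[symmetric])
    qed (use c in simp)
    then show ?thesis
      using pwrtD[OF pwrt_F_add[OF \<sigma>'(3)]] pwrtD[OF Th] CC aa
      by (intro AE_interiorsI) (simp add: \<sigma>'(1))
  qed
qed

text \<open>The gradient \<open>G\<close> is such that \<open>\<nu> (G + AD)\<close> is the
  deviatoric mean stress. So the derivative of the primal functional, in the direction of an
  admissible difference, is the pairing of that difference with \<open>\<sigma> = T - F\<close> in
  the discrete integration by parts, hence zero.\<close>

lemma primal_from_dual:
  assumes T: "dual_solution \<Omega> \<T> \<Gamma>N \<nu> f F uD T"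
    and m: "dual_multiplier \<Omega> \<T> \<Gamma>N \<nu> uD T ubar"
  defines "u\<^sub>h \<equiv> \<lambda>x. ubar x + ((1 / \<nu>) *\<^sub>R dev (\<Pi>h \<T> T x) - gradh uD x) *v (x - \<Pi>h \<T> (\<lambda>y. y) x)"
  shows "primal_solution \<Omega> \<T> \<Gamma>D \<nu> f F uD u\<^sub>h"
    and "primal_solution \<Omega> \<T> \<Gamma>D \<nu> f F uD u \<Longrightarrow> AE x in lebesgue_on \<Omega>. u x = u\<^sub>h x"
proof -
  let ?d = "real CARD('n)"
  have "T \<in> K_T \<Omega> \<T> \<Gamma>N f F" using T by (simp add: dual_solution_def)
  then obtain \<sigma> C a where \<sigma>: "T = (\<lambda>x. F x + \<sigma> x)" "\<sigma> \<in> RT_N \<Omega> \<T> \<Gamma>N" "pwrt \<sigma> C a"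
    "\<And>X. X \<in> \<T> \<Longrightarrow> ?d *\<^sub>R a X = - fT X" by (rule K_T_E) blast
  have TC: "pwrt T (\<lambda>X. FT X + C X) a" unfolding \<sigma>(1) by (rule pwrt_F_add[OF \<sigma>(3)])
  obtain b where b: "\<And>X x. X \<in> \<T> \<Longrightarrow> x \<in> interior X \<Longrightarrow> ubar x = b X"
    using m unfolding dual_multiplier_def Pk_0_iff by metis
  have m': "- (1 / \<nu>) * l2_inner \<Omega> (\<lambda>x. dev (\<Pi>h \<T> T x)) (\<lambda>x. dev (\<Pi>h \<T> \<tau> x)) - l2_inner \<Omega> ubar (Divh \<tau>)
      = - l2_inner \<Omega> (gradh uD) (\<lambda>x. dev (\<Pi>h \<T> \<tau> x))" if "\<tau> \<in> RT_N \<Omega> \<T> \<Gamma>N" for \<tau>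
    using m that unfolding dual_multiplier_def by blast
  define G where "G X = (1 / \<nu>) *\<^sub>R dev (FT X + C X) - AD X" for X
  have uh: "pwaff u\<^sub>h b G"
    unfolding pwaff_def u\<^sub>h_def by (simp add: b \<Pi>h_pwrt[OF TC] gradh_pwaff[OF uD] \<Pi>h_id G_def)
  have trG: "trace (G X) = 0" if "X \<in> \<T>" for X
    by (simp add: G_def trace_sub trace_scaleR trace_dev divD[OF that])
  have uhCR: "u\<^sub>h \<in> CR_D \<T> \<Gamma>D"
  proof (rule CR_D_of_orthogonal[OF uh])
    fix \<tau> B c assume \<tau>: "pwrt \<tau> B c" "\<tau> \<in> RT_N \<Omega> \<T> \<Gamma>N"
    have "l2_inner \<Omega> (\<lambda>x. dev (\<Pi>h \<T> T x)) (\<lambda>x. dev (\<Pi>h \<T> \<tau> x)) = msum (\<lambda>X. dev (FT X + C X) \<bullet> dev (B X))"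
      by (rule l2_inner_const) (simp add: \<Pi>h_pwrt[OF TC] \<Pi>h_pwrt[OF \<tau>(1)])
    moreover have "l2_inner \<Omega> ubar (Divh \<tau>) = msum (\<lambda>X. ?d * (c X \<bullet> b X))"
      by (rule l2_inner_const) (simp add: b Divh_pwrt[OF \<tau>(1)] inner_commute)
    moreover have "l2_inner \<Omega> (gradh uD) (\<lambda>x. dev (\<Pi>h \<T> \<tau> x)) = msum (\<lambda>X. AD X \<bullet> dev (B X))"
      by (rule l2_inner_const) (simp add: gradh_pwaff[OF uD] \<Pi>h_pwrt[OF \<tau>(1)])
    ultimately have "- (1 / \<nu>) * msum (\<lambda>X. dev (FT X + C X) \<bullet> dev (B X)) - msum (\<lambda>X. ?d * (c X \<bullet> b X))
        = - msum (\<lambda>X. AD X \<bullet> dev (B X))"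
      using m'[OF \<tau>(2)] by simp
    moreover have "msum (\<lambda>X. G X \<bullet> B X + ?d * (c X \<bullet> b X))
        = msum (\<lambda>X. (1 / \<nu>) * (dev (FT X + C X) \<bullet> dev (B X)) - AD X \<bullet> dev (B X) + ?d * (c X \<bullet> b X))"
    proof (rule msum_cong)
      fix X assume X: "X \<in> \<T>"
      \<comment> \<open>\<open>G X\<close> is trace-free, so it pairs with the mean of the test
        field as with its deviator, the form in which the multiplier equation is given.\<close>
      have "G X \<bullet> B X = G X \<bullet> dev (B X)" by (rule inner_dev[OF trG[OF X], symmetric])
      also have "\<dots> = (1 / \<nu>) * (dev (FT X + C X) \<bullet> dev (B X)) - AD X \<bullet> dev (B X)"
        by (simp only: G_def inner_diff_left inner_scaleR_left)
      finally show "G X \<bullet> B X + ?d * (c X \<bullet> b X)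
        = (1 / \<nu>) * (dev (FT X + C X) \<bullet> dev (B X)) - AD X \<bullet> dev (B X) + ?d * (c X \<bullet> b X)" by simp
    qed
    ultimately show "msum (\<lambda>X. G X \<bullet> B X + ?d * (c X \<bullet> b X)) = 0"
      by (simp only: msum_add msum_diff msum_cmul)
  qed
  have uhK: "u\<^sub>h \<in> K_u \<Omega> \<T> \<Gamma>D" unfolding K_u_iff[OF uh] using uhCR trG by blast
  let ?\<psi> = "\<lambda>X. \<nu> / 2 * ((G X + AD X) \<bullet> (G X + AD X)) - fT X \<bullet> b X - FT X \<bullet> G X"
  have Ih: "I_h \<Omega> \<T> \<Gamma>D \<nu> f F uD u\<^sub>h = ereal (msum ?\<psi>)" by (rule I_h_eq[OF uh uhK])
  have split: "I_h \<Omega> \<T> \<Gamma>D \<nu> f F uD v = ereal (msum ?\<psi> + \<nu> / 2 * msum (\<lambda>X. (A X - G X) \<bullet> (A X - G X)))"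
    if v: "pwaff v c A" "v \<in> K_u \<Omega> \<T> \<Gamma>D" for v c A
  proof -
    have vCR: "v \<in> CR_D \<T> \<Gamma>D" and trA: "X \<in> \<T> \<Longrightarrow> trace (A X) = 0" for X
      using v(2) K_u_iff[OF v(1)] by blast+
    \<comment> \<open>This becomes the linear term of the energy: \<open>d a\<close> is
      \<open>- fT\<close>, and a trace-free difference pairs with the deviatoric stress as with the
      full stress \<open>FT + C\<close>.\<close>
    have 0: "msum (\<lambda>X. (A X - G X) \<bullet> C X + ?d * (a X \<bullet> (c X - b X))) = 0"
      by (rule discrete_integration_by_parts[OF pwaff_diff[OF v(1) uh] CR_D_diff[OF v(1) vCR uh uhCR] \<sigma>(3,2)])
    have "msum (\<lambda>X. \<nu> / 2 * ((A X + AD X) \<bullet> (A X + AD X)) - fT X \<bullet> c X - FT X \<bullet> A X)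
        = msum ?\<psi> + \<nu> / 2 * msum (\<lambda>X. (A X - G X) \<bullet> (A X - G X))"
    proof (rule msum_energy_split[OF _ 0])
      fix X assume X: "X \<in> \<T>"
      let ?E = "A X - G X"
      have AE: "A X + AD X = (G X + AD X) + ?E" by simp
      have "trace ?E = 0" by (simp add: trace_sub trA[OF X] trG[OF X])
      then have "?E \<bullet> dev (FT X + C X) = ?E \<bullet> (FT X + C X)" by (rule inner_dev)
      moreover have "\<nu> *\<^sub>R (G X + AD X) = dev (FT X + C X)" using \<nu> by (simp add: G_def)
      ultimately have 1: "\<nu> * ((G X + AD X) \<bullet> ?E) = ?E \<bullet> FT X + ?E \<bullet> C X"
        by (metis inner_commute inner_scaleR_left inner_add_right)
      have "\<nu> / 2 * ((A X + AD X) \<bullet> (A X + AD X))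
          = \<nu> / 2 * ((G X + AD X) \<bullet> (G X + AD X)) + \<nu> * ((G X + AD X) \<bullet> ?E) + \<nu> / 2 * (?E \<bullet> ?E)"
      proof -
        have "(A X + AD X) \<bullet> (A X + AD X) = (G X + AD X) \<bullet> (G X + AD X) + 2 * ((G X + AD X) \<bullet> ?E) + ?E \<bullet> ?E"
          unfolding AE inner_add_left[of _ ?E] inner_add_right[of _ _ ?E] by (simp add: inner_commute)
        then show ?thesis by (simp add: distrib_left)
      qed
      moreover have "?d * (a X \<bullet> (c X - b X)) = - (fT X \<bullet> c X) + fT X \<bullet> b X"
        unfolding inner_scaleR_left[symmetric] \<sigma>(4)[OF X] by (simp add: inner_diff_right)
      moreover have "?E \<bullet> FT X = FT X \<bullet> A X - FT X \<bullet> G X"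
        unfolding inner_diff_left by (simp only: inner_commute)
      ultimately show "\<nu> / 2 * ((A X + AD X) \<bullet> (A X + AD X)) - fT X \<bullet> c X - FT X \<bullet> A X
          = ?\<psi> X + (?E \<bullet> C X + ?d * (a X \<bullet> (c X - b X))) + \<nu> / 2 * (?E \<bullet> ?E)"
        unfolding 1 by linarith
    qed
    then show ?thesis using I_h_eq[OF v] by simp
  qed
  show "primal_solution \<Omega> \<T> \<Gamma>D \<nu> f F uD u\<^sub>h"
    unfolding primal_solution_def
  proof (intro conjI uhK ballI)
    fix v assume v: "v \<in> CR_D \<T> \<Gamma>D"
    then obtain c A where cA: "pwaff v c A" using CR_D_pwaff by blast
    show "I_h \<Omega> \<T> \<Gamma>D \<nu> f F uD u\<^sub>h \<le> I_h \<Omega> \<T> \<Gamma>D \<nu> f F uD v"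
    proof (cases "v \<in> K_u \<Omega> \<T> \<Gamma>D")
      case True
      have "0 \<le> \<nu> / 2 * msum (\<lambda>X. (A X - G X) \<bullet> (A X - G X))"
        using \<nu> by (intro mult_nonneg_nonneg msum_nonneg) auto
      then show ?thesis using split[OF cA True] Ih by simp
    next
      case False
      then show ?thesis by (simp add: I_h_def)
    qed
  qed
  show "AE x in lebesgue_on \<Omega>. u x = u\<^sub>h x" if u: "primal_solution \<Omega> \<T> \<Gamma>D \<nu> f F uD u"
  proof -
    have uK: "u \<in> K_u \<Omega> \<T> \<Gamma>D" using u by (simp add: primal_solution_def)
    then have uCR: "u \<in> CR_D \<T> \<Gamma>D" by (simp add: K_u_def)
    then obtain c A where cA: "pwaff u c A" using CR_D_pwaff by blast
    have "I_h \<Omega> \<T> \<Gamma>D \<nu> f F uD u \<le> I_h \<Omega> \<T> \<Gamma>D \<nu> f F uD u\<^sub>h"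
      using u uhCR by (simp add: primal_solution_def)
    then have "\<nu> / 2 * msum (\<lambda>X. (A X - G X) \<bullet> (A X - G X)) \<le> 0"
      using split[OF cA uK] Ih by simp
    moreover have "0 < \<nu> / 2" using \<nu> by simp
    ultimately have le0: "msum (\<lambda>X. (A X - G X) \<bullet> (A X - G X)) \<le> 0" by (rule nonpos_of_mult_nonpos)
    have AG: "A X - G X = 0" if "X \<in> \<T>" for X
    proof -
      have "(A X - G X) \<bullet> (A X - G X) = 0"
        by (rule msum_nonneg_eq_0D[of "\<lambda>X. (A X - G X) \<bullet> (A X - G X)", OF le0 inner_ge_zero that])
      then show ?thesis by (simp only: inner_eq_zero_iff)
    qed
    \<comment> \<open>The gradients agree, so the difference of the two velocities is piecewise
      constant.\<close>
    have "c X - b X = 0" if "X \<in> \<T>" for X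
      using CR_D_piecewise_constant[OF pwaff_diff[OF cA uh] CR_D_diff[OF cA uCR uh uhCR] AG that] .
    then show ?thesis
      using pwaffD[OF cA] pwaffD[OF uh] AG by (intro AE_interiorsI) simp
  qed
qed

end

theorem proposition1:
  fixes \<Omega> \<Gamma>D \<Gamma>N :: "(real^'n) set"
    and \<T> :: "(real^'n) set set"
    and \<nu> :: real
    and uD f :: "real^'n \<Rightarrow> real^'n"
    and F :: "real^'n \<Rightarrow> real^'n^'n"
  assumes "CARD('n) \<ge> 2"
    and "polyhedral_lipschitz_domain \<Omega>"
    and "boundary_parts \<Omega> \<Gamma>D \<Gamma>N"
    and "mesh_of \<Omega> \<Gamma>D \<Gamma>N \<T>"
    and "uD \<in> CR \<T>" and "AE x in lebesgue_on \<Omega>. divh uD x = 0"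
    and "f \<in> Pk 0 \<T>" and "F \<in> Pk 0 \<T>"
    and "\<nu> > 0"
  shows
    "(\<forall>u p T\<^sub>h.
        primal_solution \<Omega> \<T> \<Gamma>D \<nu> f F uD u \<and>
        primal_multiplier \<Omega> \<T> \<Gamma>D \<Gamma>N \<nu> f F uD u p \<and>
        T\<^sub>h = (\<lambda>x. \<nu> *\<^sub>R gradh (\<lambda>y. u y + uD y) x - p x *\<^sub>R mat 1
                   - (1 / real CARD('n)) *\<^sub>R (f x \<otimes>\<^sub>v (x - \<Pi>h \<T> (\<lambda>y. y) x))) \<longrightarrow>
        dual_solution \<Omega> \<T> \<Gamma>N \<nu> f F uD T\<^sub>h \<and>
        (\<forall>T. dual_solution \<Omega> \<T> \<Gamma>N \<nu> f F uD T \<longrightarrow> (AE x in lebesgue_on \<Omega>. T x = T\<^sub>h x)))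
     \<and>
     (\<forall>T ubar u\<^sub>h.
        dual_solution \<Omega> \<T> \<Gamma>N \<nu> f F uD T \<and>
        dual_multiplier \<Omega> \<T> \<Gamma>N \<nu> uD T ubar \<and>
        u\<^sub>h = (\<lambda>x. ubar x + ((1 / \<nu>) *\<^sub>R dev (\<Pi>h \<T> T x) - gradh uD x) *v
                              (x - \<Pi>h \<T> (\<lambda>y. y) x)) \<longrightarrow>
        primal_solution \<Omega> \<T> \<Gamma>D \<nu> f F uD u\<^sub>h \<and>
        (\<forall>u. primal_solution \<Omega> \<T> \<Gamma>D \<nu> f F uD u \<longrightarrow> (AE x in lebesgue_on \<Omega>. u x = u\<^sub>h x)))"
proof -
  interpret mesh \<Omega> \<Gamma>D \<Gamma>N \<T> by unfold_locales (rule assms)+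
  obtain bD AD where uD: "pwaff uD bD AD"
    using assms(5) Pk_1_iff_pwaff[of uD] by (auto simp: CR_def)
  have divD: "trace (AD T) = 0" if "T \<in> \<T>" for T
    using AE_constD[OF assms(6) that] divh_pwaff[OF uD that] by metis
  obtain fT where fT: "\<And>T x. T \<in> \<T> \<Longrightarrow> x \<in> interior T \<Longrightarrow> f x = fT T"
    using assms(7) unfolding Pk_0_iff by metis
  obtain FT where FT: "\<And>T x. T \<in> \<T> \<Longrightarrow> x \<in> interior T \<Longrightarrow> F x = FT T"
    using assms(8) unfolding Pk_0_iff by metis
  interpret discrete_Stokes \<Omega> \<Gamma>D \<Gamma>N \<T> \<nu> uD f F bD fT AD FT
    by unfold_locales (fact assms(9) uD divD fT FT)+
  show ?thesis
    using dual_from_primal primal_from_dual by blast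
qed

end
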